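(* Fix an integer $p\geq 3$ and $(\beta,h)\in(0,\infty)^2$, and let $\bm X=(X_1,\ldots,X_N)$ be a sample from the $p$-spin Curie-Weiss model $\mathbb{P}_{\beta,h,p}$ (defined in the context), with magnetization $S_N=\sum_{i=1}^N X_i$. Then there exists a constant $C>0$ such that the following hold. \begin{enumerate} \item If $(\beta,h)$ is $p$-regular, with $m_*$ the unique global maximizer of $H=H_{\beta,h,p}$, then for each $r\in\{0,1\}$, $$\frac{\mathbb{P}\left((-1)^r \frac{S_N-Nm_*}{\sqrt{-N/H''(m_* )}}>x\right)}{1-\Phi(x)} = 1 + (1+ x^3)\, O\left(\frac{1}{\sqrt{N}}\right)$$ for all $x\in [0,CN^{1/6}]$. \item If $(\beta,h)$ is $p$-critical, then for any global maximizer $m$ of $H$, any neighborhood $A$ of $m$ whose closure contains no other global maximizer of $H$, and each $r\in\{0,1\}$, $$\frac{\mathbb{P}\left((-1)^r \frac{S_N-Nm}{\sqrt{-N/H''(m)}}>x\,\Big|\,\frac{S_N}{N}\in A\right)}{1-\Phi(x)} = 1 + (1+ x^3)\, O\left(\frac{1}{\sqrt{N}}\right)$$ for all $x\in [0,CN^{1/6}]$. \item If $(\beta,h)$ is $p$-special, with $m_*$ the unique global maximizer of $H$, then for each $r\in\{0,1\}$, $$\frac{\mathbb{P}\left((-1)^r\frac{S_N-Nm_*}{N^{3/4}}>x\right)}{1-F(x)} = 1 + (1+ x^{5})\, O\left(\frac{1}{N^{1/4}}\right)$$ for all $x\in [0,CN^{1/20}]$, where $F$ is the distribution function with Lebesgue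 density $$\frac{\mathrm dF(x)}{\mathrm dx} = \frac{2}{\Gamma(1/4)}\left(-\frac{H^{(4)}(m_* )}{24}\right)^{1/4}\exp\left(\frac{H^{(4)}(m_* )}{24} x^4\right),\quad x\in\mathbb{R},$$ and $H^{(4)}$ denotes the fourth derivative of $H$. \end{enumerate}
   Context: For $p\geq 2$, $\beta>0$, $h>0$, the $p$-spin Curie-Weiss model is the probability measure on $\{-1,1\}^N$ given by $$\mathbb{P}_{\beta,h,p}(\bm X) = \frac{\exp\left\{\beta N^{1-p}\sum_{1\leq i_1,\ldots,i_p\leq N} X_{i_1}\cdots X_{i_p} + h\sum_{i=1}^N X_i\right\}}{2^N Z_N(\beta,h,p)},$$ with $Z_N(\beta,h,p)$ the normalizing constant. Let $I(x)=\frac12\{(1+x)\log(1+x)+(1-x)\log(1-x)\}$ and $H(x)=H_{\beta,h,p}(x)=\beta x^p+hx-I(x)$ for $x\in[-1,1]$. A global maximizer of $H$ is a point of $[-1,1]$ at which $H$ attains its maximum over $[-1,1]$ (such points lie in $(-1,1)$). The point $(\beta,h)$ is called $p$-regular if $H$ has a unique global maximizer $m_*\in(-1,1)$ and $H''(m_* )<0$; $p$-special if $H$ has a unique global maximizer $m_*\in(-1,1)$ and $H''(m_* )=0$; and $p$-critical if $H$ has more than one global maximizer. $\Phi$ is the standard normal distribution function. The $O(\cdot)$ terms are uniform in $x$ over the stated ranges, with constants not depending on $N$ or $x$. *)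

theory Defs
  imports "HOL-Probability.Probability"
begin

text \<open>Entropy-type function I and the function H = H_{beta,h,p}.
  Note: in Isabelle ln 0 = 0, so the convention 0 log 0 = 0 at x = +-1 holds.\<close>
definition I_fun :: "real \<Rightarrow> real" where
  "I_fun x = ((1 + x) * ln (1 + x) + (1 - x) * ln (1 - x)) / 2"

definition H_fun :: "real \<Rightarrow> real \<Rightarrow> nat \<Rightarrow> real \<Rightarrow> real" where
  "H_fun \<beta> h p x = \<beta> * x ^ p + h * x - I_fun x"

definition is_global_max :: "real \<Rightarrow> real \<Rightarrow> nat \<Rightarrow> real \<Rightarrow> bool" where
  "is_global_max \<beta> h p m \<longleftrightarrow>
     m \<in> {-1..1} \<and> (\<forall>y\<in>{-1..1}. H_fun \<beta> h p y \<le> H_fun \<beta> h p m)"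

definition p_regular :: "real \<Rightarrow> real \<Rightarrow> nat \<Rightarrow> bool" where
  "p_regular \<beta> h p \<longleftrightarrow>
     (\<exists>!m. is_global_max \<beta> h p m) \<and>
     (\<forall>m. is_global_max \<beta> h p m \<longrightarrow> m \<in> {-1<..<1} \<and> (deriv ^^ 2) (H_fun \<beta> h p) m < 0)"

definition p_special :: "real \<Rightarrow> real \<Rightarrow> nat \<Rightarrow> bool" where
  "p_special \<beta> h p \<longleftrightarrow>
     (\<exists>!m. is_global_max \<beta> h p m) \<and>
     (\<forall>m. is_global_max \<beta> h p m \<longrightarrow> m \<in> {-1<..<1} \<and> (deriv ^^ 2) (H_fun \<beta> h p) m = 0)"

definition p_critical :: "real \<Rightarrow> real \<Rightarrow> nat \<Rightarrow> bool" where
  "p_critical \<beta> h p \<longleftrightarrow>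
     (\<exists>m1 m2. m1 \<noteq> m2 \<and> is_global_max \<beta> h p m1 \<and> is_global_max \<beta> h p m2)"

definition cw_configs :: "nat \<Rightarrow> (nat \<Rightarrow> real) set" where
  "cw_configs N = {0..<N} \<rightarrow>\<^sub>E {-1, 1}"

definition magnetization :: "nat \<Rightarrow> (nat \<Rightarrow> real) \<Rightarrow> real" where
  "magnetization N X = (\<Sum>i<N. X i)"

definition cw_weight :: "real \<Rightarrow> real \<Rightarrow> nat \<Rightarrow> nat \<Rightarrow> (nat \<Rightarrow> real) \<Rightarrow> real" where
  "cw_weight \<beta> h p N X =
     exp (\<beta> * real N powr (1 - real p) *
            (\<Sum>f\<in>{0..<p} \<rightarrow>\<^sub>E {0..<N}. \<Prod>k<p. X (f k))
          + h * (\<Sum>i<N. X i))"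

definition cw_Z :: "real \<Rightarrow> real \<Rightarrow> nat \<Rightarrow> nat \<Rightarrow> real" where
  "cw_Z \<beta> h p N = (\<Sum>X\<in>cw_configs N. cw_weight \<beta> h p N X) / 2 ^ N"

definition cw_prob :: "real \<Rightarrow> real \<Rightarrow> nat \<Rightarrow> nat \<Rightarrow> ((nat \<Rightarrow> real) \<Rightarrow> bool) \<Rightarrow> real" where
  "cw_prob \<beta> h p N E =
     (\<Sum>X\<in>{X\<in>cw_configs N. E X}. cw_weight \<beta> h p N X / (2 ^ N * cw_Z \<beta> h p N))"

definition cw_cond_prob :: "real \<Rightarrow> real \<Rightarrow> nat \<Rightarrow> nat \<Rightarrow> ((nat \<Rightarrow> real) \<Rightarrow> bool)
    \<Rightarrow> ((nat \<Rightarrow> real) \<Rightarrow> bool) \<Rightarrow> real" where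
  "cw_cond_prob \<beta> h p N E G = cw_prob \<beta> h p N (\<lambda>X. E X \<and> G X) / cw_prob \<beta> h p N G"

definition Phi :: "real \<Rightarrow> real" where
  "Phi x = (LBINT t:{..x}. std_normal_density t)"

text \<open>Distribution function F with density 2/Gamma(1/4) * (-c/24)^(1/4) * exp(c/24 t^4), c = H''''(m).\<close>
definition F_special :: "real \<Rightarrow> real \<Rightarrow> real" where
  "F_special c x = (LBINT t:{..x}.
      2 / Gamma (1/4) * (- c / 24) powr (1/4) * exp (c / 24 * t ^ 4))"

end

theory Submission
  imports Defs "HOL-Real_Asymp.Real_Asymp"
begin

text \<open>
  Given the magnetization, all configurations have the same weight, so the law of \<open>S / N\<close> is
  proportional to \<open>(N choose k) * exp (N * (H s + I s))\<close> at \<open>s = (2 * k - N) / N\<close>. Stirling's formula turns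
  this into \<open>exp (N * H s)\<close> up to a prefactor that varies slowly in \<open>s\<close>. In the three cases the first
  non-vanishing derivative of \<open>H\<close> at the maximizer \<open>m\<close> is negative and of even order \<open>d\<close> (2 or 4); hence,
  with \<open>t = (S - N * m) / N powr (1 - 1 / d)\<close>, the weights are a constant times \<open>exp (- a * t ^ d)\<close> with
  relative error \<open>(1 + \<bar>t\<bar> ^ (d + 1)) * O(N powr (- 1 / d))\<close> as long as \<open>\<bar>t\<bar>\<close> is of order
  \<open>N powr (1 / (d * (d + 1)))\<close>, and everything beyond this window is negligible. The tail sum over the
  lattice is then compared with the tail integral \<open>Q\<close> of \<open>exp (- a * t ^ d)\<close>, using only that \<open>Q\<close>
  decreases to 0 with derivative \<open>- exp (- a * t ^ d)\<close>. All normalizing constants cancel in the ratio of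
  a tail to the total mass, and the left tail is the right tail for \<open>H (- s)\<close>.

  At a special point the fourth derivative must be shown to be negative, and in the critical case
  the second one; both follow from the unimodality of \<open>x ^ (p - 2) * (1 - x\<^sup>2)\<close> on (0, 1).
\<close>

section \<open>Stirling's formula and binomial coefficients\<close>

text \<open>The obstacle is that every error must be relative to \<open>Q x\<close>, and at the end
  of the range \<open>Q x\<close> itself is only of the order
  \<open>exp (- const * N powr (1 / 3))\<close> for \<open>d = 2\<close> and
  \<open>exp (- const * N powr (1 / 5))\<close> for \<open>d = 4\<close>, up to powers of
  \<open>N\<close>. Hence a bound in terms of \<open>f x\<close> is of no use until
  \<open>f x\<close> is bounded by a polynomial times \<open>Q x\<close>. The factor
  \<open>1 + t ^ (d + 1)\<close> of the pointwise error must stay inside the sum, where its tail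
  costs only the same factor at \<open>x\<close>. And the cut between near and far levels must lie
  at a large multiple of the window, so that what is discarded is small even against the smallest
  \<open>Q x\<close>. The exponents 1/6 and 1/20 mark the distance up to which the Taylor remainder
  \<open>N * \<bar>s - m\<bar> ^ (d + 1)\<close> stays bounded.\<close>

lemma ln_one_plus_upper:
  fixes x :: real
  assumes "x > 0"
  shows "ln (1 + x) \<le> x * (2 + x) / (2 * (1 + x))"
proof -
  define g where "g = (\<lambda>x::real. x * (2 + x) / (2 * (1 + x)) - ln (1 + x))"
  have "g 0 \<le> g x"
  proof (rule DERIV_nonneg_imp_nondecreasing[of 0 x g])
    show "0 \<le> x" using assms by simp
    fix y :: real assume y: "0 \<le> y" "y \<le> x"
    have "(g has_real_derivative (y\<^sup>2 / (2 * (1 + y)\<^sup>2))) (at y)"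
      unfolding g_def using y
      by (auto intro!: derivative_eq_intros) (simp add: divide_simps power2_eq_square; simp add: algebra_simps)
    thus "\<exists>z. (g has_real_derivative z) (at y) \<and> 0 \<le> z" by force
  qed
  thus ?thesis by (simp add: g_def)
qed

text \<open>The bound is the midpoint rule for the convex integrand 1 / (1 + t) on [0, x]; the upper
  bound before it is the trapezoid rule. At \<open>x = 1 / n\<close>, multiplied by
  \<open>n + 1 / 2\<close>, the two rules give exactly 1 and
  \<open>1 + (1 / (4 * n) - 1 / (4 * (n + 1)))\<close>, so the error in Stirling's formula
  telescopes.\<close>

lemma ln_one_plus_lower:
  fixes x :: real
  assumes "x > 0"
  shows "2 * x / (2 + x) \<le> ln (1 + x)"
proof -
  define g where "g = (\<lambda>x::real. ln (1 + x) - 2 * x / (2 + x))"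
  have "g 0 \<le> g x"
  proof (rule DERIV_nonneg_imp_nondecreasing[of 0 x g])
    show "0 \<le> x" using assms by simp
    fix y :: real assume y: "0 \<le> y" "y \<le> x"
    have "(g has_real_derivative (y\<^sup>2 / ((1 + y) * (2 + y)\<^sup>2))) (at y)"
      unfolding g_def using y
      by (auto intro!: derivative_eq_intros) (simp add: divide_simps power2_eq_square; simp add: algebra_simps)
    thus "\<exists>z. (g has_real_derivative z) (at y) \<and> 0 \<le> z" using y by force
  qed
  thus ?thesis by (simp add: g_def)
qed

text \<open>The value of the constant (half the logarithm of \<open>2\<pi>\<close>) cancels in all probability ratios,
  so it is left unspecified.\<close>
lemma stirling:
  "\<exists>c::real. \<forall>n\<ge>1. \<bar>ln (fact n) - ((real n + 1/2) * ln (real n) - real n + c)\<bar> \<le> 1 / (4 * real n)"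
proof -
  define D where "D = (\<lambda>n::nat. ln (fact n) - (real n + 1/2) * ln (real n) + real n)"
  have step: "0 \<le> D n - D (Suc n)" "D n - D (Suc n) \<le> 1 / (4 * real n) - 1 / (4 * real (Suc n))"
    if n: "n \<ge> 1" for n
  proof -
    have *: "ln (1 + real n) = ln (real n) + ln (1 + 1 / real n)"
    proof -
      have "1 + real n = real n * (1 + 1 / real n)" using n by (simp add: field_simps)
      also have "ln \<dots> = ln (real n) + ln (1 + 1 / real n)"
        using n by (intro ln_mult_pos) (auto simp: add_pos_pos)
      finally show ?thesis .
    qed
    have lf: "ln (fact (Suc n) :: real) = ln (1 + real n) + ln (fact n)"
      using n by (simp add: ln_mult)
    have eq: "D n - D (Suc n) = (real n + 1/2) * ln (1 + 1 / real n) - 1"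
      unfolding D_def lf using * by (simp add: algebra_simps)
    have "2 * (1 / real n) / (2 + 1 / real n) \<le> ln (1 + 1 / real n)"
      using n by (intro ln_one_plus_lower) auto
    hence "(real n + 1/2) * (2 * (1 / real n) / (2 + 1 / real n)) \<le> (real n + 1/2) * ln (1 + 1 / real n)"
      by (intro mult_left_mono) auto
    also have "(real n + 1/2) * (2 * (1 / real n) / (2 + 1 / real n)) = 1"
      using n by (simp add: divide_simps)
    finally show "0 \<le> D n - D (Suc n)" unfolding eq by simp
    have "ln (1 + 1 / real n) \<le> (1 / real n) * (2 + 1 / real n) / (2 * (1 + 1 / real n))"
      using n by (intro ln_one_plus_upper) auto
    hence "(real n + 1/2) * ln (1 + 1 / real n) \<le>
       (real n + 1/2) * ((1 / real n) * (2 + 1 / real n) / (2 * (1 + 1 / real n)))"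
      by (intro mult_left_mono) auto
    also have "\<dots> = 1 + (1 / (4 * real n) - 1 / (4 * real (Suc n)))"
      using n by (simp add: divide_simps) (simp add: algebra_simps)
    finally show "D n - D (Suc n) \<le> 1 / (4 * real n) - 1 / (4 * real (Suc n))" unfolding eq by simp
  qed
  \<comment> \<open>\<open>D\<close> decreases, \<open>E\<close> increases, and they differ by
    \<open>1 / (4 * n)\<close>. Their common limit lies between them, which is the stated error
    bound.\<close>
  define E where "E = (\<lambda>n::nat. D n - 1 / (4 * real n))"
  have Dmono: "D (Suc n + k) \<le> D (Suc n)" and Emono: "E (Suc n) \<le> E (Suc n + k)" for n k
  proof -
    show "D (Suc n + k) \<le> D (Suc n)"
    proof (induction k)
      case (Suc k) thus ?case using step(1)[of "Suc n + k"] by simp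
    qed simp
    show "E (Suc n) \<le> E (Suc n + k)"
    proof (induction k)
      case (Suc k) thus ?case using step(2)[of "Suc n + k"] by (simp add: E_def)
    qed simp
  qed
  have "decseq (\<lambda>n. D (Suc n))"
    by (rule decseq_SucI) (use step(1) in fastforce)
  moreover have "E 1 \<le> D (Suc n)" for n
  proof -
    have "E 1 \<le> E (Suc n)" using Emono[of 0 n] by simp
    also have "\<dots> \<le> D (Suc n)" by (simp add: E_def)
    finally show ?thesis .
  qed
  ultimately obtain c where c: "(\<lambda>n. D (Suc n)) \<longlonglongrightarrow> c"
    using decseq_convergent[of "\<lambda>n. D (Suc n)" "E 1"] by blast
  have bd: "c \<le> D (Suc n)" "D (Suc n) - 1 / (4 * real (Suc n)) \<le> c" for n
  proof -
    have c': "(\<lambda>k. D (Suc n + k)) \<longlonglongrightarrow> c"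
      using LIMSEQ_ignore_initial_segment[OF c, of n] by (simp add: add.commute)
    show "c \<le> D (Suc n)"
      by (rule LIMSEQ_le_const2[OF c']) (use Dmono in auto)
    have "E (Suc n) \<le> D (Suc n + k)" for k
      using Emono[of n k] by (simp add: E_def) (smt (verit) divide_nonneg_nonneg of_nat_0_le_iff)
    hence "E (Suc n) \<le> c" by (intro LIMSEQ_le_const[OF c']) auto
    thus "D (Suc n) - 1 / (4 * real (Suc n)) \<le> c" by (simp add: E_def)
  qed
  show ?thesis
  proof (intro exI[of _ c] allI impI)
    fix n :: nat assume "n \<ge> 1"
    then obtain j where "n = Suc j" by (cases n) auto
    hence "c \<le> D n" "D n - 1 / (4 * real n) \<le> c" using bd[of j] by auto
    thus "\<bar>ln (fact n) - ((real n + 1/2) * ln (real n) - real n + c)\<bar> \<le> 1 / (4 * real n)"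
      unfolding D_def by linarith
  qed
qed

text \<open>The magnetization per site of a configuration with exactly \<open>k\<close> plus spins
  among \<open>N\<close>.\<close>

definition spin :: "nat \<Rightarrow> nat \<Rightarrow> real" where
  "spin N k = (2 * real k - real N) / real N"

lemma entropy_spin:
  assumes "0 < k" "k < N"
  shows "real N * I_fun (spin N k) =
    real N * ln 2 + real k * ln (real k) + real (N - k) * ln (real (N - k)) - real N * ln (real N)"
proof -
  have 1: "1 + spin N k = 2 * real k / real N" "1 - spin N k = 2 * real (N - k) / real N"
    using assms by (auto simp: spin_def field_simps of_nat_diff)
  have l: "ln (2 * real k / real N) = ln 2 + ln (real k) - ln (real N)"
    "ln (2 * real (N - k) / real N) = ln 2 + ln (real (N - k)) - ln (real N)"
    using assms by (auto simp: ln_mult ln_div simp del: of_nat_diff)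
  have N: "real N = real k + real (N - k)" using assms by simp
  have "real N * I_fun (spin N k) = real k * ln (2 * real k / real N) + real (N - k) * ln (2 * real (N - k) / real N)"
    unfolding I_fun_def 1 using assms by (simp add: field_simps)
  also have "\<dots> = (real k + real (N - k)) * ln 2 + real k * ln (real k) + real (N - k) * ln (real (N - k))
      - (real k + real (N - k)) * ln (real N)"
    unfolding l by (simp add: algebra_simps)
  finally show ?thesis using N by metis
qed

text \<open>A single binomial probability with success rate \<open>k / N\<close> is at most 1.
  Unlike Stirling's formula this also covers \<open>k = 0\<close> and \<open>k = N\<close>, where
  the entropy is \<open>ln 2\<close>; it serves the levels far from the maximizer.\<close>

lemma binomial_entropy_upper:
  assumes "N \<ge> 1" "k \<le> N"
  shows "real (N choose k) \<le> 2 ^ N * exp (- real N * I_fun (spin N k))"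
proof -
  consider "k = 0" | "k = N" | "0 < k" "k < N" using assms by linarith
  thus ?thesis
  proof cases
    case 1
    hence "spin N k = -1" using assms by (simp add: spin_def)
    hence "- real N * I_fun (spin N k) = - (real N * ln 2)" by (simp add: I_fun_def)
    hence "exp (- real N * I_fun (spin N k)) = inverse (2 ^ N)"
      by (simp only: exp_minus exp_of_nat_mult exp_ln zero_less_numeral)
    thus ?thesis using 1 by simp
  next
    case 2
    hence "spin N k = 1" using assms by (simp add: spin_def)
    hence "- real N * I_fun (spin N k) = - (real N * ln 2)" by (simp add: I_fun_def)
    hence "exp (- real N * I_fun (spin N k)) = inverse (2 ^ N)"
      by (simp only: exp_minus exp_of_nat_mult exp_ln zero_less_numeral)
    thus ?thesis using 2 by simp
  next
    case 3
    define q where "q = real k / real N"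
    have q: "1 - q = real (N - k) / real N" "0 < q" "q < 1"
      using 3 by (auto simp: q_def field_simps of_nat_diff)
    have "real (N choose k) * q ^ k * (1 - q) ^ (N - k) \<le> (\<Sum>i\<le>N. real (N choose i) * q ^ i * (1 - q) ^ (N - i))"
      by (rule member_le_sum) (use 3 q in auto)
    also have "\<dots> = 1" using binomial_ring[of q "1 - q" N] by simp
    finally have *: "real (N choose k) * (q ^ k * (1 - q) ^ (N - k)) \<le> 1" by (simp add: mult.assoc)
    have "ln (q ^ k * (1 - q) ^ (N - k)) = real k * ln q + real (N - k) * ln (1 - q)"
      using q(2,3) by (simp add: ln_mult ln_realpow del: of_nat_diff)
    also have "\<dots> = real k * (ln (real k) - ln (real N)) + real (N - k) * (ln (real (N - k)) - ln (real N))"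
      unfolding q(1) unfolding q_def using 3 by (simp add: ln_div)
    also have "\<dots> = real k * ln (real k) + real (N - k) * ln (real (N - k)) - (real k + real (N - k)) * ln (real N)"
      by (simp add: algebra_simps)
    also have "real k + real (N - k) = real N" using 3 by simp
    also have "real k * ln (real k) + real (N - k) * ln (real (N - k)) - real N * ln (real N)
       = real N * I_fun (spin N k) - real N * ln 2" using entropy_spin[OF 3] by simp
    finally have "q ^ k * (1 - q) ^ (N - k) = exp (real N * I_fun (spin N k) - real N * ln 2)"
      using q by (metis exp_ln mult_pos_pos zero_less_power diff_gt_0_iff_gt)
    also have "\<dots> = exp (real N * I_fun (spin N k)) / 2 ^ N"
      by (simp add: exp_diff exp_of_nat_mult)
    finally have e: "q ^ k * (1 - q) ^ (N - k) = exp (real N * I_fun (spin N k)) / 2 ^ N" .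
    show ?thesis using * unfolding e by (simp add: exp_minus field_simps)
  qed
qed

text \<open>Three applications of Stirling's formula. The half logarithms of \<open>N\<close>,
  \<open>k\<close> and \<open>N - k\<close> combine into the two prefactor terms because
  \<open>1 - (spin N k)\<^sup>2\<close> equals \<open>4 * k * (N - k) / N\<^sup>2\<close>.\<close>

lemma ln_binomial_approx:
  "\<exists>c. \<forall>N k. 0 < k \<longrightarrow> k < N \<longrightarrow>
     \<bar>ln (real (N choose k)) - (real N * ln 2 - real N * I_fun (spin N k) - ln (real N) / 2
        - ln (1 - (spin N k)\<^sup>2) / 2 + c)\<bar> \<le> 1 / (4 * real N) + 1 / (4 * real k) + 1 / (4 * real (N - k))"
proof -
  obtain c where c: "\<And>n. n \<ge> 1 \<Longrightarrow> \<bar>ln (fact n) - ((real n + 1/2) * ln (real n) - real n + c)\<bar> \<le> 1 / (4 * real n)"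
    using stirling by blast
  show ?thesis
  \<comment> \<open>The three Stirling constants leave \<open>- c\<close>, and the factor 4 in
    \<open>1 - (spin N k)\<^sup>2\<close> contributes \<open>ln 2\<close>.\<close>
  proof (intro exI[of _ "ln 2 - c"] allI impI)
    fix N k :: nat assume k: "0 < k" "k < N"
    have "real (N choose k) = fact N / (fact k * fact (N - k))"
      using k by (simp add: binomial_fact)
    hence 1: "ln (real (N choose k)) = ln (fact N) - ln (fact k) - ln (fact (N - k))"
      by (simp add: ln_div ln_mult)
    have "1 - (spin N k)\<^sup>2 = (1 + spin N k) * (1 - spin N k)" by (simp add: power2_eq_square algebra_simps)
    also have "\<dots> = (2 * real k / real N) * (2 * real (N - k) / real N)"
      using k by (simp add: spin_def field_simps of_nat_diff)
    finally have 2: "ln (1 - (spin N k)\<^sup>2) = 2 * ln 2 + ln (real k) + ln (real (N - k)) - 2 * ln (real N)"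
      using k ln_mult[of 2 "2::real"] by (simp add: ln_mult ln_div del: of_nat_diff)
    have N: "real (N - k) = real N - real k" using k by simp
    show "\<bar>ln (real (N choose k)) - (real N * ln 2 - real N * I_fun (spin N k) - ln (real N) / 2
        - ln (1 - (spin N k)\<^sup>2) / 2 + (ln 2 - c))\<bar> \<le> 1 / (4 * real N) + 1 / (4 * real k) + 1 / (4 * real (N - k))"
    proof -
      define L where "L = ln (real (N - k))"
      have a: "\<bar>ln (fact N) - ((real N + 1/2) * ln (real N) - real N + c)\<bar> \<le> 1 / (4 * real N)"
        "\<bar>ln (fact k) - ((real k + 1/2) * ln (real k) - real k + c)\<bar> \<le> 1 / (4 * real k)"
        "\<bar>ln (fact (N - k)) - ((real (N - k) + 1/2) * L - real (N - k) + c)\<bar> \<le> 1 / (4 * real (N - k))"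
        unfolding L_def using c[of N] c[of k] c[of "N - k"] k by (simp_all del: of_nat_diff)
      show ?thesis using a unfolding 1 2 entropy_spin[OF k] L_def[symmetric]
        by (simp add: algebra_simps N[symmetric] add_divide_distrib diff_divide_distrib del: of_nat_diff) (simp add: N algebra_simps; linarith)
    qed
  qed
qed

section \<open>Tails of the limit density and their Riemann sums\<close>

text \<open>Used to compare tails through their derivatives, with no integral written down.\<close>

lemma nonneg_of_deriv_nonpos_limit_0:
  fixes g :: "real \<Rightarrow> real"
  assumes "\<And>t. t \<ge> x \<Longrightarrow> \<exists>D. (g has_real_derivative D) (at t) \<and> D \<le> 0"
    and "(g \<longlongrightarrow> 0) at_top"
  shows "g x \<ge> 0"
proof -
  have "g t \<le> g x" if "t \<ge> x" for t
    using that assms(1) by (intro DERIV_nonpos_imp_nonincreasing[of x t g]) auto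
  hence "\<forall>\<^sub>F t in at_top. g t \<le> g x"
    by (intro eventually_mono[OF eventually_ge_at_top[of x]])
  thus ?thesis using assms(2) tendsto_upperbound[of g 0 at_top "g x"] by simp
qed

lemma one_plus_power_le:
  fixes x :: real
  assumes "x \<ge> 0"
  shows "(1 + x) ^ n \<le> 2 ^ n * (1 + x ^ n)"
proof -
  have "(1 + x) ^ n \<le> (2 * max 1 x) ^ n" using assms by (intro power_mono) auto
  also have "\<dots> = 2 ^ n * max 1 x ^ n" by (simp add: power_mult_distrib)
  also have "max 1 x ^ n \<le> 1 + x ^ n" using assms by (auto simp: max_def)
  finally show ?thesis by simp
qed

text \<open>The step inequality charges a lattice point to the interval on its left, which must lie
  in [x, \<infinity>). Only the first point beyond \<open>x\<close> has no such interval; it lies in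
  (x, x + \<epsilon>] and is paid for by \<open>G\<close>. Monotonicity of \<open>g\<close> is
  avoided because the lemma is also applied to \<open>t ^ (d + 1) * f t\<close>.\<close>

lemma telescope_sum_upper:
  fixes g \<Psi> :: "real \<Rightarrow> real" and \<tau> \<epsilon> x G :: real
  defines "t \<equiv> \<lambda>k::nat. \<tau> + \<epsilon> * real k"
  assumes "\<epsilon> > 0" "\<tau> \<le> x" "finite J" "\<And>k. k \<in> J \<Longrightarrow> t k > x"
    and gnn: "\<And>s. s > x \<Longrightarrow> g s \<ge> 0"
    and gG: "\<And>s. x < s \<Longrightarrow> s \<le> x + \<epsilon> \<Longrightarrow> g s \<le> G"
    and step: "\<And>s. s \<ge> x \<Longrightarrow> \<epsilon> * g (s + \<epsilon>) \<le> \<Psi> s - \<Psi> (s + \<epsilon>)"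
    and \<Psi>nn: "\<And>s. s \<ge> x \<Longrightarrow> \<Psi> s \<ge> 0"
    and \<Psi>mono: "\<And>s. s \<ge> x \<Longrightarrow> \<Psi> s \<le> \<Psi> x"
  shows "(\<Sum>k\<in>J. \<epsilon> * g (t k)) \<le> \<epsilon> * G + \<Psi> x"
proof -
  define P where "P = (\<lambda>k. t k > x)"
  define k1 where "k1 = (LEAST k. P k)"
  have "\<exists>k. P k"
  proof -
    obtain k :: nat where "real k > (x - \<tau>) / \<epsilon>" using reals_Archimedean2 by blast
    hence "P k" using \<open>\<epsilon> > 0\<close> by (auto simp: P_def t_def field_simps)
    thus ?thesis ..
  qed
  hence Pk1: "P k1" unfolding k1_def by (rule LeastI_ex)
  have least: "k1 \<le> k" if "P k" for k unfolding k1_def using that by (rule Least_le)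
  \<comment> \<open>\<open>\<tau> \<le> x\<close> says that the lattice starts at or before
    \<open>x\<close>, so the point of index \<open>k1 - 1\<close> exists and is at most
    \<open>x\<close>.\<close>
  have "k1 \<noteq> 0" using Pk1 \<open>\<tau> \<le> x\<close> unfolding P_def t_def by (metis add.right_neutral linorder_not_le mult_zero_right of_nat_0)
  hence "\<not> P (k1 - 1)" using least[of "k1 - 1"] by linarith
  hence tk1: "x < t k1" "t k1 \<le> x + \<epsilon>"
    using Pk1 \<open>k1 \<noteq> 0\<close> by (auto simp: P_def t_def algebra_simps of_nat_diff)
  obtain n where n: "\<And>k. k \<in> J \<Longrightarrow> k < n" using finite_nat_set_iff_bounded \<open>finite J\<close> by auto
  define n' where "n' = max n (Suc k1)"
  have tinc: "t k1 \<le> t k" if "k1 \<le> k" for k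
    using that \<open>\<epsilon> > 0\<close> by (auto simp: t_def)
  have "(\<Sum>k\<in>J. \<epsilon> * g (t k)) \<le> (\<Sum>k\<in>{k1..<n'}. \<epsilon> * g (t k))"
  proof (rule sum_mono2)
    show "J \<subseteq> {k1..<n'}" using n least assms(5) by (force simp: n'_def P_def)
    fix k assume "k \<in> {k1..<n'} - J"
    hence "t k1 \<le> t k" using tinc by auto
    thus "0 \<le> \<epsilon> * g (t k)" using gnn[of "t k"] tk1 \<open>\<epsilon> > 0\<close> by auto
  qed simp
  also have "\<dots> = \<epsilon> * g (t k1) + (\<Sum>k\<in>{Suc k1..<n'}. \<epsilon> * g (t k))"
    by (subst sum.atLeast_Suc_lessThan) (auto simp: n'_def)
  also have "(\<Sum>k\<in>{Suc k1..<n'}. \<epsilon> * g (t k)) = (\<Sum>k\<in>{k1..<n' - 1}. \<epsilon> * g (t (Suc k)))"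
  proof -
    have "n' = Suc (n' - 1)" by (simp add: n'_def)
    thus ?thesis using sum.shift_bounds_Suc_ivl[of "\<lambda>k. \<epsilon> * g (t k)" k1 "n' - 1"] by simp
  qed
  also have "\<dots> \<le> (\<Sum>k\<in>{k1..<n' - 1}. - \<Psi> (t (Suc k)) - (- \<Psi> (t k)))"
  proof (rule sum_mono)
    fix k assume "k \<in> {k1..<n' - 1}"
    hence "x \<le> t k" using tinc[of k] tk1 by auto
    moreover have "t (Suc k) = t k + \<epsilon>" by (simp add: t_def algebra_simps)
    ultimately show "\<epsilon> * g (t (Suc k)) \<le> - \<Psi> (t (Suc k)) - (- \<Psi> (t k))" using step[of "t k"] by simp
  qed
  also have "\<dots> = - \<Psi> (t (n' - 1)) - (- \<Psi> (t k1))"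
    by (rule sum_Suc_diff') (auto simp: n'_def)
  also have "\<dots> \<le> \<Psi> x"
  proof -
    have "t k1 \<le> t (n' - 1)" by (rule tinc) (auto simp: n'_def)
    hence "\<Psi> (t (n' - 1)) \<ge> 0" using tk1 by (intro \<Psi>nn) auto
    moreover have "\<Psi> (t k1) \<le> \<Psi> x" using tk1 by (intro \<Psi>mono) auto
    ultimately show ?thesis by simp
  qed
  also have "\<epsilon> * g (t k1) \<le> \<epsilon> * G" using gG[OF tk1] \<open>\<epsilon> > 0\<close> by simp
  finally show ?thesis by simp
qed

text \<open>Here each point is charged to the interval on its right. The first point may be as late
  as \<open>x + \<epsilon>\<close>, and the last interval reaches beyond \<open>T\<close>; both
  losses show in the bound.\<close>

lemma telescope_sum_lower:
  fixes g \<Psi> :: "real \<Rightarrow> real" and \<tau> \<epsilon> x T :: real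
  defines "t \<equiv> \<lambda>k::nat. \<tau> + \<epsilon> * real k"
  assumes "\<epsilon> > 0" "\<tau> \<le> x" "x \<le> T"
    and step: "\<And>s. s \<ge> x \<Longrightarrow> \<epsilon> * g s \<ge> \<Psi> s - \<Psi> (s + \<epsilon>)"
    and \<Psi>mono: "\<And>s s'. s \<ge> x \<Longrightarrow> s \<le> s' \<Longrightarrow> \<Psi> s' \<le> \<Psi> s"
  shows "(\<Sum>k\<in>{k. x < t k \<and> t k \<le> T}. \<epsilon> * g (t k)) \<ge> \<Psi> (x + \<epsilon>) - \<Psi> T"
proof -
  have ex: "\<exists>k. t k > y" for y
  proof -
    obtain k :: nat where "real k > (y - \<tau>) / \<epsilon>" using reals_Archimedean2 by blast
    hence "t k > y" using \<open>\<epsilon> > 0\<close> by (auto simp: t_def field_simps)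
    thus ?thesis ..
  qed
  define k1 where "k1 = (LEAST k. t k > x)"
  define n where "n = (LEAST k. t k > T)"
  have k1: "t k1 > x" unfolding k1_def using ex by (rule LeastI_ex)
  have n: "t n > T" unfolding n_def using ex by (rule LeastI_ex)
  have least: "k1 \<le> k" if "t k > x" for k unfolding k1_def using that by (rule Least_le)
  have leastn: "n \<le> k" if "t k > T" for k unfolding n_def using that by (rule Least_le)
  have tmono: "t j \<le> t k" if "j \<le> k" for j k using that \<open>\<epsilon> > 0\<close> by (auto simp: t_def)
  have kn: "k1 \<le> n" using n \<open>x \<le> T\<close> by (intro least) auto
  have "k1 \<noteq> 0" using k1 \<open>\<tau> \<le> x\<close> unfolding t_def by (metis add.right_neutral linorder_not_le mult_zero_right of_nat_0)
  hence "\<not> t (k1 - 1) > x" using least[of "k1 - 1"] by linarith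
  hence tk1: "t k1 \<le> x + \<epsilon>" using \<open>k1 \<noteq> 0\<close> by (auto simp: t_def algebra_simps of_nat_diff)
  have set: "{k. x < t k \<and> t k \<le> T} = {k1..<n}"
  proof (intro equalityI subsetI)
    fix k assume "k \<in> {k. x < t k \<and> t k \<le> T}"
    thus "k \<in> {k1..<n}" using least[of k] tmono[of n k] n by (auto simp: not_le[symmetric])
  next
    fix k assume k: "k \<in> {k1..<n}"
    hence "t k1 \<le> t k" by (intro tmono) auto
    moreover have "\<not> t k > T" using leastn[of k] k by auto
    ultimately show "k \<in> {k. x < t k \<and> t k \<le> T}" using k1 by auto
  qed
  have "\<Psi> (x + \<epsilon>) - \<Psi> T \<le> \<Psi> (t k1) - \<Psi> (t n)"
    using \<Psi>mono[of "t k1" "x + \<epsilon>"] \<Psi>mono[of T "t n"] tk1 k1 n \<open>x \<le> T\<close> by simp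
  also have "\<dots> = (\<Sum>k\<in>{k1..<n}. - \<Psi> (t (Suc k)) - (- \<Psi> (t k)))"
    by (subst sum_Suc_diff'[OF kn]) simp
  also have "\<dots> \<le> (\<Sum>k\<in>{k1..<n}. \<epsilon> * g (t k))"
  proof (rule sum_mono)
    fix k assume "k \<in> {k1..<n}"
    hence "t k1 \<le> t k" by (intro tmono) auto
    moreover have "t (Suc k) = t k + \<epsilon>" by (simp add: t_def algebra_simps)
    ultimately show "- \<Psi> (t (Suc k)) - (- \<Psi> (t k)) \<le> \<epsilon> * g (t k)" using step[of "t k"] k1 by simp
  qed
  finally show ?thesis unfolding set .
qed

section \<open>Mills-ratio bounds for the tail \<open>Q\<close> and Riemann sums with a relative
  error\<close>

locale tail_function =
  fixes a :: real and d :: nat and Q :: "real \<Rightarrow> real"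
  assumes a_pos: "a > 0" and d_ge: "d \<ge> 2"
    and Q_deriv: "\<And>t. (Q has_real_derivative - exp (- a * t ^ d)) (at t)"
    and Q_lim: "(Q \<longlongrightarrow> 0) at_top"
begin

definition f :: "real \<Rightarrow> real" where "f t = exp (- a * t ^ d)"

lemma f_pos [simp]: "f t > 0" and f_nonneg [simp]: "f t \<ge> 0"
  by (simp_all add: f_def)

lemma f_antimono: "0 \<le> s \<Longrightarrow> s \<le> t \<Longrightarrow> f t \<le> f s"
  using a_pos by (simp add: f_def power_mono)

lemma f_lim: "(f \<longlongrightarrow> 0) at_top"
  unfolding f_def
proof (rule filterlim_compose[OF exp_at_bot])
  have "filterlim (\<lambda>t::real. t ^ d) at_top at_top"
    using d_ge by (intro filterlim_pow_at_top filterlim_ident) auto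
  thus "filterlim (\<lambda>t. - a * t ^ d) at_bot at_top"
    using a_pos by (intro filterlim_tendsto_neg_mult_at_bot[OF tendsto_const]) auto
qed

lemma Q_antimono: "s \<le> t \<Longrightarrow> Q t \<le> Q s"
  by (rule DERIV_nonpos_imp_nonincreasing) (use Q_deriv in \<open>auto intro!: exI[of _ "- exp (- a * _ ^ d)"]\<close>)

lemma Q_strict_antimono: "s < t \<Longrightarrow> Q t < Q s"
  by (rule DERIV_neg_imp_decreasing) (use Q_deriv in \<open>auto intro!: exI[of _ "- exp (- a * _ ^ d)"]\<close>)

lemma Q_nonneg: "Q t \<ge> 0"
  by (rule nonneg_of_deriv_nonpos_limit_0[OF _ Q_lim]) (use Q_deriv in \<open>auto intro!: exI[of _ "- exp (- a * _ ^ d)"]\<close>)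

lemma Q_pos: "Q t > 0"
  using Q_strict_antimono[of t "t + 1"] Q_nonneg[of "t + 1"] by simp

lemma Q_diff:
  assumes "0 \<le> s" "s \<le> t"
  shows "(t - s) * f t \<le> Q s - Q t" "Q s - Q t \<le> (t - s) * f s"
proof -
  have "(t - s) * f t \<le> Q s - Q t \<and> Q s - Q t \<le> (t - s) * f s"
  proof (cases "s = t")
    case False
    hence "s < t" using assms by simp
    then obtain z where z: "s < z" "z < t" "Q t - Q s = (t - s) * (- exp (- a * z ^ d))"
      using MVT2[of s t Q "\<lambda>t. - exp (- a * t ^ d)"] Q_deriv by auto
    have "Q s - Q t = (t - s) * f z" using z(3) by (simp add: f_def)
    thus ?thesis using z f_antimono[of s z] f_antimono[of z t] assms by (auto intro!: mult_left_mono)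
  qed simp
  thus "(t - s) * f t \<le> Q s - Q t" "Q s - Q t \<le> (t - s) * f s" by auto
qed

text \<open>On an interval of length \<open>1 / (1 + x) ^ (d - 1)\<close> to the right of
  \<open>x\<close> the power \<open>t ^ d\<close> grows by at most \<open>d\<close>, so
  \<open>f\<close> loses at most the factor \<open>exp (- a * d)\<close>, and \<open>Q x\<close> is
  at least the mass of this interval. This is the bound that turns errors in \<open>f x\<close> into
  errors relative to \<open>Q x\<close>.\<close>

lemma f_le_Q:
  assumes "x \<ge> 0"
  shows "f x \<le> exp (a * d) * (1 + x) ^ (d - 1) * Q x"
proof -
  define \<eta> where "\<eta> = 1 / (1 + x) ^ (d - 1)"
  have \<eta>: "0 < \<eta>" "\<eta> \<le> 1" using assms by (auto simp: \<eta>_def)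
  obtain z where z: "x < z" "z < x + \<eta>" "(x + \<eta>) ^ d - x ^ d = (x + \<eta> - x) * (real d * z ^ (d - 1))"
    using MVT2[of x "x + \<eta>" "\<lambda>z. z ^ d" "\<lambda>z. real d * z ^ (d - 1)"] \<eta>
    by (auto intro!: derivative_eq_intros)
  have "z ^ (d - 1) \<le> (1 + x) ^ (d - 1)" using z assms \<eta> by (intro power_mono) auto
  hence "\<eta> * z ^ (d - 1) \<le> 1" using assms by (simp add: \<eta>_def field_simps)
  hence "real d * (\<eta> * z ^ (d - 1)) \<le> real d * 1" by (intro mult_left_mono) auto
  hence "(x + \<eta>) ^ d \<le> x ^ d + d" using z(3) by (simp add: algebra_simps)
  hence "a * (x + \<eta>) ^ d \<le> a * (x ^ d + d)" using a_pos by (intro mult_left_mono) auto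
  hence "f x * exp (- a * d) \<le> f (x + \<eta>)"
    by (simp add: f_def exp_add[symmetric] algebra_simps)
  also have "\<eta> * f (x + \<eta>) \<le> Q x"
    using Q_diff(1)[of x "x + \<eta>"] Q_nonneg[of "x + \<eta>"] assms \<eta> by simp
  hence "f (x + \<eta>) \<le> (1 + x) ^ (d - 1) * Q x" using assms by (simp add: \<eta>_def field_simps)
  finally show ?thesis by (simp add: exp_minus field_simps)
qed

text \<open>\<open>f t / (a * d) - Q t\<close> tends to 0 and has derivative
  \<open>- (t ^ (d - 1) - 1) * f t\<close>, which is nonpositive from 1 on.\<close>

lemma Q_le_f:
  assumes "t \<ge> 1"
  shows "Q t \<le> f t / (a * d)"
proof -
  define g where "g = (\<lambda>t. f t / (a * d) - Q t)"
  have lim: "(g \<longlongrightarrow> 0) at_top"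
      unfolding g_def using tendsto_diff[OF tendsto_divide[OF f_lim tendsto_const[of "a * d"]] Q_lim] a_pos d_ge by simp
  have "g t \<ge> 0"
  proof (rule nonneg_of_deriv_nonpos_limit_0[OF _ lim])
    fix s assume "t \<le> s"
    hence s: "s \<ge> 1" using assms by simp
    have "(g has_real_derivative (- (s ^ (d - 1) - 1) * f s)) (at s)"
      unfolding g_def f_def using a_pos d_ge
      by (auto intro!: derivative_eq_intros Q_deriv) (simp add: field_simps)
    moreover have "- (s ^ (d - 1) - 1) * f s \<le> 0" using s by (simp add: mult_le_0_iff)
    ultimately show "\<exists>D. (g has_real_derivative D) (at s) \<and> D \<le> 0" by blast
  qed
  thus ?thesis by (simp add: g_def)
qed

text \<open>An explicit majorant of the weighted tail integral of \<open>(1 + s ^ (d + 1)) * f s\<close> over \<open>s \<ge> t\<close>,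
  obtained by integration by parts.\<close>
definition \<Theta> :: "real \<Rightarrow> real" where
  "\<Theta> t = Q t + ((t\<^sup>2 + 2 / (a * d)) * f t + 2 * Q t) / (a * d)"

lemma \<Theta>_nonneg: "\<Theta> t \<ge> 0"
  unfolding \<Theta>_def using a_pos Q_nonneg by (auto intro!: add_nonneg_nonneg divide_nonneg_nonneg mult_nonneg_nonneg)

text \<open>Differentiating \<open>t\<^sup>2 * f t / (a * d)\<close> produces the wanted
  \<open>t ^ (d + 1) * f t\<close> and a term \<open>2 * t * f t / (a * d)\<close> of the wrong
  sign. The summands of \<Theta> with \<open>2 / (a * d) * f t\<close> and \<open>2 * Q t\<close>
  are there to outweigh it, since \<open>t \<le> t ^ (d - 1) + 1\<close> for nonnegative
  \<open>t\<close>.\<close>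

lemma \<Theta>_deriv:
  "(\<Theta> has_real_derivative - ((1 + t ^ (d + 1) + 2 * (t ^ (d - 1) + 1 - t) / (a * d)) * f t)) (at t)"
proof -
  have d1: "t ^ (d + 1) = t\<^sup>2 * t ^ (d - 1)"
    using d_ge by (simp add: power_add[symmetric])
  show ?thesis
    unfolding \<Theta>_def f_def d1 using a_pos d_ge
    by (auto intro!: derivative_eq_intros Q_deriv) (simp add: field_simps)
qed

lemma \<Theta>_slope:
  assumes "t \<ge> 0"
  shows "(1 + t ^ (d + 1)) * f t \<le> (1 + t ^ (d + 1) + 2 * (t ^ (d - 1) + 1 - t) / (a * d)) * f t"
proof -
  have "t \<le> t ^ (d - 1) + 1"
  proof (cases "t \<le> 1")
    case False
    hence "t ^ 1 \<le> t ^ (d - 1)" using d_ge by (intro power_increasing) auto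
    thus ?thesis by simp
  qed (use assms in \<open>auto intro!: add_increasing\<close>)
  thus ?thesis using a_pos by (intro mult_right_mono) auto
qed

lemma \<Theta>_antimono:
  assumes "0 \<le> s" "s \<le> t"
  shows "\<Theta> t \<le> \<Theta> s"
proof (rule DERIV_nonpos_imp_nonincreasing[OF assms(2)])
  fix u assume "s \<le> u" "u \<le> t"
  hence "u \<ge> 0" using assms by simp
  have "0 \<le> (1 + u ^ (d + 1)) * f u" using \<open>u \<ge> 0\<close> by (intro mult_nonneg_nonneg) auto
  thus "\<exists>y. (\<Theta> has_real_derivative y) (at u) \<and> y \<le> 0"
    using \<Theta>_slope[OF \<open>u \<ge> 0\<close>] 
    by (intro exI[of _ "- ((1 + u ^ (d + 1) + 2 * (u ^ (d - 1) + 1 - u) / (a * real d)) * f u)"] conjI \<Theta>_deriv) linarith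
qed

text \<open>\<open>t ^ (d + 1) * f t\<close> is not monotone, so the two factors are compared
  separately with their values at a mean value point \<open>z\<close>. The power increases by less
  than replacing \<open>z\<close> by \<open>1 + z\<close>, which costs
  \<open>2 ^ (d + 1)\<close>.\<close>

lemma \<Theta>_step:
  assumes "0 \<le> s" "0 < \<epsilon>" "\<epsilon> \<le> 1"
  shows "\<epsilon> * ((s + \<epsilon>) ^ (d + 1) * f (s + \<epsilon>)) \<le> 2 ^ (d + 1) * \<Theta> s - 2 ^ (d + 1) * \<Theta> (s + \<epsilon>)"
proof -
  obtain z where z: "s < z" "z < s + \<epsilon>"
    "\<Theta> (s + \<epsilon>) - \<Theta> s = (s + \<epsilon> - s) * - ((1 + z ^ (d + 1) + 2 * (z ^ (d - 1) + 1 - z) / (a * d)) * f z)"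
    using MVT2[of s "s + \<epsilon>" \<Theta> "\<lambda>t. - ((1 + t ^ (d + 1) + 2 * (t ^ (d - 1) + 1 - t) / (a * d)) * f t)"]
      assms \<Theta>_deriv by auto
  have "(s + \<epsilon>) ^ (d + 1) * f (s + \<epsilon>) \<le> (1 + z) ^ (d + 1) * f z"
    using z assms f_antimono[of z "s + \<epsilon>"] by (intro mult_mono power_mono) auto
  also have "\<dots> \<le> 2 ^ (d + 1) * (1 + z ^ (d + 1)) * f z"
    using one_plus_power_le[of z "d + 1"] z assms by (intro mult_right_mono) auto
  also have "\<dots> \<le> 2 ^ (d + 1) * ((1 + z ^ (d + 1) + 2 * (z ^ (d - 1) + 1 - z) / (a * d)) * f z)"
    using \<Theta>_slope[of z] z assms by (simp only: mult.assoc) (intro mult_left_mono, auto)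
  finally have "\<epsilon> * ((s + \<epsilon>) ^ (d + 1) * f (s + \<epsilon>)) \<le>
      \<epsilon> * (2 ^ (d + 1) * ((1 + z ^ (d + 1) + 2 * (z ^ (d - 1) + 1 - z) / (a * d)) * f z))"
    using assms by (intro mult_left_mono) auto
  also have "\<dots> = 2 ^ (d + 1) * (\<Theta> s - \<Theta> (s + \<epsilon>))" using z(3) by simp
  finally show ?thesis by (simp add: algebra_simps)
qed

text \<open>The factor \<open>t\<^sup>2\<close> in \<Theta> and the factor
  \<open>(1 + t) ^ (d - 1)\<close> from \<open>f_le_Q\<close> multiply to degree exactly
  \<open>d + 1\<close>, so a weighted tail is no worse than the weight at its left end times
  \<open>Q\<close>.\<close>

lemma \<Theta>_le_Q: "\<exists>C>0. \<forall>x\<ge>0. \<Theta> x \<le> C * (1 + x ^ (d + 1)) * Q x"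
proof -
  define c where "c = 2 / (a * d)"
  have c: "c > 0" using a_pos d_ge by (simp add: c_def)
  define C where "C = 1 + c + c * (1 + c) * exp (a * d) * 2 ^ (d + 1)"
  show ?thesis
  proof (intro exI[of _ C] conjI allI impI)
    show "C > 0" using c by (auto simp: C_def intro!: add_pos_nonneg)
    fix x :: real assume x: "x \<ge> 0"
    have "x\<^sup>2 + c \<le> (1 + c) * (1 + x)\<^sup>2" using x c by (simp add: power2_eq_square algebra_simps add_increasing)
    hence "(x\<^sup>2 + c) * f x \<le> ((1 + c) * (1 + x)\<^sup>2) * (exp (a * d) * (1 + x) ^ (d - 1) * Q x)"
      using f_le_Q[OF x] x c by (intro mult_mono) auto
    also have "\<dots> = (1 + c) * exp (a * d) * (1 + x) ^ (d + 1) * Q x"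
    proof -
      have "(1 + x) ^ (d + 1) = (1 + x)\<^sup>2 * (1 + x) ^ (d - 1)"
        using d_ge by (simp add: power_add[symmetric] del: power_Suc)
      thus ?thesis by simp
    qed
    also have "\<dots> \<le> (1 + c) * exp (a * d) * (2 ^ (d + 1) * (1 + x ^ (d + 1))) * Q x"
      using one_plus_power_le[OF x, of "d + 1"] c Q_nonneg by (intro mult_right_mono mult_left_mono) auto
    finally have A: "(x\<^sup>2 + c) * f x \<le> (1 + c) * exp (a * d) * (2 ^ (d + 1) * (1 + x ^ (d + 1))) * Q x" .
    have "1 * Q x \<le> (1 + x ^ (d + 1)) * Q x" using x Q_nonneg by (intro mult_right_mono) auto
    hence "(1 + c) * Q x \<le> (1 + c) * ((1 + x ^ (d + 1)) * Q x)" using c by (intro mult_left_mono) auto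
    moreover have "(c / 2) * ((x\<^sup>2 + c) * f x) \<le> c * ((1 + c) * exp (a * d) * (2 ^ (d + 1) * (1 + x ^ (d + 1))) * Q x)"
      by (rule mult_mono[OF _ A]) (use c x in auto)
    moreover have "\<Theta> x = (1 + c) * Q x + (c / 2) * ((x\<^sup>2 + c) * f x)"
      unfolding \<Theta>_def c_def using a_pos d_ge by (simp add: field_simps)
    ultimately have "\<Theta> x \<le> (1 + c) * ((1 + x ^ (d + 1)) * Q x) + c * ((1 + c) * exp (a * d) * (2 ^ (d + 1) * (1 + x ^ (d + 1))) * Q x)"
      by linarith
    also have "\<dots> = C * (1 + x ^ (d + 1)) * Q x" unfolding C_def by algebra
    finally show "\<Theta> x \<le> C * (1 + x ^ (d + 1)) * Q x" .
  qed
qed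

text \<open>Replacing \<open>v\<close> by \<open>f\<close> costs \<kappa> times a weighted tail,
  controlled by \<Theta>; replacing the sum of \<open>f\<close> by \<open>Q\<close> costs one
  lattice term at \<open>x\<close>; stopping at \<open>T\<close> costs \<open>Q T\<close>, which
  stays additive because \<open>T\<close> is chosen later. \<open>M\<close> compares the mesh with
  the length \<open>1 / (1 + x) ^ (d - 1)\<close> over which \<open>f\<close> changes by a bounded
  factor. \<open>C\<close> depends on \<open>a\<close>, \<open>d\<close> and \<open>M\<close> alone,
  so the bound is uniform in \<open>x\<close> and in the lattice.\<close>

lemma tail_sum_approx:
  fixes M :: real
  assumes "M > 0"
  obtains C where "C > 0"
    "\<And>(x::real) (\<tau>::real) (\<epsilon>::real) (T::real) (\<kappa>::real) v. 0 \<le> x \<Longrightarrow> \<tau> \<le> x \<Longrightarrow> x \<le> T \<Longrightarrow> 0 < \<epsilon> \<Longrightarrow> \<epsilon> \<le> 1 \<Longrightarrow>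
     \<epsilon> * (1 + x) ^ (d - 1) \<le> M \<Longrightarrow> 0 \<le> \<kappa> \<Longrightarrow>
     (\<And>k::nat. x < \<tau> + \<epsilon> * k \<Longrightarrow> \<tau> + \<epsilon> * k \<le> T \<Longrightarrow>
        \<bar>v k - f (\<tau> + \<epsilon> * k)\<bar> \<le> \<kappa> * (1 + (\<tau> + \<epsilon> * k) ^ (d + 1)) * f (\<tau> + \<epsilon> * k)) \<Longrightarrow>
     \<bar>\<epsilon> * (\<Sum>k\<in>{k::nat. x < \<tau> + \<epsilon> * k \<and> \<tau> + \<epsilon> * k \<le> T}. v k) - Q x\<bar>
       \<le> C * (\<kappa> + \<epsilon>) * (1 + x ^ (d + 1)) * Q x + Q T"
proof -
  obtain C1 where C1: "C1 > 0" "\<And>x. x \<ge> 0 \<Longrightarrow> \<Theta> x \<le> C1 * (1 + x ^ (d + 1)) * Q x"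
    using \<Theta>_le_Q by blast
  define C2 where "C2 = exp (a * d) * 2 ^ (d - 1) * 2"
  define C where "C = exp (a * d) * M + 1 + 2 ^ (d + 1) * (exp (a * d) * M + C1) + C2"
  have C2: "C2 > 0" by (simp add: C2_def)
  have C: "C > 0" using assms C1 C2 by (auto simp: C_def intro!: add_pos_pos mult_pos_pos)
  show thesis
  proof (rule that[OF C])
    fix x \<tau> \<epsilon> T \<kappa> :: real and v :: "nat \<Rightarrow> real"
    assume x: "0 \<le> x" "\<tau> \<le> x" "x \<le> T" and \<epsilon>: "0 < \<epsilon>" "\<epsilon> \<le> 1" and M: "\<epsilon> * (1 + x) ^ (d - 1) \<le> M" and \<kappa>: "0 \<le> \<kappa>"
    define t where "t = (\<lambda>k::nat. \<tau> + \<epsilon> * real k)"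
    assume "\<And>k::nat. x < \<tau> + \<epsilon> * k \<Longrightarrow> \<tau> + \<epsilon> * k \<le> T \<Longrightarrow>
        \<bar>v k - f (\<tau> + \<epsilon> * k)\<bar> \<le> \<kappa> * (1 + (\<tau> + \<epsilon> * k) ^ (d + 1)) * f (\<tau> + \<epsilon> * k)"
    hence v: "\<bar>v k - f (t k)\<bar> \<le> \<kappa> * (1 + t k ^ (d + 1)) * f (t k)" if "x < t k" "t k \<le> T" for k
      using that unfolding t_def by blast
    define J where "J = {k::nat. x < t k \<and> t k \<le> T}"
    have "finite J"
    proof (rule finite_subset)
      show "J \<subseteq> {..nat \<lceil>(T - \<tau>) / \<epsilon>\<rceil>}"
      proof
        fix k assume "k \<in> J"
        hence "real k \<le> (T - \<tau>) / \<epsilon>" using \<epsilon> by (auto simp: J_def t_def field_simps)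
        thus "k \<in> {..nat \<lceil>(T - \<tau>) / \<epsilon>\<rceil>}" by simp linarith
      qed
    qed simp
    have R1: "(\<Sum>k\<in>J. \<epsilon> * f (t k)) \<le> \<epsilon> * f x + Q x"
      unfolding t_def
    proof (rule telescope_sum_upper[where g = f and \<Psi> = Q and G = "f x" and x = x])
      fix s assume s: "x \<le> s"
      show "\<epsilon> * f (s + \<epsilon>) \<le> Q s - Q (s + \<epsilon>)" using Q_diff(1)[of s "s + \<epsilon>"] s x \<epsilon> by simp
    qed (use x \<epsilon> \<open>finite J\<close> Q_nonneg Q_antimono in \<open>auto simp: J_def t_def intro!: f_antimono\<close>)
    have R2: "(\<Sum>k\<in>J. \<epsilon> * f (t k)) \<ge> Q (x + \<epsilon>) - Q T"
      unfolding t_def J_def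
    proof (rule telescope_sum_lower[where g = f and \<Psi> = Q])
      fix s assume s: "x \<le> s"
      show "\<epsilon> * f s \<ge> Q s - Q (s + \<epsilon>)" using Q_diff(2)[of s "s + \<epsilon>"] s x \<epsilon> by simp
    qed (use x \<epsilon> Q_antimono in auto)
    have R2': "Q (x + \<epsilon>) \<ge> Q x - \<epsilon> * f x" using Q_diff(2)[of x "x + \<epsilon>"] x \<epsilon> by simp
    have R3: "(\<Sum>k\<in>J. \<epsilon> * (t k ^ (d + 1) * f (t k))) \<le> \<epsilon> * (2 ^ (d + 1) * (1 + x ^ (d + 1)) * f x) + 2 ^ (d + 1) * \<Theta> x"
      unfolding t_def
    proof (rule telescope_sum_upper[where g = "\<lambda>t. t ^ (d + 1) * f t" and \<Psi> = "\<lambda>s. 2 ^ (d + 1) * \<Theta> s"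
        and G = "2 ^ (d + 1) * (1 + x ^ (d + 1)) * f x" and x = x])
      fix s assume s: "x \<le> s"
      show "\<epsilon> * ((s + \<epsilon>) ^ (d + 1) * f (s + \<epsilon>)) \<le> 2 ^ (d + 1) * \<Theta> s - 2 ^ (d + 1) * \<Theta> (s + \<epsilon>)"
        using \<Theta>_step[of s \<epsilon>] s x \<epsilon> by simp
      show "2 ^ (d + 1) * \<Theta> s \<le> 2 ^ (d + 1) * \<Theta> x" using \<Theta>_antimono[of x s] s x by simp
    next
      fix s assume s: "x < s" "s \<le> x + \<epsilon>"
      have "s ^ (d + 1) \<le> (1 + x) ^ (d + 1)" using s x \<epsilon> by (intro power_mono) auto
      also have "\<dots> \<le> 2 ^ (d + 1) * (1 + x ^ (d + 1))" by (rule one_plus_power_le) fact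
      finally show "s ^ (d + 1) * f s \<le> 2 ^ (d + 1) * (1 + x ^ (d + 1)) * f x"
        using f_antimono[of x s] s x by (intro mult_mono) auto
    qed (use x \<epsilon> \<open>finite J\<close> \<Theta>_nonneg in \<open>auto simp: J_def t_def\<close>)
    define S where "S = (1 + x ^ (d + 1))"
    have S: "S \<ge> 1" using x by (simp add: S_def)
    \<comment> \<open>The boundary term \<open>\<epsilon> * f x\<close> is estimated twice: by a
      constant times \<open>Q x\<close> where \<kappa> already supplies a small factor, and in
      \<open>fS\<close> by keeping \<epsilon> and paying with \<open>S\<close>.\<close>
    have fM: "\<epsilon> * f x \<le> exp (a * d) * M * Q x"
    proof -
      have "\<epsilon> * f x \<le> \<epsilon> * (exp (a * d) * (1 + x) ^ (d - 1) * Q x)"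
        using f_le_Q[OF x(1)] \<epsilon> by (intro mult_left_mono) auto
      also have "\<dots> = exp (a * d) * (\<epsilon> * (1 + x) ^ (d - 1)) * Q x" by simp
      also have "\<dots> \<le> exp (a * d) * M * Q x" using M Q_nonneg by (intro mult_right_mono mult_left_mono) auto
      finally show ?thesis .
    qed
    have fS: "f x \<le> C2 * S * Q x"
    proof -
      have "(1 + x) ^ (d - 1) \<le> 2 ^ (d - 1) * (1 + x ^ (d - 1))" by (rule one_plus_power_le) fact
      also have "x ^ (d - 1) \<le> 1 + x ^ (d + 1)"
      proof (cases "x \<le> 1")
        case True
        hence "x ^ (d - 1) \<le> 1" using x by (intro power_le_one) auto
        thus ?thesis using x by (simp add: add_increasing2)
      next
        case False
        hence "x ^ (d - 1) \<le> x ^ (d + 1)" by (intro power_increasing) auto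
        thus ?thesis by simp
      qed
      hence "2 ^ (d - 1) * (1 + x ^ (d - 1)) \<le> 2 ^ (d - 1) * (2 * S)"
        using zero_le_power[OF x(1), of "d + 1"] by (intro mult_left_mono) (simp_all add: S_def)
      finally have "exp (a * d) * (1 + x) ^ (d - 1) * Q x \<le> exp (a * d) * (2 ^ (d - 1) * (2 * S)) * Q x"
        using Q_nonneg by (intro mult_right_mono mult_left_mono) auto
      thus ?thesis using f_le_Q[OF x(1)] by (simp add: C2_def mult_ac)
    qed
    have "\<bar>(\<Sum>k\<in>J. \<epsilon> * v k) - (\<Sum>k\<in>J. \<epsilon> * f (t k))\<bar> = \<bar>\<Sum>k\<in>J. \<epsilon> * (v k - f (t k))\<bar>"
      by (simp add: sum_subtractf algebra_simps)
    also have "\<dots> \<le> (\<Sum>k\<in>J. \<bar>\<epsilon> * (v k - f (t k))\<bar>)" by (rule sum_abs)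
    also have "\<dots> \<le> (\<Sum>k\<in>J. \<epsilon> * (\<kappa> * (1 + t k ^ (d + 1)) * f (t k)))"
      using \<epsilon> v by (intro sum_mono) (auto simp: abs_mult J_def mult.assoc intro!: mult_left_mono)
    also have "\<dots> = \<kappa> * ((\<Sum>k\<in>J. \<epsilon> * f (t k)) + (\<Sum>k\<in>J. \<epsilon> * (t k ^ (d + 1) * f (t k))))"
      by (simp add: sum.distrib[symmetric] sum_distrib_left algebra_simps)
    also have "\<dots> \<le> \<kappa> * ((\<epsilon> * f x + Q x) + (\<epsilon> * (2 ^ (d + 1) * (1 + x ^ (d + 1)) * f x) + 2 ^ (d + 1) * \<Theta> x))"
      using R1 R3 \<kappa> by (intro mult_left_mono add_mono) auto
    also have "\<dots> \<le> \<kappa> * (((exp (a * d) * M + 1) * S * Q x) + (2 ^ (d + 1) * S * (exp (a * d) * M * Q x) + 2 ^ (d + 1) * (C1 * S * Q x)))"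
    proof (intro mult_left_mono add_mono)
      have "(exp (a * d) * M + 1) * Q x * 1 \<le> (exp (a * d) * M + 1) * Q x * S"
        using S assms Q_nonneg by (intro mult_left_mono) auto
      thus "\<epsilon> * f x + Q x \<le> (exp (a * d) * M + 1) * S * Q x" using fM by (simp add: algebra_simps)
      have "2 ^ (d + 1) * S * (\<epsilon> * f x) \<le> 2 ^ (d + 1) * S * (exp (a * d) * M * Q x)"
        using fM S by (intro mult_left_mono) auto
      thus "\<epsilon> * (2 ^ (d + 1) * (1 + x ^ (d + 1)) * f x) \<le> 2 ^ (d + 1) * S * (exp (a * d) * M * Q x)"
        by (simp add: S_def mult_ac)
    qed (use C1 x \<kappa> in \<open>auto simp: S_def\<close>)
    also have "\<dots> = \<kappa> * (C - C2) * S * Q x" by (simp add: C_def algebra_simps)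
    finally have D1: "\<bar>(\<Sum>k\<in>J. \<epsilon> * v k) - (\<Sum>k\<in>J. \<epsilon> * f (t k))\<bar> \<le> \<kappa> * (C - C2) * S * Q x" .
    have "\<epsilon> * f x \<le> \<epsilon> * (C2 * S * Q x)" using fS \<epsilon> by (intro mult_left_mono) auto
    hence D2: "\<bar>(\<Sum>k\<in>J. \<epsilon> * f (t k)) - Q x\<bar> \<le> \<epsilon> * C2 * S * Q x + Q T"
      using R1 R2 R2' Q_nonneg[of T] by (simp add: mult_ac)
    have "\<bar>(\<Sum>k\<in>J. \<epsilon> * v k) - Q x\<bar> \<le> \<kappa> * (C - C2) * S * Q x + \<epsilon> * C2 * S * Q x + Q T"
      using D1 D2 by linarith
    also have "\<dots> \<le> C * (\<kappa> + \<epsilon>) * S * Q x + Q T"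
    proof -
      have "C2 \<le> C" using assms C1 by (auto simp: C_def)
      hence "\<kappa> * (C - C2) + \<epsilon> * C2 \<le> \<kappa> * C + \<epsilon> * C" using \<kappa> \<epsilon> C2 by (intro add_mono mult_left_mono) auto
      hence "(\<kappa> * (C - C2) + \<epsilon> * C2) * (S * Q x) \<le> (\<kappa> * C + \<epsilon> * C) * (S * Q x)"
        using S Q_nonneg by (intro mult_right_mono) auto
      thus ?thesis by (simp add: algebra_simps)
    qed
    finally show "\<bar>\<epsilon> * (\<Sum>k\<in>{k::nat. x < \<tau> + \<epsilon> * k \<and> \<tau> + \<epsilon> * k \<le> T}. v k) - Q x\<bar>
       \<le> C * (\<kappa> + \<epsilon>) * (1 + x ^ (d + 1)) * Q x + Q T"
      by (simp add: J_def t_def S_def sum_distrib_left)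
  qed
qed

end

section \<open>Laplace's method on the lattice of magnetizations\<close>

lemma abs_exp_minus_1_le:
  fixes e :: real
  shows "\<bar>exp e - 1\<bar> \<le> \<bar>e\<bar> * exp \<bar>e\<bar>"
proof (cases "e \<ge> 0")
  case True
  have "exp e * (1 - e) \<le> exp e * exp (- e)" using exp_ge_add_one_self[of "- e"] by (intro mult_left_mono) auto
  thus ?thesis using True by (simp add: exp_minus algebra_simps)
next
  case False
  have "1 + e \<le> exp e" by (rule exp_ge_add_one_self)
  moreover have "- e * 1 \<le> - e * exp (- e)" using False by (intro mult_left_mono) auto
  moreover have "\<bar>exp e - 1\<bar> = 1 - exp e" "\<bar>e\<bar> = - e" using False by auto
  ultimately show ?thesis by (simp only: mult_minus_left mult_1_right)
qed

lemma abs_ln_diff_le: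
  fixes y z \<rho> :: real
  assumes "\<rho> > 0" "y \<ge> \<rho>" "z \<ge> \<rho>"
  shows "\<bar>ln y - ln z\<bar> \<le> \<bar>y - z\<bar> / \<rho>"
proof -
  have *: "ln y - ln z \<le> \<bar>y - z\<bar> / \<rho>" if "y \<ge> \<rho>" "z \<ge> \<rho>" for y z :: real
  proof -
    have "ln y - ln z = ln (y / z)" using that assms by (simp add: ln_div)
    also have "\<dots> \<le> y / z - 1" using that assms by (intro ln_le_minus_one) auto
    also have "\<dots> = (y - z) / z" using that assms by (simp add: field_simps)
    also have "\<dots> \<le> \<bar>y - z\<bar> / z" using that assms by (intro divide_right_mono) auto
    also have "\<dots> \<le> \<bar>y - z\<bar> / \<rho>" using that assms by (intro divide_left_mono) auto
    finally show ?thesis .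
  qed
  show ?thesis using *[of y z] *[of z y] assms by (simp add: abs_minus_commute abs_le_iff)
qed

text \<open>Choosing the constant once makes it available to the normalization \<open>W\<close>
  below, outside any proof.\<close>

definition binom_const :: real where
  "binom_const = (SOME c. \<forall>N k. 0 < k \<longrightarrow> k < N \<longrightarrow>
     \<bar>ln (real (N choose k)) - (real N * ln 2 - real N * I_fun (spin N k) - ln (real N) / 2
        - ln (1 - (spin N k)\<^sup>2) / 2 + c)\<bar> \<le> 1 / (4 * real N) + 1 / (4 * real k) + 1 / (4 * real (N - k)))"

lemma ln_binomial_const:
  assumes "0 < k" "k < N"
  shows "\<bar>ln (real (N choose k)) - (real N * ln 2 - real N * I_fun (spin N k) - ln (real N) / 2
        - ln (1 - (spin N k)\<^sup>2) / 2 + binom_const)\<bar> \<le> 1 / (4 * real N) + 1 / (4 * real k) + 1 / (4 * real (N - k))"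
  using someI_ex[OF ln_binomial_approx] assms unfolding binom_const_def by blast

text \<open>The number of configurations at a level times their common weight. \<open>H\<close> is
  an arbitrary function so that its reflection can be inserted as well.\<close>

definition wt :: "(real \<Rightarrow> real) \<Rightarrow> nat \<Rightarrow> nat \<Rightarrow> real" where
  "wt H N k = real (N choose k) * exp (real N * (H (spin N k) + I_fun (spin N k)))"

text \<open>Neighbouring values of the magnetization differ by 2; this is the mesh after division by
  the scale.\<close>

definition spacing :: "nat \<Rightarrow> nat \<Rightarrow> real" where
  "spacing d N = 2 / real N powr (1 - 1 / real d)"

definition scaled :: "nat \<Rightarrow> real \<Rightarrow> nat \<Rightarrow> nat \<Rightarrow> real" where
  "scaled d m N k = (2 * real k - real N - real N * m) / real N powr (1 - 1 / real d)"

lemma scaled_affine: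
  "scaled d m N k = - (real N + real N * m) / real N powr (1 - 1 / real d) + spacing d N * real k"
  by (simp add: scaled_def spacing_def diff_divide_distrib add_divide_distrib)

lemma spin_minus:

  \<comment> \<open>Scaling identities and the reflection of the lattice\<close>
  assumes "N > 0"
  shows "spin N k - m = scaled d m N k * real N powr (- 1 / real d)"
proof -
  have "real N powr (1 - 1 / real d) = real N * real N powr (- 1 / real d)"
    using assms by (simp add: powr_diff powr_minus divide_inverse)
  thus ?thesis using assms by (simp add: spin_def scaled_def field_simps)
qed

lemma powr_inverse_power:
  assumes "N > 0" "d > 0"
  shows "(real N powr (- 1 / real d)) ^ d = 1 / real N"
proof -
  have "(real N powr (- 1 / real d)) ^ d = (real N powr (- 1 / real d)) powr real d"
    using assms by (simp add: powr_realpow)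
  also have "\<dots> = real N powr (- 1)" using assms by (subst powr_powr) simp
  finally show ?thesis using assms by (simp add: powr_minus divide_inverse)
qed

text \<open>This identity is what dictates the scale \<open>N powr (1 - 1 / d)\<close>: the leading
  term of \<open>N * H\<close> becomes free of \<open>N\<close>.\<close>

lemma spin_minus_power:
  assumes "N > 0" "d > 0"
  shows "real N * (spin N k - m) ^ d = scaled d m N k ^ d"
  unfolding spin_minus[OF assms(1), of k m d] power_mult_distrib powr_inverse_power[OF assms] using assms by simp

lemma spin_bounds: "k \<le> N \<Longrightarrow> spin N k \<in> {-1..1}"
  by (cases "N = 0") (auto simp: spin_def field_simps)

lemma spin_flip: "k \<le> N \<Longrightarrow> spin N (N - k) = - spin N k"
  by (cases "N = 0") (auto simp: spin_def of_nat_diff field_simps)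

lemma I_fun_minus: "I_fun (- s) = I_fun s"
  by (simp add: I_fun_def)

lemma scaled_flip: "k \<le> N \<Longrightarrow> scaled d (- m) N (N - k) = - scaled d m N k"
  by (simp add: scaled_def of_nat_diff minus_divide_left)

lemma wt_flip: "k \<le> N \<Longrightarrow> wt (\<lambda>s. H (- s)) N (N - k) = wt H N k"
  by (simp add: wt_def spin_flip I_fun_minus binomial_symmetric[symmetric])

lemma wt_nonneg: "wt H N k \<ge> 0"
  by (simp add: wt_def)

text \<open>\<open>local_expansion\<close> governs the levels in the window and
  \<open>global_bound\<close> all others in \<open>A\<close>. Restricting the latter to
  \<open>A\<close> is what admits several maximizers; no sign of \<open>m\<close> is assumed, so
  that the reflected peak is again an instance.\<close>

locale laplace_peak = tail_function +
  fixes H :: "real \<Rightarrow> real" and m :: real and A :: "real set"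
  assumes d_cases: "d = 2 \<or> d = 4"
    and m_bounds: "- 1 < m" "m < 1"
    and A_nhd: "\<exists>e>0. \<forall>s. \<bar>s - m\<bar> \<le> e \<longrightarrow> s \<in> A"
    and local_expansion: "\<exists>\<delta>>0. \<exists>L. \<forall>u. \<bar>u\<bar> \<le> \<delta> \<longrightarrow> \<bar>H (m + u) - H m + a * u ^ d\<bar> \<le> L * \<bar>u\<bar> ^ (d + 1)"
    and global_bound: "\<exists>b>0. \<forall>s\<in>A \<inter> {-1..1}. H s \<le> H m - b * \<bar>s - m\<bar> ^ d"
begin

abbreviation "t \<equiv> scaled d m"
abbreviation "\<epsilon> \<equiv> spacing d"

text \<open>The Stirling approximation of the weight with its slowly varying prefactor frozen at
  \<open>m\<close>; weights divided by \<open>W N\<close> are close to \<open>f\<close>.\<close>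

definition W :: "nat \<Rightarrow> real" where
  "W N = exp (real N * ln 2 + real N * H m - ln (real N) / 2 - ln (1 - m\<^sup>2) / 2 + binom_const)"

lemma W_pos: "W N > 0" by (simp add: W_def)

lemma d_pos: "d > 0" and d_even: "even d" using d_cases by auto

text \<open>The exponent solves \<open>window N ^ (d + 1) = N powr (1 / d)\<close>, which makes
  \<open>t ^ (d + 1) * N powr (- 1 / d)\<close> bounded for \<open>t\<close> of this size.\<close>

definition window :: "nat \<Rightarrow> real" where
  "window N = real N powr (1 / (real d * (real d + 1)))"

lemma window_power_Suc: "N > 0 \<Longrightarrow> window N ^ (d + 1) = real N powr (1 / real d)"
proof -
  assume "N > 0"
  hence "window N ^ (d + 1) = window N powr (real (d + 1))"
    by (subst powr_realpow) (auto simp: window_def)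
  also have "\<dots> = real N powr (1 / real d)"
  proof -
    have "1 / (real d * (real d + 1)) * real (d + 1) = 1 / real d" by (simp add: divide_simps)
    thus ?thesis unfolding window_def by (subst powr_powr) (simp only:)
  qed
  finally show ?thesis .
qed

lemma window_ge_1: "N > 0 \<Longrightarrow> window N \<ge> 1"
  unfolding window_def by (intro ge_one_powr_ge_zero) auto

lemma window_le: "N > 0 \<Longrightarrow> window N \<le> real N powr (1 / real d)"
  using self_le_power[OF window_ge_1, of N "d + 1"] window_power_Suc[of N] by simp

lemma in_window_close:
  assumes "\<delta> > 0"
  shows "\<exists>N0>0. \<forall>N\<ge>N0. \<forall>k. \<bar>t N k\<bar> \<le> B * window N \<longrightarrow> \<bar>spin N k - m\<bar> \<le> \<delta>"
proof -
  have "\<forall>\<^sub>F N in sequentially. B * real N powr (1 / (real d * (real d + 1))) * real N powr (- 1 / real d) < \<delta>"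
    using d_cases
  proof
    assume d: "d = 2"
    have "((\<lambda>N. B * real N powr (1 / 6) * real N powr (- 1 / 2)) \<longlongrightarrow> 0) sequentially" by real_asymp
    from order_tendstoD(2)[OF this assms] show ?thesis by (simp add: d)
  next
    assume d: "d = 4"
    have "((\<lambda>N. B * real N powr (1 / 20) * real N powr (- 1 / 4)) \<longlongrightarrow> 0) sequentially" by real_asymp
    from order_tendstoD(2)[OF this assms] show ?thesis by (simp add: d)
  qed
  then obtain N0 where N0: "\<And>N. N \<ge> N0 \<Longrightarrow> B * window N * real N powr (- 1 / real d) < \<delta>"
    unfolding eventually_sequentially window_def by blast
  show ?thesis
  proof (intro exI[of _ "max 1 N0"] conjI allI impI)
    fix N k assume N: "max 1 N0 \<le> N" and k: "\<bar>t N k\<bar> \<le> B * window N"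
    have "\<bar>spin N k - m\<bar> = \<bar>t N k\<bar> * real N powr (- 1 / real d)"
      using N by (subst spin_minus[of N k m d]) (auto simp: abs_mult)
    also have "\<dots> \<le> B * window N * real N powr (- 1 / real d)" using k by (intro mult_right_mono) auto
    finally show "\<bar>spin N k - m\<bar> \<le> \<delta>" using N0[of N] N by simp
  qed auto
qed

text \<open>Levels in the window satisfy the conditioning event automatically, and stay off the
  endpoints, where Stirling's formula does not apply.\<close>

lemma in_window:
  "\<exists>N0>0. \<forall>N\<ge>N0. \<forall>k. \<bar>t N k\<bar> \<le> B * window N \<longrightarrow> spin N k \<in> A \<and> 0 < k \<and> k < N"
proof -
  obtain e where e: "e > 0" "\<And>s. \<bar>s - m\<bar> \<le> e \<Longrightarrow> s \<in> A" using A_nhd by blast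
  define \<delta> where "\<delta> = min e (min ((1 - m) / 2) ((1 + m) / 2))"
  have \<delta>: "\<delta> > 0" "\<delta> \<le> e" "\<delta> < 1 - m" "\<delta> < 1 + m"
    using e m_bounds by (auto simp: \<delta>_def min_def field_simps)
  obtain N0 where N0: "N0 > 0" "\<And>N k. N \<ge> N0 \<Longrightarrow> \<bar>t N k\<bar> \<le> B * window N \<Longrightarrow> \<bar>spin N k - m\<bar> \<le> \<delta>"
    using in_window_close[OF \<delta>(1)] by blast
  show ?thesis
  proof (intro exI[of _ N0] conjI allI impI)
    fix N k assume N: "N0 \<le> N" and k: "\<bar>t N k\<bar> \<le> B * window N"
    have s: "\<bar>spin N k - m\<bar> \<le> \<delta>" using N0(2)[OF N k] .
    thus "spin N k \<in> A" using \<delta> by (intro e) auto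
    have "- 1 < spin N k" "spin N k < 1" using s \<delta> by auto
    thus "0 < k" "k < N" using N N0(1) by (auto simp: spin_def field_simps)
  qed fact
qed

text \<open>The logarithm of the normalized weight differs from \<open>- a * T ^ d\<close> by three
  errors: \<open>e\<close>, the Taylor remainder of \<open>H\<close> times \<open>N\<close>;
  \<open>c\<close>, the variation of the prefactor between \<open>m\<close> and \<open>s\<close>,
  linear in \<open>s - m\<close>; and \<open>b\<close>, the Stirling remainder of order
  \<open>1 / N\<close>. Their sum is bounded in the window, so exponentiating it gives a relative
  error of the same order.\<close>

lemma weight_local:
  assumes "B > 0"
  shows "\<exists>K\<ge>0. \<exists>N0>0. \<forall>N\<ge>N0. \<forall>k. \<bar>t N k\<bar> \<le> B * window N \<longrightarrow>
    \<bar>wt H N k / W N - f (t N k)\<bar> \<le> K * real N powr (- 1 / real d) * (1 + \<bar>t N k\<bar> ^ (d + 1)) * f (t N k)"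
proof -
  obtain \<delta>0 L0 where L0: "\<delta>0 > 0" "\<And>u. \<bar>u\<bar> \<le> \<delta>0 \<Longrightarrow> \<bar>H (m + u) - H m + a * u ^ d\<bar> \<le> L0 * \<bar>u\<bar> ^ (d + 1)"
    using local_expansion by blast
  define L where "L = max L0 0"
  have L: "L \<ge> 0" "\<And>u. \<bar>u\<bar> \<le> \<delta>0 \<Longrightarrow> \<bar>H (m + u) - H m + a * u ^ d\<bar> \<le> L * \<bar>u\<bar> ^ (d + 1)"
  proof -
    fix u :: real assume u: "\<bar>u\<bar> \<le> \<delta>0"
    have "L0 * \<bar>u\<bar> ^ (d + 1) \<le> L * \<bar>u\<bar> ^ (d + 1)" by (intro mult_right_mono) (auto simp: L_def)
    thus "\<bar>H (m + u) - H m + a * u ^ d\<bar> \<le> L * \<bar>u\<bar> ^ (d + 1)" using L0(2)[OF u] by linarith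
  qed (simp add: L_def)
  define \<rho> where "\<rho> = (1 - \<bar>m\<bar>) / 2"
  have \<rho>: "\<rho> > 0" "\<rho> \<le> 1" "\<bar>m\<bar> + 2 * \<rho> = 1" using m_bounds by (auto simp: \<rho>_def field_simps)
  define \<delta> where "\<delta> = min \<delta>0 \<rho>"
  have \<delta>: "\<delta> > 0" "\<delta> \<le> \<delta>0" "\<delta> \<le> \<rho>" using L0 \<rho> by (auto simp: \<delta>_def)
  obtain N1 where N1: "N1 > 0" "\<And>N k. N \<ge> N1 \<Longrightarrow> \<bar>t N k\<bar> \<le> B * window N \<Longrightarrow> \<bar>spin N k - m\<bar> \<le> \<delta>"
    using in_window_close[OF \<delta>(1)] by blast
  \<comment> \<open>\<open>L\<close> pays for the Taylor remainder, the first
    \<open>1 / \<rho>\<close> for the prefactor, and \<open>1 / 4 + 1 / \<rho>\<close> for the three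
    Stirling remainders.\<close>
  define K where "K = L + 1 / \<rho> + 1 / 4 + 1 / \<rho>"
  have K: "K \<ge> 0" using L \<rho> by (auto simp: K_def)
  define E0 where "E0 = K * (1 + B ^ (d + 1))"
  show ?thesis
  proof (intro exI[of _ "2 * K * exp (2 * E0)"] exI[of _ N1] conjI allI impI)
    show "0 \<le> 2 * K * exp (2 * E0)" using K by simp
    fix N k assume N: "N1 \<le> N" and k: "\<bar>t N k\<bar> \<le> B * window N"
    define s where "s = spin N k"
    define u where "u = s - m"
    define T where "T = t N k"
    define \<eta> where "\<eta> = real N powr (- 1 / real d)"
    have N0: "N > 0" using N N1 by auto
    have u: "\<bar>u\<bar> \<le> \<delta>" using N1(2)[OF N k] by (simp add: u_def s_def)
    have \<eta>: "\<eta> > 0" "\<eta> \<le> 1" "1 / real N \<le> \<eta>"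
    proof -
      show "\<eta> > 0" using N0 by (simp add: \<eta>_def)
      have "\<eta> \<le> real N powr 0" unfolding \<eta>_def using N0 d_pos by (intro powr_mono) (auto simp: field_simps)
      thus "\<eta> \<le> 1" using N0 by simp
      have "real N powr (- 1) \<le> \<eta>" unfolding \<eta>_def using N0 d_pos by (intro powr_mono) (auto simp: field_simps)
      thus "1 / real N \<le> \<eta>" using N0 by (simp add: powr_minus divide_inverse)
    qed
    have uT: "u = T * \<eta>" unfolding u_def s_def T_def \<eta>_def using N0 by (rule spin_minus)
    have Nu: "real N * u ^ d = T ^ d" unfolding u_def s_def T_def using N0 d_pos by (rule spin_minus_power)
    have sb: "\<bar>s\<bar> + \<rho> \<le> 1" using u \<delta> \<rho> by (auto simp: u_def)
    have kb: "real k = real N * (1 + s) / 2" using N0 by (simp add: s_def spin_def field_simps)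
    have k1: "real k \<ge> real N * \<rho> / 2" "real N - real k \<ge> real N * \<rho> / 2"
    proof -
      have "real N * \<rho> \<le> real N * (1 + s)" using sb by (intro mult_left_mono) auto
      thus "real k \<ge> real N * \<rho> / 2" using kb by simp
      have "real N * \<rho> \<le> real N * (1 - s)" using sb by (intro mult_left_mono) auto
      thus "real N - real k \<ge> real N * \<rho> / 2" using kb by (simp add: field_simps)
    qed
    have Nr: "real N * \<rho> / 2 > 0" using N0 \<rho> by simp
    have k2: "0 < k" "k < N" using k1 Nr by auto
    define b where "b = ln (real (N choose k)) - (real N * ln 2 - real N * I_fun s - ln (real N) / 2
        - ln (1 - s\<^sup>2) / 2 + binom_const)"
    have "\<bar>b\<bar> \<le> 1 / (4 * real N) + 1 / (4 * real k) + 1 / (4 * real (N - k))"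
      unfolding b_def s_def by (rule ln_binomial_const[OF k2])
    also have "\<dots> \<le> 1 / (4 * real N) + 1 / (4 * (real N * \<rho> / 2)) + 1 / (4 * (real N * \<rho> / 2))"
      using k1 k2 Nr by (intro add_mono divide_left_mono mult_pos_pos) (auto simp: of_nat_diff mult.commute)
    also have "\<dots> = (1 / 4 + 1 / \<rho>) * (1 / real N)" using N0 \<rho> by (simp add: field_simps)
    also have "\<dots> \<le> (1 / 4 + 1 / \<rho>) * \<eta>" using \<eta> \<rho> by (intro mult_left_mono) auto
    finally have b: "\<bar>b\<bar> \<le> (1 / 4 + 1 / \<rho>) * \<eta>" .
    define c where "c = (ln (1 - m\<^sup>2) - ln (1 - s\<^sup>2)) / 2"
    have sq: "1 - y\<^sup>2 \<ge> \<rho>" if "\<bar>y\<bar> + \<rho> \<le> 1" for y :: real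
    proof -
      have "\<bar>y\<bar> * \<bar>y\<bar> \<le> \<bar>y\<bar> * 1" using that \<rho> by (intro mult_left_mono) auto
      thus ?thesis using that by (simp add: power2_eq_square)
    qed
    have "\<bar>ln (1 - m\<^sup>2) - ln (1 - s\<^sup>2)\<bar> \<le> \<bar>(1 - m\<^sup>2) - (1 - s\<^sup>2)\<bar> / \<rho>"
      using sb \<rho> by (intro abs_ln_diff_le sq) auto
    also have "(1 - m\<^sup>2) - (1 - s\<^sup>2) = u * (s + m)" by (simp add: u_def power2_eq_square algebra_simps)
    also have "\<bar>u * (s + m)\<bar> / \<rho> \<le> (\<bar>u\<bar> * 2) / \<rho>"
      unfolding abs_mult using sb \<rho> by (intro divide_right_mono mult_left_mono) auto
    finally have c: "\<bar>c\<bar> \<le> 1 / \<rho> * (\<bar>T\<bar> * \<eta>)" using \<eta> by (simp add: c_def uT abs_mult field_simps)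
    define e where "e = real N * (H s - H m + a * u ^ d)"
    have "\<bar>e\<bar> \<le> real N * (L * \<bar>u\<bar> ^ (d + 1))"
      using L(2)[of u] u \<delta> by (simp add: e_def u_def abs_mult mult_left_mono)
    also have "\<dots> = L * (real N * \<bar>u\<bar> ^ d) * \<bar>u\<bar>" by simp
    also have "real N * \<bar>u\<bar> ^ d = \<bar>T\<bar> ^ d" using Nu d_even by (simp add: power_even_abs)
    also have "L * \<bar>T\<bar> ^ d * \<bar>u\<bar> = L * (\<bar>T\<bar> ^ (d + 1) * \<eta>)" using \<eta> by (simp add: uT abs_mult)
    finally have e: "\<bar>e\<bar> \<le> L * (\<bar>T\<bar> ^ (d + 1) * \<eta>)" .
    define S where "S = 1 + \<bar>T\<bar> ^ (d + 1)"
    have S: "S \<ge> 1" "\<bar>T\<bar> ^ (d + 1) \<le> S" by (auto simp: S_def)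
    have TS: "\<bar>T\<bar> \<le> S"
    proof (cases "\<bar>T\<bar> \<le> 1")
      case False
      hence "\<bar>T\<bar> \<le> \<bar>T\<bar> ^ (d + 1)" by (intro self_le_power) auto
      thus ?thesis by (simp add: S_def)
    qed (use S in auto)
    have "\<bar>e + c + b\<bar> \<le> L * (\<bar>T\<bar> ^ (d + 1) * \<eta>) + 1 / \<rho> * (\<bar>T\<bar> * \<eta>) + (1 / 4 + 1 / \<rho>) * \<eta>"
      using e c b by linarith
    also have "\<dots> \<le> L * (S * \<eta>) + 1 / \<rho> * (S * \<eta>) + (1 / 4 + 1 / \<rho>) * (S * \<eta>)"
      using S TS L \<rho> \<eta> by (intro add_mono mult_left_mono mult_right_mono) auto
    also have "\<dots> = K * S * \<eta>" by (simp add: K_def algebra_simps)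
    finally have ecb: "\<bar>e + c + b\<bar> \<le> K * S * \<eta>" .
    \<comment> \<open>The only place where the width of the window enters: the total error in the
      exponent stays below the constant \<open>E0\<close>.\<close>
    have SE: "S * \<eta> \<le> 1 + B ^ (d + 1)"
    proof -
      have "\<bar>T\<bar> ^ (d + 1) \<le> (B * window N) ^ (d + 1)" using k unfolding T_def by (intro power_mono) auto
      also have "\<dots> = B ^ (d + 1) * real N powr (1 / real d)"
        using window_power_Suc[OF N0] by (simp only: power_mult_distrib)
      finally have "\<bar>T\<bar> ^ (d + 1) * \<eta> \<le> B ^ (d + 1) * real N powr (1 / real d) * \<eta>"
        using \<eta> by (intro mult_right_mono) auto
      also have "\<dots> = B ^ (d + 1)" using N0 by (simp add: \<eta>_def powr_minus)
      finally show ?thesis using \<eta> by (simp add: S_def algebra_simps)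
    qed
    have eE: "\<bar>e + c + b\<bar> \<le> E0"
      using ecb mult_left_mono[OF SE K] by (simp add: E0_def mult.assoc)
    have bpos: "real (N choose k) > 0" using k2 by simp
    have "ln (real (N choose k)) + real N * (H s + I_fun s) =
       (real N * ln 2 + real N * H m - ln (real N) / 2 - ln (1 - m\<^sup>2) / 2 + binom_const) + (- a * T ^ d) + (e + c + b)"
      unfolding e_def c_def b_def Nu[symmetric] by (simp add: algebra_simps diff_divide_distrib)
    hence "exp (ln (real (N choose k)) + real N * (H s + I_fun s)) = W N * f T * exp (e + c + b)"
      by (simp only: W_def f_def exp_add)
    hence wt: "wt H N k = W N * f T * exp (e + c + b)"
      using bpos by (simp add: wt_def s_def exp_add)
    have "\<bar>exp (e + c + b) - 1\<bar> \<le> \<bar>e + c + b\<bar> * exp \<bar>e + c + b\<bar>" by (rule abs_exp_minus_1_le)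
    also have "\<dots> \<le> (K * S * \<eta>) * exp E0" using ecb eE by (intro mult_mono) auto
    also have "\<dots> \<le> (2 * K * S * \<eta>) * exp (2 * E0)"
      using eE K S \<eta> by (intro mult_mono) auto
    finally have "\<bar>exp (e + c + b) - 1\<bar> * f T \<le> (2 * K * S * \<eta>) * exp (2 * E0) * f T"
      by (intro mult_right_mono) auto
    moreover have "wt H N k / W N - f T = (exp (e + c + b) - 1) * f T"
      using wt W_pos[of N] by (simp add: field_simps)
    ultimately have "\<bar>wt H N k / W N - f T\<bar> \<le> (2 * K * S * \<eta>) * exp (2 * E0) * f T"
      by (simp add: abs_mult)
    thus "\<bar>wt H N k / W N - f (t N k)\<bar> \<le>
       2 * K * exp (2 * E0) * real N powr (- 1 / real d) * (1 + \<bar>t N k\<bar> ^ (d + 1)) * f (t N k)"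
      unfolding T_def[symmetric] \<eta>_def[symmetric] S_def[symmetric] by (simp add: mult_ac)
  qed (use N1 in auto)
qed

text \<open>The entropy bound has no factor \<open>1 / sqrt N\<close>, whereas \<open>W N\<close>
  contains one; this leaves \<open>sqrt N\<close>, harmless against the exponential.\<close>

lemma weight_far:
  "\<exists>b>0. \<exists>C>0. \<forall>N>0. \<forall>k\<le>N. spin N k \<in> A \<longrightarrow> wt H N k / W N \<le> C * sqrt (real N) * exp (- b * t N k ^ d)"
proof -
  obtain b where b: "b > 0" "\<And>s. s \<in> A \<Longrightarrow> s \<in> {-1..1} \<Longrightarrow> H s \<le> H m - b * \<bar>s - m\<bar> ^ d"
    using global_bound by blast
  define C where "C = exp (ln (1 - m\<^sup>2) / 2 - binom_const)"
  have C: "C > 0" by (simp add: C_def)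
  show ?thesis
  proof (rule exI[of _ b], rule conjI[OF b(1)], rule exI[of _ C], rule conjI[OF C], intro allI impI)
    fix N k assume N: "N > 0" and k: "k \<le> N" "spin N k \<in> A"
    define s where "s = spin N k"
    have "H s \<le> H m - b * \<bar>s - m\<bar> ^ d" unfolding s_def using k spin_bounds[of k N] by (intro b) auto
    hence "real N * H s \<le> real N * (H m - b * \<bar>s - m\<bar> ^ d)" by (intro mult_left_mono) auto
    also have "\<dots> = real N * H m - b * (real N * \<bar>s - m\<bar> ^ d)" by (simp add: algebra_simps)
    also have "real N * \<bar>s - m\<bar> ^ d = t N k ^ d"
      unfolding s_def using spin_minus_power[OF N d_pos, of k m] d_even by (simp add: power_even_abs)
    finally have H: "real N * H s \<le> real N * H m - b * t N k ^ d" .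
    have "wt H N k \<le> (2 ^ N * exp (- real N * I_fun s)) * exp (real N * (H s + I_fun s))"
      unfolding wt_def s_def using binomial_entropy_upper[of N k] N k by (intro mult_right_mono) auto
    also have "\<dots> = 2 ^ N * exp (real N * H s)" by (simp add: exp_add[symmetric] algebra_simps)
    also have "\<dots> \<le> 2 ^ N * exp (real N * H m - b * t N k ^ d)" using H by (intro mult_left_mono) auto
    also have "(2::real) ^ N = exp (real N * ln 2)" by (simp add: exp_of_nat_mult)
    finally have "wt H N k / W N \<le> exp (real N * ln 2) * exp (real N * H m - b * t N k ^ d) / W N"
      using W_pos[of N] by (intro divide_right_mono) auto
    also have "\<dots> = C * exp (ln (real N) / 2) * exp (- b * t N k ^ d)"
      unfolding W_def C_def by (simp add: exp_add[symmetric] exp_diff[symmetric] algebra_simps)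
    also have "exp (ln (real N) / 2) = sqrt (real N)"
      using N by (simp add: ln_sqrt[symmetric])
    finally show "wt H N k / W N \<le> C * sqrt (real N) * exp (- b * t N k ^ d)" .
  qed
qed

end

section \<open>From one-sided sums to the ratio of a tail to the total mass\<close>

lemma quotient_error_le:
  fixes p q K1 K2 \<eta> S :: real
  assumes p: "\<bar>p - 1\<bar> \<le> K1 * \<eta> * S" and q: "\<bar>q - 1\<bar> \<le> K2 * \<eta>"
    and K: "0 \<le> K2" "0 \<le> \<eta>" "1 \<le> S" "K2 * \<eta> \<le> 1 / 2"
  shows "\<bar>p / q - 1\<bar> \<le> 2 * (K1 + K2) * S * \<eta>"
proof -
  have q2: "q \<ge> 1 / 2" using q K by linarith
  have "\<bar>p - q\<bar> \<le> K1 * \<eta> * S + K2 * \<eta>" using p q by linarith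
  moreover have "K2 * \<eta> * 1 \<le> K2 * \<eta> * S" using K by (intro mult_left_mono) auto
  moreover have "(K1 + K2) * S * \<eta> = K1 * \<eta> * S + K2 * \<eta> * S" by (simp add: algebra_simps)
  ultimately have pq: "\<bar>p - q\<bar> \<le> (K1 + K2) * S * \<eta>" by linarith
  have "p / q - 1 = (p - q) / q" using q2 by (simp add: field_simps)
  hence "\<bar>p / q - 1\<bar> = \<bar>p - q\<bar> / q" using q2 by (simp only: abs_divide)
  also have "\<dots> \<le> \<bar>p - q\<bar> / (1 / 2)" using q2 by (intro divide_left_mono) auto
  also have "\<dots> \<le> 2 * ((K1 + K2) * S * \<eta>)" using pq by simp
  finally show ?thesis by (simp add: mult_ac)
qed

context laplace_peak
begin

abbreviation "\<eta> N \<equiv> real N powr (- 1 / real d)"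

text \<open>\<open>window N ^ d\<close> is a positive power of \<open>N\<close>, so the exponential
  beats every polynomial factor: the number of levels, the \<open>sqrt N\<close> of the far bound,
  and the price of passing from \<open>f x\<close> to \<open>Q x\<close>. The constant
  \<open>c1\<close> belongs to \<open>Q T\<close>, \<open>c2\<close> to the levels beyond
  \<open>T\<close>.\<close>

lemma far_negligible:
  assumes c: "c1 > 0" "c2 > 0" "C0 > 0"
  shows "\<exists>N0>0. \<forall>N\<ge>N0. (c1 + c2 * (real N + 1) * sqrt (real N)) * (1 + C0 * window N) ^ (d - 1)
     * exp (- (window N ^ d)) \<le> \<eta> N"
proof -
  have "\<forall>\<^sub>F N in sequentially. (c1 + c2 * (real N + 1) * sqrt (real N)) * (1 + C0 * window N) ^ (d - 1)
     * exp (- (window N ^ d)) * real N powr (1 / real d) < 1"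
    using d_cases
  proof
    assume d: "d = 2"
    have "((\<lambda>N. (c1 + c2 * (real N + 1) * sqrt (real N)) * (1 + C0 * real N powr (1 / 6)) ^ 1
     * exp (- ((real N powr (1 / 6)) ^ 2)) * real N powr (1 / 2)) \<longlongrightarrow> 0) sequentially"
      using c by real_asymp
    from order_tendstoD(2)[OF this zero_less_one] show ?thesis unfolding window_def by (simp add: d)
  next
    assume d: "d = 4"
    have "((\<lambda>N. (c1 + c2 * (real N + 1) * sqrt (real N)) * (1 + C0 * real N powr (1 / 20)) ^ 3
     * exp (- ((real N powr (1 / 20)) ^ 4)) * real N powr (1 / 4)) \<longlongrightarrow> 0) sequentially"
      using c by real_asymp
    from order_tendstoD(2)[OF this zero_less_one] show ?thesis unfolding window_def by (simp add: d)
  qed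
  then obtain N0 where N0: "\<And>N. N \<ge> N0 \<Longrightarrow> (c1 + c2 * (real N + 1) * sqrt (real N)) * (1 + C0 * window N) ^ (d - 1)
     * exp (- (window N ^ d)) * real N powr (1 / real d) < 1"
    unfolding eventually_sequentially by blast
  show ?thesis
  proof (intro exI[of _ "max 1 N0"] conjI allI impI)
    fix N assume N: "max 1 N0 \<le> N"
    have e: "\<eta> N = 1 / real N powr (1 / real d)" by (simp add: powr_minus divide_inverse)
    have Y: "real N powr (1 / real d) > 0" using N by simp
    show "(c1 + c2 * (real N + 1) * sqrt (real N)) * (1 + C0 * window N) ^ (d - 1) * exp (- (window N ^ d)) \<le> \<eta> N"
      unfolding e pos_le_divide_eq[OF Y] using N0[of N] N by simp
  qed auto
qed

text \<open>For \<open>d = 2\<close> the mesh is \<open>2 / sqrt N\<close>, hence the threshold 4.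
  The comparison with \<open>N powr (- 1 / d)\<close> rests on
  \<open>1 / d \<le> 1 - 1 / d\<close>.\<close>

lemma spacing_bounds:
  assumes "N \<ge> 4"
  shows "0 < \<epsilon> N" "\<epsilon> N \<le> 1" "\<epsilon> N \<le> 2 * \<eta> N"
proof -
  have d2: "1 / 2 \<le> 1 - 1 / real d" "1 / real d \<le> 1 - 1 / real d" using d_cases by auto
  show "0 < \<epsilon> N" using assms by (simp add: spacing_def)
  have "2 = sqrt 4" by simp
  also have "\<dots> \<le> sqrt (real N)" using assms by (intro real_sqrt_le_mono) auto
  also have "\<dots> = real N powr (1 / 2)" by (simp add: powr_half_sqrt)
  also have "\<dots> \<le> real N powr (1 - 1 / real d)" using assms d2 by (intro powr_mono) auto
  finally show "\<epsilon> N \<le> 1" using assms by (simp add: spacing_def field_simps)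
  have "real N powr (1 / real d) \<le> real N powr (1 - 1 / real d)" using assms d2 by (intro powr_mono) auto
  hence "2 / real N powr (1 - 1 / real d) \<le> 2 / real N powr (1 / real d)" using assms by (intro divide_left_mono) auto
  thus "\<epsilon> N \<le> 2 * \<eta> N" by (simp add: spacing_def powr_minus divide_inverse)
qed

lemma spacing_window:
  assumes "N > 0" "C0 > 0" "0 \<le> x" "x \<le> C0 * window N"
  shows "\<epsilon> N * (1 + x) ^ (d - 1) \<le> 2 * (1 + C0) ^ (d - 1)"
proof -
  define Y where "Y = real N powr (1 / real d)"
  have Y: "Y \<ge> 1" unfolding Y_def using assms by (intro ge_one_powr_ge_zero) auto
  have Yp: "Y ^ (d - 1) = real N powr (1 - 1 / real d)"
  proof -
    have "Y ^ (d - 1) = Y powr (real (d - 1))" using Y by (subst powr_realpow) auto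
    also have "\<dots> = real N powr (1 - 1 / real d)"
      using d_pos unfolding Y_def by (subst powr_powr) (simp add: of_nat_diff field_simps)
    finally show ?thesis .
  qed
  have "x \<le> C0 * Y" using assms window_le[OF assms(1)] unfolding Y_def
    by (smt (verit) mult_left_mono)
  hence "1 + x \<le> (1 + C0) * Y" using Y by (simp add: algebra_simps)
  hence "(1 + x) ^ (d - 1) \<le> ((1 + C0) * Y) ^ (d - 1)" using assms by (intro power_mono) auto
  also have "\<dots> = (1 + C0) ^ (d - 1) * real N powr (1 - 1 / real d)" by (simp only: power_mult_distrib Yp)
  finally have "\<epsilon> N * (1 + x) ^ (d - 1) \<le> \<epsilon> N * ((1 + C0) ^ (d - 1) * real N powr (1 - 1 / real d))"
    by (intro mult_left_mono) (auto simp: spacing_def)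
  also have "\<dots> = 2 * (1 + C0) ^ (d - 1)" using assms by (simp add: spacing_def)
  finally show ?thesis .
qed

text \<open>The sum is cut at \<open>T = B * window N\<close>. Below \<open>T\<close> the local
  approximation and the Riemann sum estimate apply; above \<open>T\<close> the crude bound is summed
  over at most \<open>N + 1\<close> levels. That part and \<open>Q T\<close> are both smaller than
  \<open>N powr (- 1 / d) * Q x\<close>, uniformly for \<open>x\<close> up to
  \<open>C0 * window N\<close>.\<close>

lemma one_sided:
  assumes C0: "C0 > 0"
  shows "\<exists>K\<ge>0. \<exists>N0::nat. \<forall>N\<ge>N0. \<forall>x\<in>{0..C0 * window N}.
    \<bar>\<epsilon> N * (\<Sum>k | k \<le> N \<and> spin N k \<in> A \<and> t N k > x. wt H N k / W N) - Q x\<bar>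
      \<le> K * \<eta> N * (1 + x ^ (d + 1)) * Q x"
proof -
  obtain b Cf where b: "b > 0" "Cf > 0"
    "\<And>N k. N > 0 \<Longrightarrow> k \<le> N \<Longrightarrow> spin N k \<in> A \<Longrightarrow> wt H N k / W N \<le> Cf * sqrt (real N) * exp (- b * t N k ^ d)"
    using weight_far by blast
  \<comment> \<open>\<open>a * C0 ^ d\<close> covers the decay of \<open>f\<close> at the largest
    admissible \<open>x\<close>; the extra 1 leaves a spare factor
    \<open>exp (- (window N ^ d))\<close>. \<open>B\<close> is then made so large that both decay
    rates, \<open>a\<close> and \<open>b\<close>, reach \<open>E\<close> at
    \<open>T\<close>.\<close>
  define E where "E = a * C0 ^ d + 1"
  have E: "E > 0" using a_pos C0 by (auto simp: E_def intro!: add_pos_pos)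
  define B where "B = max 1 (max C0 (max (E / a) (E / b)))"
  have B: "B \<ge> 1" "B \<ge> C0" "E / a \<le> B" "E / b \<le> B" by (auto simp: B_def)
  have BBd: "B \<le> B ^ d" using B d_pos by (intro self_le_power) auto
  have aB: "a * B ^ d \<ge> E" and bB: "b * B ^ d \<ge> E"
  proof -
    have "E / a \<le> B ^ d" "E / b \<le> B ^ d" using B BBd by linarith+
    thus "a * B ^ d \<ge> E" "b * B ^ d \<ge> E" using a_pos b(1) by (auto simp: field_simps)
  qed
  obtain K1 N1 where K1: "K1 \<ge> 0" "N1 > 0" "\<And>N k. N \<ge> N1 \<Longrightarrow> \<bar>t N k\<bar> \<le> B * window N \<Longrightarrow>
    \<bar>wt H N k / W N - f (t N k)\<bar> \<le> K1 * \<eta> N * (1 + \<bar>t N k\<bar> ^ (d + 1)) * f (t N k)"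
  proof -
    have "B > 0" using B(1) by simp
    from weight_local[OF this] that show thesis by blast
  qed
  obtain N2 where N2: "\<And>N k. N \<ge> N2 \<Longrightarrow> \<bar>t N k\<bar> \<le> B * window N \<Longrightarrow> spin N k \<in> A \<and> 0 < k \<and> k < N"
    using in_window[of B] by blast
  have M: "2 * (1 + C0) ^ (d - 1) > 0" using C0 by simp
  show ?thesis
  proof (rule tail_sum_approx[OF M])
  fix C :: real assume C: "C > 0" "\<And>(x::real) (\<tau>::real) (\<epsilon>::real) (T::real) (\<kappa>::real) v.
     0 \<le> x \<Longrightarrow> \<tau> \<le> x \<Longrightarrow> x \<le> T \<Longrightarrow> 0 < \<epsilon> \<Longrightarrow> \<epsilon> \<le> 1 \<Longrightarrow>
     \<epsilon> * (1 + x) ^ (d - 1) \<le> 2 * (1 + C0) ^ (d - 1) \<Longrightarrow> 0 \<le> \<kappa> \<Longrightarrow>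
     (\<And>k::nat. x < \<tau> + \<epsilon> * k \<Longrightarrow> \<tau> + \<epsilon> * k \<le> T \<Longrightarrow>
        \<bar>v k - f (\<tau> + \<epsilon> * k)\<bar> \<le> \<kappa> * (1 + (\<tau> + \<epsilon> * k) ^ (d + 1)) * f (\<tau> + \<epsilon> * k)) \<Longrightarrow>
     \<bar>\<epsilon> * (\<Sum>k\<in>{k::nat. x < \<tau> + \<epsilon> * k \<and> \<tau> + \<epsilon> * k \<le> T}. v k) - Q x\<bar>
       \<le> C * (\<kappa> + \<epsilon>) * (1 + x ^ (d + 1)) * Q x + Q T"
  define c1 where "c1 = exp (a * d) / (a * d)"
  define c2 where "c2 = exp (a * d) * Cf"
  have c12: "c1 > 0" "c2 > 0" using a_pos d_pos b by (auto simp: c1_def c2_def)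
  obtain N3 where N3: "N3 > 0" "\<And>N. N \<ge> N3 \<Longrightarrow> (c1 + c2 * (real N + 1) * sqrt (real N)) * (1 + C0 * window N) ^ (d - 1)
     * exp (- (window N ^ d)) \<le> \<eta> N"
    using far_negligible[OF c12 C0] by blast
  show ?thesis
  proof (intro exI[of _ "C * (K1 + 2) + 1"] exI[of _ "max 4 (max N1 (max N2 N3))"] conjI allI impI ballI)
    show "0 \<le> C * (K1 + 2) + 1" using C K1 by simp
    fix N x assume N: "max 4 (max N1 (max N2 N3)) \<le> N" and x: "x \<in> {0..C0 * window N}"
    have N': "N \<ge> 4" "N \<ge> N1" "N \<ge> N2" "N \<ge> N3" "N > 0" using N by auto
    define X where "X = window N"
    define T where "T = B * X"
    have X: "X \<ge> 1" using window_ge_1 N' by (simp add: X_def)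
    have "B * 1 \<le> B * X" using B X by (intro mult_left_mono) auto
    hence T: "T \<ge> 1" using B unfolding T_def by linarith
    have "C0 * X \<le> B * X" using B X by (intro mult_right_mono) auto
    hence xT: "0 \<le> x" "x \<le> T" using x by (auto simp: T_def X_def)
    define v where "v = (\<lambda>k. wt H N k / W N)"
    define J where "J = {k. x < t N k \<and> t N k \<le> T}"
    define G where "G = {k. k \<le> N \<and> spin N k \<in> A \<and> t N k > T}"
    \<comment> \<open>The constraints \<open>k \<le> N\<close> and \<open>spin N k \<in> A\<close>
      hold automatically up to \<open>T\<close>, so the near part is a full stretch of the
      lattice.\<close>
    have JG: "{k. k \<le> N \<and> spin N k \<in> A \<and> t N k > x} = J \<union> G"
    proof -
      have "spin N k \<in> A \<and> k \<le> N" if "k \<in> J" for k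
        using N2[OF N'(3), of k] that xT by (auto simp: J_def T_def X_def)
      thus ?thesis using xT by (auto simp: J_def G_def)
    qed
    have fJ: "finite J" "finite G" 
    proof -
      show "finite G" by (rule finite_subset[of _ "{..N}"]) (auto simp: G_def)
      show "finite J" by (rule finite_subset[of _ "{..N}"]) (use JG in auto)
    qed
    have disj: "J \<inter> G = {}" by (auto simp: J_def G_def)
    have near: "\<bar>\<epsilon> N * (\<Sum>k\<in>J. v k) - Q x\<bar> \<le> C * (K1 * \<eta> N + \<epsilon> N) * (1 + x ^ (d + 1)) * Q x + Q T"
      unfolding J_def scaled_affine
    proof (rule C(2))
      \<comment> \<open>The lattice starts at spin -1, to the left of \<open>m\<close>, hence at a
        nonpositive rescaled point.\<close>
      show "- (real N + real N * m) / real N powr (1 - 1 / real d) \<le> x"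
      proof -
        have "real N * (1 + m) \<ge> 0" using m_bounds by (intro mult_nonneg_nonneg) auto
        hence "- (real N + real N * m) / real N powr (1 - 1 / real d) \<le> 0"
          by (intro divide_nonpos_nonneg) (auto simp: algebra_simps)
        thus ?thesis using xT by simp
      qed
      show "\<epsilon> N * (1 + x) ^ (d - 1) \<le> 2 * (1 + C0) ^ (d - 1)"
        using spacing_window[of N C0 x] N' C0 x by auto
      fix k assume "x < - (real N + real N * m) / real N powr (1 - 1 / real d) + \<epsilon> N * real k"
        "- (real N + real N * m) / real N powr (1 - 1 / real d) + \<epsilon> N * real k \<le> T"
      hence k: "x < t N k" "t N k \<le> T" unfolding scaled_affine .
      show "\<bar>v k - f (- (real N + real N * m) / real N powr (1 - 1 / real d) + \<epsilon> N * real k)\<bar>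
        \<le> K1 * \<eta> N * (1 + (- (real N + real N * m) / real N powr (1 - 1 / real d) + \<epsilon> N * real k) ^ (d + 1))
         * f (- (real N + real N * m) / real N powr (1 - 1 / real d) + \<epsilon> N * real k)"
        unfolding scaled_affine[symmetric]
      proof -
        have "\<bar>t N k\<bar> = t N k" "\<bar>t N k\<bar> \<le> B * window N" using k xT by (auto simp: T_def X_def)
        thus "\<bar>v k - f (t N k)\<bar> \<le> K1 * \<eta> N * (1 + t N k ^ (d + 1)) * f (t N k)"
          using K1(3)[OF N'(2), of k] by (simp add: v_def)
      qed
    qed (use xT spacing_bounds[OF N'(1)] K1 in auto)
    \<comment> \<open>Used with \<open>y = b\<close> for the far weights and with
      \<open>y = a\<close> for \<open>Q T\<close>.\<close>
    have expX: "exp (- y * T ^ d) \<le> f x * exp (- (X ^ d))" if "y * B ^ d \<ge> E" for y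
    proof -
      have "x ^ d \<le> (C0 * X) ^ d" using x by (intro power_mono) (auto simp: X_def)
      hence "a * x ^ d \<le> a * (C0 * X) ^ d" using a_pos by (intro mult_left_mono) auto
      hence "a * x ^ d + X ^ d \<le> E * X ^ d" by (simp add: E_def power_mult_distrib algebra_simps)
      also have "\<dots> \<le> y * B ^ d * X ^ d" using that X by (intro mult_right_mono) auto
      finally have "- y * T ^ d \<le> - a * x ^ d + - (X ^ d)" by (simp add: T_def power_mult_distrib)
      thus ?thesis by (simp add: f_def exp_add[symmetric])
    qed
    have far: "(\<Sum>k\<in>G. v k) \<le> (real N + 1) * (Cf * sqrt (real N) * (f x * exp (- (X ^ d))))"
    proof -
      have "(\<Sum>k\<in>G. v k) \<le> real (card G) * (Cf * sqrt (real N) * (f x * exp (- (X ^ d))))"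
      proof (rule sum_bounded_above)
        fix k assume k: "k \<in> G"
        have "v k \<le> Cf * sqrt (real N) * exp (- b * t N k ^ d)"
          unfolding v_def using k N' by (intro b(3)) (auto simp: G_def)
        also have "exp (- b * t N k ^ d) \<le> exp (- b * T ^ d)"
          using k T b(1) by (auto simp: G_def intro!: power_mono)
        also have "\<dots> \<le> f x * exp (- (X ^ d))" by (rule expX[OF bB])
        finally show "v k \<le> Cf * sqrt (real N) * (f x * exp (- (X ^ d)))"
          using b(2) by (simp add: mult_left_mono)
      qed
      also have "real (card G) \<le> real N + 1"
      proof -
        have "card G \<le> card {..N}" by (intro card_mono) (auto simp: G_def)
        thus ?thesis by simp
      qed
      finally show ?thesis using b(2) by (simp add: mult_right_mono)
    qed
    have v0: "v k \<ge> 0" for k using W_pos[of N] by (simp add: v_def wt_nonneg)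
    have "\<epsilon> N * (\<Sum>k\<in>G. v k) \<le> 1 * (\<Sum>k\<in>G. v k)"
      using spacing_bounds[OF N'(1)] v0 by (intro mult_right_mono sum_nonneg) auto
    hence far': "\<epsilon> N * (\<Sum>k\<in>G. v k) \<le> (real N + 1) * (Cf * sqrt (real N) * (f x * exp (- (X ^ d))))"
      using far by simp
    have far0: "0 \<le> \<epsilon> N * (\<Sum>k\<in>G. v k)"
      using spacing_bounds[OF N'(1)] v0 by (intro mult_nonneg_nonneg sum_nonneg) auto
    have "Q T \<le> f T / (a * d)" by (rule Q_le_f[OF T])
    also have "f T \<le> f x * exp (- (X ^ d))" using expX[OF aB] by (simp add: f_def)
    hence "f T / (a * d) \<le> f x * exp (- (X ^ d)) / (a * d)" using a_pos by (intro divide_right_mono) auto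
    finally have QT: "Q T \<le> f x * exp (- (X ^ d)) / (a * d)" .
    have "Q T + \<epsilon> N * (\<Sum>k\<in>G. v k) \<le> (1 / (a * d) + Cf * (real N + 1) * sqrt (real N)) * exp (- (X ^ d)) * f x"
      using QT far' by (simp add: algebra_simps)
    also have "\<dots> \<le> (1 / (a * d) + Cf * (real N + 1) * sqrt (real N)) * exp (- (X ^ d)) * (exp (a * d) * (1 + x) ^ (d - 1) * Q x)"
      using f_le_Q[OF xT(1)] a_pos b(2) by (intro mult_left_mono) auto
    also have "\<dots> = (c1 + c2 * (real N + 1) * sqrt (real N)) * exp (- (X ^ d)) * (1 + x) ^ (d - 1) * Q x"
      by (simp add: c1_def c2_def algebra_simps)
    also have "\<dots> \<le> (c1 + c2 * (real N + 1) * sqrt (real N)) * exp (- (X ^ d)) * (1 + C0 * X) ^ (d - 1) * Q x"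
      using x c12 Q_nonneg by (intro mult_right_mono mult_left_mono power_mono) (auto simp: X_def)
    also have "\<dots> \<le> \<eta> N * Q x"
      using N3(2)[OF N'(4)] Q_nonneg by (intro mult_right_mono) (auto simp: X_def mult_ac)
    also have "\<dots> \<le> \<eta> N * (1 + x ^ (d + 1)) * Q x"
      using xT Q_nonneg by (intro mult_right_mono) (auto simp: algebra_simps)
    finally have rest: "Q T + \<epsilon> N * (\<Sum>k\<in>G. v k) \<le> \<eta> N * (1 + x ^ (d + 1)) * Q x" .
    have "C * (K1 * \<eta> N + \<epsilon> N) * (1 + x ^ (d + 1)) * Q x \<le> C * (K1 * \<eta> N + 2 * \<eta> N) * (1 + x ^ (d + 1)) * Q x"
      using spacing_bounds(3)[OF N'(1)] C(1) xT Q_nonneg by (intro mult_right_mono mult_left_mono) auto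
    hence "\<bar>\<epsilon> N * (\<Sum>k\<in>J. v k) - Q x\<bar> + \<epsilon> N * (\<Sum>k\<in>G. v k)
       \<le> C * (K1 * \<eta> N + 2 * \<eta> N) * (1 + x ^ (d + 1)) * Q x + \<eta> N * (1 + x ^ (d + 1)) * Q x"
      using near rest by linarith
    also have "\<dots> = (C * (K1 + 2) + 1) * \<eta> N * (1 + x ^ (d + 1)) * Q x" by algebra
    finally have fin: "\<bar>\<epsilon> N * (\<Sum>k\<in>J. v k) - Q x\<bar> + \<epsilon> N * (\<Sum>k\<in>G. v k)
       \<le> (C * (K1 + 2) + 1) * \<eta> N * (1 + x ^ (d + 1)) * Q x" .
    have "(\<Sum>k\<in>J \<union> G. v k) = (\<Sum>k\<in>J. v k) + (\<Sum>k\<in>G. v k)"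
      using fJ disj by (intro sum.union_disjoint)
    hence "\<epsilon> N * (\<Sum>k\<in>J \<union> G. v k) = \<epsilon> N * (\<Sum>k\<in>J. v k) + \<epsilon> N * (\<Sum>k\<in>G. v k)"
      by (simp only: distrib_left)
    thus "\<bar>\<epsilon> N * (\<Sum>k | k \<le> N \<and> spin N k \<in> A \<and> t N k > x. wt H N k / W N) - Q x\<bar>
      \<le> (C * (K1 + 2) + 1) * \<eta> N * (1 + x ^ (d + 1)) * Q x"
      unfolding JG v_def[symmetric] using fin far0 by linarith
  qed
qed
qed

text \<open>Evenness of \<open>d\<close> leaves \<open>a * u ^ d\<close> unchanged under
  \<open>u\<close> to \<open>- u\<close>; both estimates on \<open>H\<close> are otherwise
  symmetric.\<close>

lemma laplace_peak_reflected: "laplace_peak a d Q (\<lambda>s. H (- s)) (- m) {s. - s \<in> A}"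
proof (intro laplace_peak.intro laplace_peak_axioms.intro)
  show "\<exists>e>0. \<forall>s. \<bar>s - (- m)\<bar> \<le> e \<longrightarrow> s \<in> {s. - s \<in> A}"
  proof -
    obtain e where e: "e > 0" "\<And>s. \<bar>s - m\<bar> \<le> e \<Longrightarrow> s \<in> A" using A_nhd by blast
    have "\<bar>- s - m\<bar> = \<bar>s - (- m)\<bar>" for s by (simp add: abs_if)
    thus ?thesis using e by (metis mem_Collect_eq)
  qed
  obtain \<delta> L where L: "\<delta> > 0" "\<And>u. \<bar>u\<bar> \<le> \<delta> \<Longrightarrow> \<bar>H (m + u) - H m + a * u ^ d\<bar> \<le> L * \<bar>u\<bar> ^ (d + 1)"
    using local_expansion by blast
  have "\<bar>H (- (- m + u)) - H (- (- m)) + a * u ^ d\<bar> \<le> L * \<bar>u\<bar> ^ (d + 1)" if "\<bar>u\<bar> \<le> \<delta>" for u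
    using L(2)[of "- u"] that d_even by simp
  thus "\<exists>\<delta>>0. \<exists>L. \<forall>u. \<bar>u\<bar> \<le> \<delta> \<longrightarrow> \<bar>H (- (- m + u)) - H (- (- m)) + a * u ^ d\<bar> \<le> L * \<bar>u\<bar> ^ (d + 1)"
    using L(1) by blast
  obtain b where b: "b > 0" "\<And>s. s \<in> A \<Longrightarrow> s \<in> {-1..1} \<Longrightarrow> H s \<le> H m - b * \<bar>s - m\<bar> ^ d"
    using global_bound by blast
  have "H (- s) \<le> H (- (- m)) - b * \<bar>s - (- m)\<bar> ^ d" if "s \<in> {s. - s \<in> A} \<inter> {-1..1}" for s
  proof -
    have "\<bar>- s - m\<bar> = \<bar>s - (- m)\<bar>" by (simp add: abs_if)
    thus ?thesis using b(2)[of "- s"] that by simp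
  qed
  thus "\<exists>b>0. \<forall>s\<in>{s. - s \<in> A} \<inter> {-1..1}. H (- s) \<le> H (- (- m)) - b * \<bar>s - (- m)\<bar> ^ d"
    using b(1) by blast
qed (use d_cases m_bounds tail_function_axioms in simp_all)

lemma one_sided_sign:
  fixes r :: nat
  assumes C0: "C0 > 0" and r: "r \<le> 1"
  shows "\<exists>K\<ge>0. \<exists>N0::nat. \<forall>N\<ge>N0. \<forall>x\<in>{0..C0 * window N}.
    \<bar>\<epsilon> N * (\<Sum>k | k \<le> N \<and> spin N k \<in> A \<and> (- 1) ^ r * t N k > x. wt H N k / W N) - Q x\<bar>
      \<le> K * \<eta> N * (1 + x ^ (d + 1)) * Q x"
proof (cases "r = 0")
  case True
  thus ?thesis using one_sided[OF C0] by simp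
next
  case False
  hence r1: "r = 1" using r by simp
  interpret R: laplace_peak a d Q "\<lambda>s. H (- s)" "- m" "{s. - s \<in> A}" by (rule laplace_peak_reflected)
  \<comment> \<open>The normalization sees \<open>m\<close> only through \<open>m\<^sup>2\<close>
    and the peak value, so both tails are measured against the same constant.\<close>
  have W: "R.W N = W N" for N by (simp add: W_def R.W_def)
  have sum: "(\<Sum>k | k \<le> N \<and> spin N k \<in> {s. - s \<in> A} \<and> R.t N k > x. wt (\<lambda>s. H (- s)) N k / W N)
     = (\<Sum>k | k \<le> N \<and> spin N k \<in> A \<and> (- 1) ^ r * t N k > x. wt H N k / W N)" for N x
  proof (rule sum.reindex_bij_witness[of _ "\<lambda>k. N - k" "\<lambda>k. N - k"])
    fix k assume k: "k \<in> {k. k \<le> N \<and> spin N k \<in> {s. - s \<in> A} \<and> R.t N k > x}"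
    hence kN: "k \<le> N" by simp
    show "N - (N - k) = k" using kN by simp
    show "wt H N (N - k) / W N = wt (\<lambda>s. H (- s)) N k / W N"
      using wt_flip[of "N - k" N H] kN by simp
    have "t N (N - k) = - R.t N k" using scaled_flip[of k N d "- m"] kN by simp
    thus "N - k \<in> {k. k \<le> N \<and> spin N k \<in> A \<and> (- 1) ^ r * t N k > x}"
      using k kN by (simp add: spin_flip r1)
  next
    fix k assume k: "k \<in> {k. k \<le> N \<and> spin N k \<in> A \<and> (- 1) ^ r * t N k > x}"
    hence kN: "k \<le> N" by simp
    show "N - (N - k) = k" using kN by simp
    show "N - k \<in> {k. k \<le> N \<and> spin N k \<in> {s. - s \<in> A} \<and> R.t N k > x}"
      using k kN by (simp add: spin_flip r1 scaled_flip)
  qed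
  show ?thesis using R.one_sided[OF C0] unfolding W sum .
qed

text \<open>The denominator is the sum of the two one-sided tails at 0 and the level with
  \<open>t = 0\<close>, if there is one. Each tail is close to \<open>Q 0\<close>, whence
  \<open>2 * Q 0\<close>; the single level weighs one mesh width, which is of the order of the
  allowed error.\<close>

lemma moderate_deviation_ratio:
  fixes r :: nat
  assumes C0: "C0 > 0" and r: "r \<le> 1"
  shows "\<exists>K N0. \<forall>N\<ge>N0. \<forall>x\<in>{0..C0 * window N}.
    \<bar>(\<Sum>k | k \<le> N \<and> spin N k \<in> A \<and> (- 1) ^ r * t N k > x. wt H N k) /
      (\<Sum>k | k \<le> N \<and> spin N k \<in> A. wt H N k) / (Q x / (2 * Q 0)) - 1\<bar>
      \<le> K * (1 + x ^ (d + 1)) * \<eta> N"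
proof -
  define S where "S = (\<lambda>N P. \<epsilon> N * (\<Sum>k | k \<le> N \<and> spin N k \<in> A \<and> P (t N k). wt H N k / W N))"
  define tail where "tail = (\<lambda>N r x. S N (\<lambda>y. (- 1) ^ r * y > x))"
  have ts: "\<exists>K\<ge>0. \<exists>N0::nat. \<forall>N\<ge>N0. \<forall>x\<in>{0..C0 * window N}. \<bar>tail N r x - Q x\<bar> \<le> K * \<eta> N * (1 + x ^ (d + 1)) * Q x"
    if "r \<le> 1" for r :: nat
    using one_sided_sign[OF C0 that] by (simp add: tail_def S_def)
  obtain Kr Nr where Kr: "Kr \<ge> 0" "\<And>N x. N \<ge> Nr \<Longrightarrow> x \<in> {0..C0 * window N} \<Longrightarrow> \<bar>tail N r x - Q x\<bar> \<le> Kr * \<eta> N * (1 + x ^ (d + 1)) * Q x"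
    using ts[OF r] by blast
  obtain Ka Na where Ka: "Ka \<ge> 0" "\<And>N x. N \<ge> Na \<Longrightarrow> x \<in> {0..C0 * window N} \<Longrightarrow> \<bar>tail N 0 x - Q x\<bar> \<le> Ka * \<eta> N * (1 + x ^ (d + 1)) * Q x"
    using ts[of 0] by blast
  obtain Kb Nb where Kb: "Kb \<ge> 0" "\<And>N x. N \<ge> Nb \<Longrightarrow> x \<in> {0..C0 * window N} \<Longrightarrow> \<bar>tail N 1 x - Q x\<bar> \<le> Kb * \<eta> N * (1 + x ^ (d + 1)) * Q x"
    using ts[of 1] by blast
  obtain Kc Nc where Kc: "Kc \<ge> 0" "Nc > 0" "\<And>N k. N \<ge> Nc \<Longrightarrow> \<bar>t N k\<bar> \<le> 1 * window N \<Longrightarrow>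
    \<bar>wt H N k / W N - f (t N k)\<bar> \<le> Kc * \<eta> N * (1 + \<bar>t N k\<bar> ^ (d + 1)) * f (t N k)"
    using weight_local[of 1] by (metis zero_less_one)
  \<comment> \<open>The errors of the two tails at 0 and of the central level, after division by
    \<open>2 * Q 0\<close>.\<close>
  define K2 where "K2 = (Ka + Kb) / 2 + (1 + Kc) / Q 0"
  have K2: "K2 \<ge> 0" using Ka Kb Kc Q_pos[of 0] by (simp add: K2_def)
  have "\<forall>\<^sub>F N in sequentially. K2 * \<eta> N < 1 / 2"
  proof -
    have "((\<lambda>N. K2 * \<eta> N) \<longlongrightarrow> 0) sequentially"
      using d_cases
    proof
      assume d: "d = 2"
      show ?thesis unfolding d by real_asymp
    next
      assume d: "d = 4"
      show ?thesis unfolding d by real_asymp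
    qed
    thus ?thesis by (rule order_tendstoD) simp
  qed
  then obtain Nd where Nd: "\<And>N. N \<ge> Nd \<Longrightarrow> K2 * \<eta> N < 1 / 2" unfolding eventually_sequentially by blast
  define N0 where "N0 = max 4 (max Nr (max Na (max Nb (max Nc Nd))))"
  show ?thesis
  proof (intro exI[of _ "2 * (Kr + K2)"] exI[of _ N0] allI impI ballI)
    fix N x assume N: "N0 \<le> N" and x: "x \<in> {0..C0 * window N}"
    have N': "N \<ge> 4" "N \<ge> Nr" "N \<ge> Na" "N \<ge> Nb" "N \<ge> Nc" "N \<ge> Nd" "N > 0" using N by (auto simp: N0_def)
    define D where "D = S N (\<lambda>_. True)"
    define zero where "zero = S N (\<lambda>y. y = 0)"
    have Dsum: "D = tail N 0 0 + tail N 1 0 + zero"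
    proof -
      define U where "U = (\<lambda>P. {k. k \<le> N \<and> spin N k \<in> A \<and> P (t N k)})"
      have fU: "finite (U P)" for P by (rule finite_subset[of _ "{..N}"]) (auto simp: U_def)
      have "U (\<lambda>_. True) = (U (\<lambda>y. (- 1) ^ 0 * y > 0) \<union> U (\<lambda>y. (- 1) ^ 1 * y > 0)) \<union> U (\<lambda>y. y = 0)"
        by (auto simp: U_def)
      moreover have "(U (\<lambda>y. (- 1) ^ 0 * y > 0) \<union> U (\<lambda>y. (- 1) ^ 1 * y > 0)) \<inter> U (\<lambda>y. y = 0) = {}"
        "U (\<lambda>y. (- 1) ^ 0 * y > 0) \<inter> U (\<lambda>y. (- 1) ^ 1 * y > 0) = {}"
        by (auto simp: U_def)
      ultimately have "sum g (U (\<lambda>_. True)) = sum g (U (\<lambda>y. (- 1) ^ 0 * y > 0)) + sum g (U (\<lambda>y. (- 1) ^ 1 * y > 0))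
        + sum g (U (\<lambda>y. y = 0))" for g :: "nat \<Rightarrow> real"
        by (simp only: sum.union_disjoint fU finite_Un simp_thms)
      thus ?thesis unfolding D_def zero_def tail_def S_def U_def distrib_left[symmetric] by (simp only:)
    qed
    have zero: "0 \<le> zero" "zero \<le> 2 * \<eta> N * (1 + Kc)"
    proof -
      define Z where "Z = {k. k \<le> N \<and> spin N k \<in> A \<and> t N k = 0}"
      have e: "\<epsilon> N > 0" "\<epsilon> N \<le> 2 * \<eta> N" using spacing_bounds[OF N'(1)] by auto
      have w0: "wt H N k / W N \<ge> 0" for k using W_pos[of N] by (simp add: wt_nonneg)
      show "0 \<le> zero" unfolding zero_def S_def using e w0 by (intro mult_nonneg_nonneg sum_nonneg) auto
      have "card Z \<le> 1"
      proof (rule card_le_Suc0_iff_eq[THEN iffD2, unfolded One_nat_def[symmetric]])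
        show "finite Z" by (rule finite_subset[of _ "{..N}"]) (auto simp: Z_def)
        show "\<forall>k\<in>Z. \<forall>l\<in>Z. k = l"
          using N'(7) by (auto simp: Z_def scaled_def)
      qed
      have \<eta>1: "\<eta> N \<le> 1"
      proof -
        have "\<eta> N \<le> real N powr 0" using N' d_pos by (intro powr_mono) (auto simp: field_simps)
        thus ?thesis using N' by simp
      qed
      have "wt H N k / W N \<le> 1 + Kc" if "k \<in> Z" for k
      proof -
        have t0: "t N k = 0" using that by (simp add: Z_def)
        have "\<bar>wt H N k / W N - 1\<bar> \<le> Kc * \<eta> N"
          using Kc(3)[OF N'(5), of k] window_ge_1[OF N'(7)] d_pos unfolding t0 by (simp add: f_def zero_power)
        moreover have "Kc * \<eta> N \<le> Kc * 1" using Kc \<eta>1 by (intro mult_left_mono) auto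
        ultimately show ?thesis by linarith
      qed
      hence "(\<Sum>k\<in>Z. wt H N k / W N) \<le> real (card Z) * (1 + Kc)" by (intro sum_bounded_above) auto
      also have "\<dots> \<le> 1 * (1 + Kc)" using \<open>card Z \<le> 1\<close> Kc by (intro mult_right_mono) auto
      finally have "(\<Sum>k\<in>Z. wt H N k / W N) \<le> 1 + Kc" by simp
      hence "\<epsilon> N * (\<Sum>k\<in>Z. wt H N k / W N) \<le> 2 * \<eta> N * (1 + Kc)"
        using e Kc w0 by (intro mult_mono sum_nonneg) auto
      thus "zero \<le> 2 * \<eta> N * (1 + Kc)" by (simp add: zero_def S_def Z_def)
    qed
    have Q0: "Q 0 > 0" "Q x > 0" by (rule Q_pos)+
    have "C0 * window N \<ge> 0" using C0 window_ge_1[OF N'(7)] by (intro mult_nonneg_nonneg) auto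
    hence "0 \<in> {0..C0 * window N}" by simp
    hence "\<bar>tail N 0 0 - Q 0\<bar> \<le> Ka * \<eta> N * Q 0" "\<bar>tail N 1 0 - Q 0\<bar> \<le> Kb * \<eta> N * Q 0"
      using Ka(2)[of N 0] Kb(2)[of N 0] N' by auto
    hence "\<bar>D - 2 * Q 0\<bar> \<le> Ka * \<eta> N * Q 0 + Kb * \<eta> N * Q 0 + 2 * \<eta> N * (1 + Kc)"
      using zero unfolding Dsum by linarith
    also have "\<dots> = K2 * \<eta> N * (2 * Q 0)" using Q0 by (simp add: K2_def field_simps)
    finally have "\<bar>D - 2 * Q 0\<bar> / (2 * Q 0) \<le> K2 * \<eta> N" using Q0 by (simp add: pos_divide_le_eq)
    moreover have "D / (2 * Q 0) - 1 = (D - 2 * Q 0) / (2 * Q 0)" using Q0 by (simp add: field_simps)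
    ultimately have q: "\<bar>D / (2 * Q 0) - 1\<bar> \<le> K2 * \<eta> N" using Q0 by (simp add: abs_divide)
    have "\<bar>tail N r x - Q x\<bar> / Q x \<le> Kr * \<eta> N * (1 + x ^ (d + 1))"
      using Kr(2)[OF N'(2) x] Q0 by (simp add: pos_divide_le_eq)
    moreover have "tail N r x / Q x - 1 = (tail N r x - Q x) / Q x" using Q0 by (simp add: field_simps)
    ultimately have p: "\<bar>tail N r x / Q x - 1\<bar> \<le> Kr * \<eta> N * (1 + x ^ (d + 1))" using Q0 by (simp add: abs_divide)
    have fin: "\<bar>(tail N r x / Q x) / (D / (2 * Q 0)) - 1\<bar> \<le> 2 * (Kr + K2) * (1 + x ^ (d + 1)) * \<eta> N"
      using p q K2 x Nd[OF N'(6)] by (intro quotient_error_le) auto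
    \<comment> \<open>Numerator and denominator carry the same factor, so neither the mesh nor
      \<open>W\<close> survives in the ratio.\<close>
    define c where "c = \<epsilon> N / W N"
    have c: "c > 0" using spacing_bounds[OF N'(1)] W_pos[of N] by (simp add: c_def)
    have "tail N r x = c * (\<Sum>k | k \<le> N \<and> spin N k \<in> A \<and> (- 1) ^ r * t N k > x. wt H N k)"
      by (simp add: tail_def S_def c_def sum_divide_distrib[symmetric])
    moreover have "D = c * (\<Sum>k | k \<le> N \<and> spin N k \<in> A. wt H N k)"
      by (simp add: D_def S_def c_def sum_divide_distrib[symmetric])
    ultimately have "(tail N r x / Q x) / (D / (2 * Q 0)) =
      (\<Sum>k | k \<le> N \<and> spin N k \<in> A \<and> (- 1) ^ r * t N k > x. wt H N k) /
      (\<Sum>k | k \<le> N \<and> spin N k \<in> A. wt H N k) / (Q x / (2 * Q 0))"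
      using c by simp
    thus "\<bar>(\<Sum>k | k \<le> N \<and> spin N k \<in> A \<and> (- 1) ^ r * t N k > x. wt H N k) /
      (\<Sum>k | k \<le> N \<and> spin N k \<in> A. wt H N k) / (Q x / (2 * Q 0)) - 1\<bar>
      \<le> 2 * (Kr + K2) * (1 + x ^ (d + 1)) * \<eta> N" using fin by (simp only:)
  qed
qed

end

section \<open>Global maximizers of H\<close>

text \<open>Closed forms of all derivatives of \<open>H\<close> on (-1, 1). Subtraction on naturals
  is harmless: once the order exceeds \<open>p\<close>, the product contains the factor
  \<open>p - p\<close> and the polynomial part vanishes.\<close>

fun H_diff :: "real \<Rightarrow> real \<Rightarrow> nat \<Rightarrow> nat \<Rightarrow> real \<Rightarrow> real" where
  "H_diff \<beta> h p 0 x = H_fun \<beta> h p x"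
| "H_diff \<beta> h p (Suc 0) x = \<beta> * real p * x ^ (p - 1) + h - (ln (1 + x) - ln (1 - x)) / 2"
| "H_diff \<beta> h p (Suc (Suc j)) x = \<beta> * (\<Prod>i<j + 2. real (p - i)) * x ^ (p - (j + 2))
     - fact j * ((- 1) ^ j / (1 + x) ^ (j + 1) + 1 / (1 - x) ^ (j + 1)) / 2"

lemma H_diff_eta:
  "H_diff \<beta> h p 0 = H_fun \<beta> h p"
  "H_diff \<beta> h p (Suc 0) = (\<lambda>x. \<beta> * real p * x ^ (p - 1) + h - (ln (1 + x) - ln (1 - x)) / 2)"
  "H_diff \<beta> h p (Suc (Suc j)) = (\<lambda>x. \<beta> * (\<Prod>i<j + 2. real (p - i)) * x ^ (p - (j + 2))
     - fact j * ((- 1) ^ j / (1 + x) ^ (j + 1) + 1 / (1 - x) ^ (j + 1)) / 2)"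
  by (rule ext, simp)+

lemma H_diff_deriv:
  assumes x: "- 1 < x" "x < 1"
  shows "(H_diff \<beta> h p j has_real_derivative H_diff \<beta> h p (Suc j) x) (at x)"
proof -
  consider "j = 0" | "j = 1" | i where "j = Suc (Suc i)" by (metis One_nat_def not0_implies_Suc)
  thus ?thesis
  proof cases
    case 1
    have dd: "((\<lambda>x. (1 + x) * ln (1 + x)) has_real_derivative ln (1 + x) + 1) (at x)"
      "((\<lambda>x. (1 - x) * ln (1 - x)) has_real_derivative - ln (1 - x) - 1) (at x)"
      using x by (auto intro!: derivative_eq_intros)
    have I: "(I_fun has_real_derivative (ln (1 + x) - ln (1 - x)) / 2) (at x)"
      using DERIV_cdivide[OF DERIV_add[OF dd], of 2] by (simp add: I_fun_def[abs_def])
    have "(H_fun \<beta> h p has_real_derivative H_diff \<beta> h p (Suc 0) x) (at x)"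
      unfolding H_fun_def[abs_def]
      by (rule derivative_eq_intros I refl)+ simp
    thus ?thesis unfolding 1 H_diff_eta(1) .
  next
    case 2
    have "((\<lambda>x. \<beta> * real p * x ^ (p - 1) + h - (ln (1 + x) - ln (1 - x)) / 2)
       has_real_derivative H_diff \<beta> h p (Suc (Suc 0)) x) (at x)"
      using x by (auto intro!: derivative_eq_intros simp: numeral_2_eq_2 lessThan_Suc)
    thus ?thesis unfolding 2 One_nat_def H_diff_eta(2) .
  next
    case 3
    have d1: "((\<lambda>x. (- 1) ^ i / (1 + x) ^ (i + 1)) has_real_derivative
      (- 1) ^ (i + 1) * real (i + 1) / (1 + x) ^ (i + 2)) (at x)"
    proof -
      have P: "((\<lambda>x. (1 + x) ^ (i + 1)) has_real_derivative real (i + 1) * (1 + x) ^ i) (at x)"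
        by (rule DERIV_cong[OF DERIV_power[where D = 1]]) (auto intro!: derivative_eq_intros)
      have "1 + x \<noteq> 0" using x by simp
      thus ?thesis
        by (intro DERIV_cong[OF DERIV_divide[OF DERIV_const P]]) (auto simp: divide_simps)
    qed
    have d2: "((\<lambda>x. 1 / (1 - x) ^ (i + 1)) has_real_derivative
      real (i + 1) / (1 - x) ^ (i + 2)) (at x)"
    proof -
      have P: "((\<lambda>x. (1 - x) ^ (i + 1)) has_real_derivative - (real (i + 1) * (1 - x) ^ i)) (at x)"
        by (rule DERIV_cong[OF DERIV_power[where D = "- 1"]]) (auto intro!: derivative_eq_intros)
      have "1 - x \<noteq> 0" using x by simp
      thus ?thesis
        by (intro DERIV_cong[OF DERIV_divide[OF DERIV_const P]]) (auto simp: divide_simps)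
    qed
    have "((\<lambda>x. \<beta> * (\<Prod>i<i + 2. real (p - i)) * x ^ (p - (i + 2))
     - fact i * ((- 1) ^ i / (1 + x) ^ (i + 1) + 1 / (1 - x) ^ (i + 1)) / 2)
      has_real_derivative (\<beta> * (\<Prod>i<i + 2. real (p - i)) * (real (p - (i + 2)) * x ^ (p - (i + 2) - 1)) -
        fact i * ((- 1) ^ (i + 1) * real (i + 1) / (1 + x) ^ (i + 2) + real (i + 1) / (1 - x) ^ (i + 2)) / 2)) (at x)"
    proof -
      have "((\<lambda>x. C * x ^ n) has_real_derivative C * (real n * x ^ (n - 1))) (at x)" for C n
        by (auto intro!: derivative_eq_intros)
      from DERIV_diff[OF this DERIV_cdivide[OF DERIV_cmult[OF DERIV_add[OF d1 d2], of "fact i"], of 2]]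
      show ?thesis .
    qed
    also have "\<beta> * (\<Prod>i<i + 2. real (p - i)) * (real (p - (i + 2)) * x ^ (p - (i + 2) - 1)) -
        fact i * ((- 1) ^ (i + 1) * real (i + 1) / (1 + x) ^ (i + 2) + real (i + 1) / (1 - x) ^ (i + 2)) / 2
      = H_diff \<beta> h p (Suc j) x"
    proof -
      have G: "g * (s * r / X + r / Y) / 2 = (r * g) * (s / X + 1 / Y) / 2" for g s r X Y :: real
        by (simp only: distrib_left times_divide_eq_right mult_1_right) (simp only: mult_ac)
      have fs: "(fact (Suc i) :: real) = real (i + 1) * fact i" by simp
      have F: "fact i * ((- 1) ^ (i + 1) * real (i + 1) / X + real (i + 1) / Y) / 2
        = fact (Suc i) * ((- 1) ^ Suc i / X + 1 / Y) / 2" for X Y :: real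
        unfolding fs unfolding Suc_eq_plus1 by (rule G)
      have P: "(\<Prod>k<Suc i + 2. real (p - k)) = (\<Prod>k<i + 2. real (p - k)) * real (p - (i + 2))"
        by simp
      have e: "p - (i + 2) - 1 = p - (Suc i + 2)" "i + 2 = Suc i + 1" by simp_all
      show ?thesis unfolding 3 H_diff.simps P F e(1) by (simp only: mult.assoc) (simp only: e(2))
    qed
    finally show ?thesis unfolding 3 H_diff_eta(3) .
  qed
qed

text \<open>\<open>deriv\<close> looks at a whole neighbourhood, so the induction has to carry the
  identity for all points of the open interval.\<close>

lemma H_fun_deriv_funpow:
  assumes "- 1 < x" "x < 1"
  shows "(deriv ^^ j) (H_fun \<beta> h p) x = H_diff \<beta> h p j x"
  using assms
proof (induction j arbitrary: x)
  case (Suc j)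
  have ev: "\<forall>\<^sub>F y in nhds x. (deriv ^^ j) (H_fun \<beta> h p) y = H_diff \<beta> h p j y"
    using eventually_nhds_in_open[of "{-1<..<1}" x] Suc by (auto elim!: eventually_mono)
  have "(deriv ^^ Suc j) (H_fun \<beta> h p) x = deriv ((deriv ^^ j) (H_fun \<beta> h p)) x" by simp
  also have "\<dots> = deriv (H_diff \<beta> h p j) x" using ev by (rule deriv_cong_ev) simp
  also have "\<dots> = H_diff \<beta> h p (Suc j) x" using H_diff_deriv[OF Suc.prems] by (rule DERIV_imp_deriv)
  finally show ?case .
qed simp

lemma H_Taylor:
  assumes m: "- 1 < m" "m < 1" and n: "n > 0"
  shows "\<exists>\<delta>>0. \<exists>L\<ge>0. \<forall>u. \<bar>u\<bar> \<le> \<delta> \<longrightarrow>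
     \<bar>H_fun \<beta> h p (m + u) - (\<Sum>j<n. H_diff \<beta> h p j m / fact j * u ^ j)\<bar> \<le> L * \<bar>u\<bar> ^ n"
proof -
  \<comment> \<open>Half the distance to the endpoints: the derivatives blow up at -1 and 1 but are
    bounded on this compact interval.\<close>
  define \<delta> where "\<delta> = (1 - \<bar>m\<bar>) / 2"
  have \<delta>: "\<delta> > 0" "\<bar>m\<bar> + \<delta> < 1" using m by (auto simp: \<delta>_def field_simps)
  have "continuous_on {m - \<delta>..m + \<delta>} (H_diff \<beta> h p n)"
    using \<delta> by (intro continuous_at_imp_continuous_on ballI DERIV_isCont[OF H_diff_deriv]) auto
  hence "compact (H_diff \<beta> h p n ` {m - \<delta>..m + \<delta>})" by (intro compact_continuous_image) auto
  then obtain M where M: "\<And>x. x \<in> {m - \<delta>..m + \<delta>} \<Longrightarrow> \<bar>H_diff \<beta> h p n x\<bar> \<le> M"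
    using compact_imp_bounded[THEN bounded_iff[THEN iffD1]] by (metis image_eqI real_norm_def)
  have "M \<ge> 0" using M[of m] \<delta> by simp
  show ?thesis
  proof (rule exI[of _ \<delta>], rule conjI[OF \<delta>(1)], rule exI[of _ "M / fact n"], intro conjI allI impI)
    show "0 \<le> M / fact n" using \<open>M \<ge> 0\<close> by simp
    fix u :: real assume u: "\<bar>u\<bar> \<le> \<delta>"
    show "\<bar>H_fun \<beta> h p (m + u) - (\<Sum>j<n. H_diff \<beta> h p j m / fact j * u ^ j)\<bar> \<le> M / fact n * \<bar>u\<bar> ^ n"
    proof (cases "u = 0")
      case True
      have "(\<Sum>j<n. H_diff \<beta> h p j m / fact j * 0 ^ j) = H_fun \<beta> h p m"
        using n by (subst sum.remove[of _ 0]) (auto intro!: sum.neutral)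
      thus ?thesis using True n \<open>M \<ge> 0\<close> by simp
    next
      case False
      have "\<exists>t. (if m + u < m then m + u < t \<and> t < m else m < t \<and> t < m + u) \<and>
        H_fun \<beta> h p (m + u) = (\<Sum>j<n. (H_diff \<beta> h p j m / fact j) * (m + u - m) ^ j)
           + (H_diff \<beta> h p n t / fact n) * (m + u - m) ^ n"
        using \<delta> u False n
        by (intro Taylor[where a = "m - \<delta>" and b = "m + \<delta>"] allI impI H_diff_deriv) auto
      then obtain t where t0: "if m + u < m then m + u < t \<and> t < m else m < t \<and> t < m + u"
        "H_fun \<beta> h p (m + u) = (\<Sum>j<n. (H_diff \<beta> h p j m / fact j) * (m + u - m) ^ j)
           + (H_diff \<beta> h p n t / fact n) * (m + u - m) ^ n" by blast
      have t: "\<bar>t - m\<bar> \<le> \<bar>u\<bar>"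
        "H_fun \<beta> h p (m + u) = (\<Sum>j<n. (H_diff \<beta> h p j m / fact j) * u ^ j) + (H_diff \<beta> h p n t / fact n) * u ^ n"
        using t0 by (auto split: if_splits)
      have "\<bar>H_diff \<beta> h p n t\<bar> \<le> M" using t u by (intro M) auto
      hence "\<bar>H_diff \<beta> h p n t\<bar> / fact n * \<bar>u\<bar> ^ n \<le> M / fact n * \<bar>u\<bar> ^ n"
        by (intro mult_right_mono divide_right_mono) auto
      thus ?thesis using t(2) by (simp add: abs_mult power_abs)
    qed
  qed
qed

lemma leading_coeff_nonpos:
  fixes c L :: real
  assumes "\<delta> > 0" "\<And>u. 0 < u \<Longrightarrow> u \<le> \<delta> \<Longrightarrow> c * u ^ n \<le> L * u ^ (n + 1)"
  shows "c \<le> 0"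
proof (rule ccontr)
  assume "\<not> c \<le> 0"
  hence c: "c > 0" by simp
  define u where "u = min \<delta> (c / (2 * (\<bar>L\<bar> + 1)))"
  have u: "0 < u" "u \<le> \<delta>" "u \<le> c / (2 * (\<bar>L\<bar> + 1))" using assms c by (auto simp: u_def)
  have "c * u ^ n \<le> (L * u) * u ^ n" using assms(2)[OF u(1,2)] by (simp add: mult_ac)
  hence "c \<le> L * u" using u by simp
  also have "\<dots> \<le> (\<bar>L\<bar> + 1) * u" using u by (intro mult_right_mono) auto
  also have "\<dots> \<le> (\<bar>L\<bar> + 1) * (c / (2 * (\<bar>L\<bar> + 1)))" using u by (intro mult_left_mono) auto
  also have "\<dots> = c / 2" by (simp add: field_simps)
  finally show False using c by simp
qed

section \<open>Continuity up to the endpoints and the position of the maximizers\<close>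

lemma continuous_xlnx: "continuous_on {0..} (\<lambda>x::real. x * ln x)"
proof (rule continuous_on_eq_continuous_within[THEN iffD2], rule ballI)
  fix x :: real assume "x \<in> {0..}"
  show "continuous (at x within {0..}) (\<lambda>x. x * ln x)"
  proof (cases "x = 0")
    case True
    have "((\<lambda>x::real. x * ln x) \<longlongrightarrow> 0) (at_right 0)" by real_asymp
    thus ?thesis using True by (simp add: continuous_within at_within_Ici_at_right)
  next
    case False
    hence "isCont (\<lambda>x. x * ln x) x" by (auto intro!: continuous_intros)
    thus ?thesis by (rule continuous_at_imp_continuous_at_within)
  qed
qed

lemma continuous_H_fun: "continuous_on {-1..1} (H_fun \<beta> h p)"
proof -
  have 1: "continuous_on {-1..1} (\<lambda>x. (1 + x) * ln (1 + x :: real))"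
    by (rule continuous_on_compose2[OF continuous_xlnx]) (auto intro!: continuous_intros)
  have 2: "continuous_on {-1..1} (\<lambda>x. (1 - x) * ln (1 - x :: real))"
    by (rule continuous_on_compose2[OF continuous_xlnx]) (auto intro!: continuous_intros)
  show ?thesis unfolding H_fun_def[abs_def] I_fun_def
    by (intro continuous_intros 1 2) auto
qed

context
  fixes p :: nat and \<beta> h :: real
  assumes p: "p \<ge> 3" and \<beta>: "\<beta> > 0" and h: "h > 0"
begin

abbreviation (input) "H \<equiv> H_fun \<beta> h p"
abbreviation (input) "HD \<equiv> H_diff \<beta> h p"

text \<open>The entropy has infinite slope at 1. Moving inwards by \<open>e\<close> loses at most
  \<open>e * (\<beta> * p + h)\<close> by Bernoulli's inequality, while the entropy gains at least
  \<open>- e * ln e / 2\<close>; \<open>e\<close> is chosen so that this exceeds the loss by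
  \<open>e / 2\<close>.\<close>

lemma H_one_not_max: "\<exists>x. -1 < x \<and> x < 1 \<and> H 1 < H x"
proof -
  define e where "e = exp (- 2 * (\<beta> * real p + h) - 1)"
  have "\<beta> * real p \<ge> 0" using \<beta> by simp
  hence e: "e > 0" "e < 1" using h by (auto simp: e_def)
  have "1 - real p * e \<le> (1 - e) ^ p"
    using Bernoulli_inequality[of "- e" p] e by simp
  hence "\<beta> * (1 - real p * e) \<le> \<beta> * (1 - e) ^ p" using \<beta> by (intro mult_left_mono) auto
  moreover have "(2 - e) * ln (2 - e) \<le> 2 * ln 2"
    using e by (intro mult_mono) auto
  moreover have "e * (- ln e) = e * (2 * (\<beta> * real p + h) + 1)" by (simp add: e_def)
  hence "e * ln e = - (2 * (\<beta> * real p * e + h * e) + e)" by (simp add: algebra_simps)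
  moreover have "H 1 = \<beta> + h - ln 2"
    "H (1 - e) = \<beta> * (1 - e) ^ p + h - h * e - ((2 - e) * ln (2 - e) + e * ln e) / 2"
    "\<beta> * (1 - real p * e) = \<beta> - \<beta> * real p * e"
    by (simp_all add: H_fun_def I_fun_def algebra_simps)
  moreover define P Y Z where "P = \<beta> * (1 - e) ^ p" and "Y = (2 - e) * ln (2 - e)" and "Z = e * ln e"
  ultimately have "H 1 < H (1 - e)" using e unfolding P_def[symmetric] Y_def[symmetric] Z_def[symmetric]
    by (simp only:) (simp add: field_simps)
  thus ?thesis using e by (intro exI[of _ "1 - e"]) auto
qed

text \<open>The entropy is even and the power term does not decrease under reflection, whatever the
  parity of \<open>p\<close>; the positive field \<open>h\<close> makes the inequality
  strict.\<close>

lemma H_minus_le: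
  assumes "x < 0"
  shows "H x < H (- x)"
proof -
  have "x ^ p \<le> (- x) ^ p" using assms power_mono_even[of p]
    by (metis abs_ge_self abs_of_neg power_abs)
  hence "\<beta> * x ^ p \<le> \<beta> * (- x) ^ p" using \<beta> by (intro mult_left_mono) auto
  moreover have "h * x < h * (- x)" using assms h by (intro mult_strict_left_mono) auto
  ultimately show ?thesis by (simp add: H_fun_def I_fun_minus)
qed

context
  fixes m :: real
  assumes gm: "is_global_max \<beta> h p m"
begin

lemma H_le_max: "y \<in> {-1..1} \<Longrightarrow> H y \<le> H m" and max_in_closed: "m \<in> {-1..1}"
  using gm by (auto simp: is_global_max_def)

lemma max_lt_1: "m < 1"
  using H_one_not_max max_in_closed H_le_max by (force simp: less_le)

lemma max_nonneg: "m \<ge> 0"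
  using H_minus_le[of m] H_le_max[of "- m"] max_in_closed by force

lemma first_derivative_at_max: "HD (Suc 0) m = 0"
proof -
  have "(H has_real_derivative HD (Suc 0) m) (at m)"
  proof -
    show ?thesis using H_diff_eta(1)[of \<beta> h p] H_diff_deriv[of m \<beta> h p 0] max_lt_1 max_nonneg by simp
  qed
  moreover have "0 < 1 - m" using max_lt_1 by simp
  moreover have "\<forall>y. \<bar>m - y\<bar> < 1 - m \<longrightarrow> H y \<le> H m"
    using max_nonneg max_lt_1 by (auto intro!: H_le_max)
  ultimately show ?thesis by (rule DERIV_local_max)
qed

lemma max_pos: "m > 0"
proof (rule ccontr)
  assume "\<not> m > 0"
  hence "m = 0" using max_nonneg by simp
  hence "HD (Suc 0) m = h" using p by simp
  thus False using first_derivative_at_max h by simp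
qed

lemma max_in_open: "- 1 < m" "m < 1" using max_lt_1 max_nonneg by auto

lemma H_max_expansion:
  assumes n: "n > 0" "\<And>j. 0 < j \<Longrightarrow> j < n \<Longrightarrow> HD j m = 0"
  shows "\<exists>\<delta>>0. \<exists>L\<ge>0. \<forall>u. \<bar>u\<bar> \<le> \<delta> \<longrightarrow> \<bar>H (m + u) - H m - HD n m / fact n * u ^ n\<bar> \<le> L * \<bar>u\<bar> ^ (n + 1)"
proof -
  have "(\<Sum>j<n + 1. HD j m / fact j * u ^ j) = H m + HD n m / fact n * u ^ n" for u
  proof -
    have "(\<Sum>j<n. HD j m / fact j * u ^ j) = H m"
      using n by (subst sum.remove[of _ 0]) (auto intro!: sum.neutral)
    thus ?thesis by simp
  qed
  thus ?thesis using H_Taylor[OF max_in_open, of "n + 1" \<beta> h p] by (simp add: algebra_simps)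
qed

text \<open>Near \<open>m\<close> the leading term dominates the remainder, and it may not be
  positive at a maximum. For odd order, testing on both sides of \<open>m\<close> gives both
  signs.\<close>

lemma leading_derivative_nonpos:
  assumes n: "n > 0" "\<And>j. 0 < j \<Longrightarrow> j < n \<Longrightarrow> HD j m = 0"
  shows "HD n m \<le> 0" "odd n \<Longrightarrow> HD n m = 0"
proof -
  obtain \<delta>0 L where L: "\<delta>0 > 0" "\<And>u. \<bar>u\<bar> \<le> \<delta>0 \<Longrightarrow> \<bar>H (m + u) - H m - HD n m / fact n * u ^ n\<bar> \<le> L * \<bar>u\<bar> ^ (n + 1)"
    using H_max_expansion[of n] n by blast
  define \<delta> where "\<delta> = min \<delta>0 (min (1 - m) (1 + m))"
  have \<delta>: "\<delta> > 0" using L max_in_open by (simp add: \<delta>_def)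
  have b: "HD n m / fact n * u ^ n \<le> L * \<bar>u\<bar> ^ (n + 1)" if "\<bar>u\<bar> \<le> \<delta>" for u
  proof -
    have "H (m + u) \<le> H m" using that by (intro H_le_max) (auto simp: \<delta>_def)
    thus ?thesis using L(2)[of u] that by (simp add: \<delta>_def abs_le_iff)
  qed
  have "HD n m / fact n \<le> 0"
  proof (rule leading_coeff_nonpos[OF \<delta>])
    fix u assume "0 < u" "u \<le> \<delta>"
    thus "HD n m / fact n * u ^ n \<le> L * u ^ (n + 1)" using b[of u] by simp
  qed
  from mult_nonpos_nonneg[OF this, of "fact n"] show *: "HD n m \<le> 0" by simp
  assume "odd n"
  have "- (HD n m / fact n) \<le> 0"
  proof (rule leading_coeff_nonpos[OF \<delta>])
    fix u assume "0 < u" "u \<le> \<delta>"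
    thus "- (HD n m / fact n) * u ^ n \<le> L * u ^ (n + 1)" using b[of "- u"] \<open>odd n\<close> by simp
  qed
  from mult_nonpos_nonneg[OF this, of "fact n"] show "HD n m = 0" using * by simp
qed

lemma second_derivative_nonpos: "HD 2 m \<le> 0"
  using leading_derivative_nonpos(1)[of 2] first_derivative_at_max by (auto simp: less_2_cases_iff)

lemma third_derivative_zero: "HD 2 m = 0 \<Longrightarrow> HD 3 m = 0"
  using leading_derivative_nonpos(2)[of 3] first_derivative_at_max
  by (metis One_nat_def Suc_1 less_Suc_eq not_less_zero numeral_3_eq_3 odd_numeral zero_less_numeral)

lemma second_derivative_eq: "HD 2 x = \<beta> * p * (p - 1) * x ^ (p - 2) - 1 / (1 - x\<^sup>2)" if "- 1 < x" "x < 1"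
proof -
  have "1 + x \<noteq> 0" "1 - x \<noteq> 0" using that by auto
  moreover have "1 - x\<^sup>2 = (1 + x) * (1 - x)" by (simp add: power2_eq_square algebra_simps)
  ultimately have "(1 / (1 + x) + 1 / (1 - x)) / 2 = 1 / (1 - x\<^sup>2)"
    by (simp add: divide_simps)
  moreover have "HD 2 x = \<beta> * p * (p - 1) * x ^ (p - 2) - (1 / (1 + x) + 1 / (1 - x)) / 2"
    using p by (simp add: numeral_2_eq_2 lessThan_Suc of_nat_diff)
  ultimately show ?thesis by (simp only:)
qed

text \<open>\<open>(1 - x\<^sup>2) * H'' x + 1\<close> is a multiple of \<open>x ^ (p - 2) * (1 - x\<^sup>2)\<close>, which is maximal exactly where
  \<open>p * x\<^sup>2 = p - 2\<close>; at a special point this maximum equals 1.\<close>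
lemma degenerate_max:
  assumes "HD 2 m = 0"
  shows "p * m\<^sup>2 = real p - 2"
    and "HD 4 m < 0"
    and "\<And>x. 0 < x \<Longrightarrow> x < 1 \<Longrightarrow> x \<noteq> m \<Longrightarrow> HD 2 x < 0"
proof -
  define q where "q = 1 - m\<^sup>2"
  have q: "q > 0" using max_in_open by (simp add: q_def abs_square_less_1 abs_less_iff)
  define c where "c = \<beta> * p * (p - 1)"
  have c: "c > 0" using \<beta> p by (simp add: c_def)
  have pm: "1 + m \<noteq> 0" "1 - m \<noteq> 0" "q = (1 + m) * (1 - m)"
    using max_in_open by (auto simp: q_def power2_eq_square algebra_simps)
  have e2: "c * m ^ (p - 2) = 1 / q" using assms second_derivative_eq[OF max_in_open] by (simp add: c_def q_def)
  have e2': "c * m ^ (p - 2) * q = 1" using e2 q by simp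
  have p3: "m ^ (p - 2) = m * m ^ (p - 3)"
    using p by (metis Suc_diff_Suc Suc_le_lessD numeral_2_eq_2 numeral_3_eq_3 power_Suc)
  have "HD 3 m = 0" using assms by (rule third_derivative_zero)
  moreover have "HD 3 m = c * (real p - 2) * m ^ (p - 3) - 2 * m / q\<^sup>2"
  proof -
    have "(- 1 / (1 + m) ^ 2 + 1 / (1 - m) ^ 2) / 2 = 2 * m / q\<^sup>2"
      unfolding pm(3) using pm(1,2) by (simp add: divide_simps) (simp add: power2_eq_square algebra_simps)
    thus ?thesis using p by (simp add: numeral_3_eq_3 numeral_2_eq_2 lessThan_Suc of_nat_diff c_def)
  qed
  ultimately have "c * (real p - 2) * m ^ (p - 3) = 2 * m / q\<^sup>2" by simp
  \<comment> \<open>Multiplication by \<open>m\<close> restores the power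
    \<open>m ^ (p - 2)\<close>, whose value is known from the vanishing second derivative. An
    equation in \<open>p\<close> and \<open>m\<^sup>2\<close> alone remains.\<close>
  hence "m * (c * (real p - 2) * m ^ (p - 3)) = m * (2 * m / q\<^sup>2)" by (simp only:)
  hence "c * m ^ (p - 2) * (real p - 2) = 2 * m\<^sup>2 / q\<^sup>2"
    unfolding p3 by (simp add: power2_eq_square mult_ac)
  hence "(real p - 2) / q = 2 * m\<^sup>2 / q\<^sup>2" unfolding e2 by simp
  hence "(real p - 2) / q * q\<^sup>2 = 2 * m\<^sup>2 / q\<^sup>2 * q\<^sup>2" by (simp only:)
  hence "(real p - 2) * q = 2 * m\<^sup>2" using q by (simp add: power2_eq_square)
  thus pm2: "p * m\<^sup>2 = real p - 2" by (simp add: q_def algebra_simps)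
  have m2: "m\<^sup>2 = (real p - 2) / p" and q2: "q = 2 / p" using pm2 p by (auto simp: q_def field_simps)
  show "HD 4 m < 0"
  proof -
    have "(1 / (1 + m) ^ 3 + 1 / (1 - m) ^ 3) = (2 + 6 * m\<^sup>2) / q ^ 3"
      unfolding pm(3) using pm(1,2) by (simp add: divide_simps) (simp add: power2_eq_square power3_eq_cube algebra_simps)
    hence "HD 4 m = c * (real p - 2) * (real p - 3) * m ^ (p - 4) - (2 + 6 * m\<^sup>2) / q ^ 3"
      using p by (simp add: numeral_eq_Suc lessThan_Suc of_nat_diff c_def; use q in \<open>simp add: divide_simps\<close>)
    hence A: "HD 4 m * m\<^sup>2 = c * (real p - 2) * ((real p - 3) * m ^ (p - 4) * m\<^sup>2) - (2 + 6 * m\<^sup>2) * m\<^sup>2 / q ^ 3"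
      by (simp only: left_diff_distrib mult.assoc times_divide_eq_left)
    \<comment> \<open>For \<open>p = 3\<close> the truncated exponent \<open>p - 4\<close> breaks
      the law of powers, but there the factor \<open>p - 3\<close> is 0.\<close>
    have B: "(real p - 3) * m ^ (p - 4) * m\<^sup>2 = (real p - 3) * m ^ (p - 2)"
    proof (cases "p = 3")
      case False
      hence "p - 2 = p - 4 + 2" using p by simp
      thus ?thesis by (simp only: power_add mult.assoc)
    qed simp
    have "HD 4 m * m\<^sup>2 = (real p - 2) * (real p - 3) * (c * m ^ (p - 2)) - (2 + 6 * m\<^sup>2) * m\<^sup>2 / q ^ 3"
      unfolding A B by (simp only: mult_ac)
    also have "\<dots> = - ((real p - 2) * (real p)\<^sup>2) / 2"
      unfolding e2 m2 q2 using p by (simp add: field_simps power2_eq_square power3_eq_cube)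
    also have "\<dots> < 0" using p by simp
    finally show ?thesis using max_pos by (simp add: mult_less_0_iff)
  qed
  fix x :: real assume x: "0 < x" "x < 1" "x \<noteq> m"
  define y where "y = x\<^sup>2 / m\<^sup>2"
  have xs: "x\<^sup>2 < 1" using x by (simp add: abs_square_less_1)
  have y: "y > 0" "y \<noteq> 1" using x max_pos by (auto simp: y_def power2_eq_iff)
  have mp: "m\<^sup>2 > 0" using max_pos by simp
  \<comment> \<open>A weighted arithmetic-geometric mean inequality, strict because
    \<open>y \<noteq> 1\<close>. With weights \<open>(p - 2) / 2\<close> and 1 the linear bounds
    cancel, by the values of \<open>m\<^sup>2\<close> and \<open>q\<close>.\<close>
  have "ln y < y - 1" using ln_add_one_self_le_self[of "y - 1"] y ln_eq_minus_one[of y] ln_le_minus_one[of y]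
    by fastforce
  moreover have "ln ((1 - x\<^sup>2) / q) \<le> (1 - x\<^sup>2) / q - 1"
    using xs q by (intro ln_le_minus_one) auto
  ultimately have "(real p - 2) / 2 * ln y + ln ((1 - x\<^sup>2) / q) < (real p - 2) / 2 * (y - 1) + ((1 - x\<^sup>2) / q - 1)"
    using p by (intro add_less_le_mono mult_strict_left_mono) auto
  also have "\<dots> = 0"
  proof -
    have "y = x\<^sup>2 * p / (real p - 2)" by (simp add: y_def m2)
    thus ?thesis unfolding q2 using p by (simp add: field_simps)
  qed
  finally have "(real p - 2) / 2 * ln y + ln ((1 - x\<^sup>2) / q) < 0" .
  moreover have "ln y = 2 * (ln x - ln m)" using x max_pos by (simp add: y_def ln_div ln_realpow)
  hence "(real p - 2) / 2 * ln y = (real p - 2) * ln x - (real p - 2) * ln m" by (simp add: right_diff_distrib)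
  moreover have "ln ((1 - x\<^sup>2) / q) = ln (1 - x\<^sup>2) - ln q" using xs q by (simp add: ln_div)
  ultimately have "(real p - 2) * ln x + ln (1 - x\<^sup>2) < (real p - 2) * ln m + ln q"
    by linarith
  hence "ln (x ^ (p - 2) * (1 - x\<^sup>2)) < ln (m ^ (p - 2) * q)"
    using x xs q max_pos p by (simp add: ln_mult ln_realpow of_nat_diff)
  hence "x ^ (p - 2) * (1 - x\<^sup>2) < m ^ (p - 2) * q"
    using x xs q max_pos by (subst (asm) ln_less_cancel_iff) auto
  hence "c * (x ^ (p - 2) * (1 - x\<^sup>2)) < c * (m ^ (p - 2) * q)" using c by (intro mult_strict_left_mono)
  also have "\<dots> = 1" using e2' by simp
  finally have "c * x ^ (p - 2) < 1 / (1 - x\<^sup>2)" using xs by (simp add: field_simps)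
  thus "HD 2 x < 0" using second_derivative_eq[of x] x by (simp add: c_def)
qed

text \<open>Close to \<open>m\<close> half of the leading term survives the remainder. On the rest
  of the closure of \<open>A\<close> compactness gives a gap, since a point attaining the maximum
  there would be a second maximizer in the closure.\<close>

lemma global_bound_at_max:
  assumes d: "d > 0" and a: "a > 0"
    and loc: "\<exists>\<delta>>0. \<exists>L. \<forall>u. \<bar>u\<bar> \<le> \<delta> \<longrightarrow> \<bar>H (m + u) - H m + a * u ^ d\<bar> \<le> L * \<bar>u\<bar> ^ (d + 1)"
    and "even d"
    and uniq: "\<And>m'. is_global_max \<beta> h p m' \<Longrightarrow> m' \<in> closure A \<Longrightarrow> m' = m"
  shows "\<exists>b>0. \<forall>s\<in>A \<inter> {-1..1}. H s \<le> H m - b * \<bar>s - m\<bar> ^ d"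
proof -
  obtain \<delta>0 L0 where L0: "\<delta>0 > 0" "\<And>u. \<bar>u\<bar> \<le> \<delta>0 \<Longrightarrow> \<bar>H (m + u) - H m + a * u ^ d\<bar> \<le> L0 * \<bar>u\<bar> ^ (d + 1)"
    using loc by blast
  define L where "L = \<bar>L0\<bar> + 1"
  define \<delta> where "\<delta> = min \<delta>0 (a / (2 * L))"
  have L: "L > 0" by (simp add: L_def)
  have \<delta>: "\<delta> > 0" "\<delta> \<le> \<delta>0" using L0 a L by (auto simp: \<delta>_def)
  have "\<delta> \<le> a / (2 * L)" by (simp add: \<delta>_def)
  hence L\<delta>: "L * \<delta> \<le> a / 2" using L by (simp add: field_simps)
  have near: "H s \<le> H m - a / 2 * \<bar>s - m\<bar> ^ d" if "\<bar>s - m\<bar> \<le> \<delta>" for s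
  proof -
    define u where "u = s - m"
    have "\<bar>H s - H m + a * \<bar>u\<bar> ^ d\<bar> \<le> L0 * \<bar>u\<bar> ^ (d + 1)"
      using L0(2)[of u] that \<delta> \<open>even d\<close> by (simp add: u_def power_even_abs)
    also have "\<dots> \<le> L * \<bar>u\<bar> ^ (d + 1)" by (intro mult_right_mono) (auto simp: L_def)
    also have "\<dots> = (L * \<bar>u\<bar>) * \<bar>u\<bar> ^ d" by simp
    also have "\<dots> \<le> (L * \<delta>) * \<bar>u\<bar> ^ d" using that by (intro mult_right_mono mult_left_mono) (auto simp: u_def L_def)
    also have "\<dots> \<le> (a / 2) * \<bar>u\<bar> ^ d" using L\<delta> by (intro mult_right_mono) auto
    finally have "H s - H m + a * \<bar>u\<bar> ^ d \<le> (a / 2) * \<bar>u\<bar> ^ d" by (rule abs_le_D1)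
    thus ?thesis unfolding u_def by (simp add: field_simps)
  qed
  define C where "C = (closure A \<inter> {-1..1}) - ball m \<delta>"
  have C: "compact C" unfolding C_def by (intro compact_diff closed_Int_compact) auto
  have "\<exists>\<eta>>0. \<forall>s\<in>C. H s \<le> H m - \<eta>"
  proof (cases "C = {}")
    case False
    obtain s0 where s0: "s0 \<in> C" "\<And>s. s \<in> C \<Longrightarrow> H s \<le> H s0"
      using continuous_attains_sup[OF C False] continuous_on_subset[OF continuous_H_fun]
      by (metis (no_types, lifting) C_def Diff_subset Int_lower2 subset_trans)
    have "H s0 < H m"
    proof (rule ccontr)
      assume "\<not> H s0 < H m"
      hence "is_global_max \<beta> h p s0" using s0(1) H_le_max unfolding is_global_max_def C_def by fastforce
      hence "s0 = m" using uniq s0(1) by (auto simp: C_def)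
      thus False using s0(1) \<delta> by (simp add: C_def)
    qed
    thus ?thesis using s0 by (intro exI[of _ "H m - H s0"]) auto
  qed (auto intro!: exI[of _ 1])
  then obtain \<eta> where \<eta>: "\<eta> > 0" "\<And>s. s \<in> C \<Longrightarrow> H s \<le> H m - \<eta>" by blast
  \<comment> \<open>Two points of [-1, 1] are at most 2 apart, so a gap \<eta> is worth \<eta> /
    \<open>2 ^ d\<close> times the distance power.\<close>
  define b where "b = min (a / 2) (\<eta> / 2 ^ d)"
  show ?thesis
  proof (intro exI[of _ b] conjI ballI)
    show "b > 0" using a \<eta> by (simp add: b_def)
    fix s assume s: "s \<in> A \<inter> {-1..1}"
    show "H s \<le> H m - b * \<bar>s - m\<bar> ^ d"
    proof (cases "\<bar>s - m\<bar> \<le> \<delta>")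
      case True
      have "b \<le> a / 2" unfolding b_def by (rule min.cobounded1)
      hence "b * \<bar>s - m\<bar> ^ d \<le> a / 2 * \<bar>s - m\<bar> ^ d" by (intro mult_right_mono) auto
      thus ?thesis using near[OF True] by linarith
    next
      case False
      hence "s \<in> C" using s closure_subset by (auto simp: C_def dist_real_def abs_minus_commute)
      have "\<bar>s - m\<bar> ^ d \<le> 2 ^ d" using s max_in_open by (intro power_mono) auto
      hence "b * \<bar>s - m\<bar> ^ d \<le> \<eta> / 2 ^ d * 2 ^ d" using \<eta> by (intro mult_mono) (auto simp: b_def)
      thus ?thesis using \<eta>(2)[OF \<open>s \<in> C\<close>] by simp
    qed
  qed
qed

end

text \<open>\<open>H'\<close> vanishes at both maximizers, so \<open>H''\<close> vanishes strictly
  between them. If it also vanished at \<open>m\<close>, it would be negative everywhere else on (0,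
  1).\<close>

lemma critical_nondegenerate:
  assumes "is_global_max \<beta> h p m" "is_global_max \<beta> h p m'" "m \<noteq> m'"
  shows "HD 2 m < 0"
proof (rule ccontr)
  assume "\<not> HD 2 m < 0"
  hence 0: "HD 2 m = 0" using second_derivative_nonpos[OF assms(1)] by simp
  have r: "0 < m" "m < 1" "0 < m'" "m' < 1"
    using max_pos max_lt_1 assms by auto
  have d: "(HD (Suc 0) has_real_derivative HD 2 x) (at x)" if "0 < x" "x < 1" for x
    using H_diff_deriv[of x \<beta> h p 1] that by (simp add: numeral_2_eq_2)
  have "\<exists>z. min m m' < z \<and> z < max m m' \<and> HD (Suc 0) (max m m') - HD (Suc 0) (min m m') = (max m m' - min m m') * HD 2 z"
    using r assms(3) by (intro MVT2 d) auto
  moreover have "HD (Suc 0) (max m m') = 0" "HD (Suc 0) (min m m') = 0"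
    using first_derivative_at_max[OF assms(1)] first_derivative_at_max[OF assms(2)] by (cases "m \<le> m'"; simp only: max_def min_def if_True if_False)+
  ultimately obtain z where z: "min m m' < z" "z < max m m'" "(max m m' - min m m') * HD 2 z = 0"
    by (metis diff_self)
  hence "HD 2 z = 0" by simp
  moreover have "HD 2 z < 0" using degenerate_max(3)[OF assms(1) 0, of z] r z by (auto simp: min_def max_def split: if_splits)
  ultimately show False by simp
qed

end

section \<open>Limit distributions\<close>

text \<open>Symmetry gives the value 1/2 at 0, by which \<open>Q x / (2 * Q 0)\<close> becomes one
  minus the distribution function.\<close>

locale even_density =
  fixes g :: "real \<Rightarrow> real"
  assumes cont: "continuous_on UNIV g"
    and has_total: "has_bochner_integral lborel g 1"
    and even: "\<And>x. g (- x) = g x"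
begin

definition cdf :: "real \<Rightarrow> real" where "cdf x = (LBINT t:{..x}. g t)"

lemma integrable: "integrable lborel g"
  using has_total by (rule integrable.intros)

lemma total: "(\<integral>x. g x \<partial>lborel) = 1"
  using has_total by (rule has_bochner_integral_integral_eq)

lemma set_int: "A \<in> sets lborel \<Longrightarrow> set_integrable lborel A g"
  unfolding set_integrable_def using integrable by (intro integrable_mult_indicator) auto

lemma cdf_deriv: "(cdf has_real_derivative g x) (at x)"
proof -
  \<comment> \<open>A base point to the left puts \<open>x\<close> in the interior of
    \<open>{c..x + 1}\<close>, so the one-interval derivative is the full one.\<close>
  define c where "c = x - 1"
  have ad: "cdf u = cdf c + (LBINT y=c..u. g y)" if "u \<in> {c..x + 1}" for u
  proof -
    have "{..u} = {..c} \<union> {c<..u}" using that by auto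
    moreover have "(LBINT t:{..c} \<union> {c<..u}. g t) = (LBINT t:{..c}. g t) + (LBINT t:{c<..u}. g t)"
      by (intro set_integral_Un set_int) auto
    moreover have "(LBINT y=c..u. g y) = (LBINT t:{c<..u}. g t)" using that by (intro interval_integral_Ioc) auto
    ultimately show ?thesis by (simp add: cdf_def)
  qed
  have "((\<lambda>u. LBINT y=c..u. g y) has_vector_derivative g x) (at x within {c..x + 1})"
    by (rule interval_integral_FTC2) (auto simp: c_def intro: continuous_on_subset[OF cont])
  hence "((\<lambda>u. LBINT y=c..u. g y) has_real_derivative g x) (at x within {c..x + 1})"
    by (simp add: has_real_derivative_iff_has_vector_derivative)
  hence "((\<lambda>u. cdf c + (LBINT y=c..u. g y)) has_real_derivative g x) (at x within {c..x + 1})"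
    by (auto intro!: derivative_eq_intros)
  hence "(cdf has_real_derivative g x) (at x within {c..x + 1})"
    by (rule has_field_derivative_transform_within[OF _ zero_less_one]) (auto simp: ad[unfolded c_def, symmetric] c_def)
  moreover have "at x within {c..x + 1} = at x" by (rule at_within_interior) (simp add: c_def)
  ultimately show ?thesis by (simp only:)
qed

lemma cdf_lim: "(cdf \<longlongrightarrow> 1) at_top"
  using tendsto_integral_at_top[OF _ integrable] unfolding cdf_def set_lebesgue_integral_def total by simp

lemma cdf_0: "cdf 0 = 1 / 2"
proof -
  have "(LBINT t:{..0}. g t) = (LBINT t:{x. - x \<in> {..0}}. g (- t))" by (rule set_integral_reflect)
  also have "{x. - x \<in> {..0::real}} = {0..}" by auto
  also have "(LBINT t:{0..}. g (- t)) = (LBINT t:{0..}. g t)" by (simp add: even)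
  also have "\<dots> = (LBINT t:{0<..}. g t)"
    by (rule set_integral_discrete_difference[where X = "{0}"]) auto
  finally have 1: "cdf 0 = (LBINT t:{0<..}. g t)" by (simp add: cdf_def)
  have "(LBINT t:{..0} \<union> {0<..}. g t) = (LBINT t:{..0}. g t) + (LBINT t:{0<..}. g t)"
    by (intro set_integral_Un set_int) auto
  moreover have "{..0} \<union> {0<..} = (UNIV :: real set)" by auto
  ultimately have "1 = cdf 0 + (LBINT t:{0<..}. g t)"
    using total by (simp add: cdf_def set_lebesgue_integral_def)
  thus ?thesis using 1 by simp
qed

text \<open>\<open>s\<close> is the standard deviation in the Gaussian case and 1 in the quartic
  case; \<open>C\<close> undoes the normalization of the density.\<close>

lemma tail_function_scaled_cdf:
  assumes "a > 0" "d \<ge> 2" "s > 0" and eq: "\<And>y. C * g (y / s) / s = exp (- a * y ^ d)"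
  shows "tail_function a d (\<lambda>y. C * (1 - cdf (y / s)))"
proof
  fix y
  have "((\<lambda>y. cdf (y / s)) has_real_derivative g (y / s) * (1 / s)) (at y)"
    by (rule DERIV_chain2[OF cdf_deriv]) (use \<open>s > 0\<close> in \<open>auto intro!: derivative_eq_intros\<close>)
  hence "((\<lambda>y. C * (1 - cdf (y / s))) has_real_derivative C * (0 - g (y / s) * (1 / s))) (at y)"
    by (intro DERIV_cmult DERIV_diff DERIV_const)
  also have "C * (0 - g (y / s) * (1 / s)) = - exp (- a * y ^ d)" using eq[of y] by simp
  finally show "((\<lambda>y. C * (1 - cdf (y / s))) has_real_derivative - exp (- a * y ^ d)) (at y)" .
next
  have "filterlim (\<lambda>y. y / s) at_top at_top" using \<open>s > 0\<close> by real_asymp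
  hence "((\<lambda>y. cdf (y / s)) \<longlongrightarrow> 1) at_top" by (rule filterlim_compose[OF cdf_lim])
  hence "((\<lambda>y. C * (1 - cdf (y / s))) \<longlongrightarrow> C * (1 - 1)) at_top" by (intro tendsto_intros)
  thus "((\<lambda>y. C * (1 - cdf (y / s))) \<longlongrightarrow> 0) at_top" by simp
qed fact+

end

lemma even_density_std_normal: "even_density std_normal_density"
proof
  show "continuous_on UNIV std_normal_density"
    unfolding std_normal_density_def[abs_def] by (intro continuous_intros) auto
  show "has_bochner_integral lborel std_normal_density 1"
    by (simp add: has_bochner_integral_iff)
qed (simp add: std_normal_density_def)

lemma has_integral_half_line_iff:
  fixes f :: "real \<Rightarrow> real"
  shows "(f has_integral y) {0..} \<longleftrightarrow> (f has_integral y) {0<..}"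
proof (rule has_integral_spike_set_eq)
  show "negligible {x \<in> {0..} - {0<..}. f x \<noteq> 0}"
    by (rule negligible_subset[of "{0}"]) auto
  have "{x \<in> {0<..} - {0..}. f x \<noteq> 0} = {}" by auto
  thus "negligible {x \<in> {0<..} - {0..}. f x \<noteq> 0}" by (simp only: negligible_empty)
qed

text \<open>Substitution of \<open>b * u ^ 4\<close> in the Gamma integral: the Jacobian
  \<open>4 * b * u ^ 3\<close> times \<open>(b * u ^ 4) powr (1 / 4 - 1)\<close> is the constant
  \<open>4 * b powr (1 / 4)\<close>.\<close>

lemma quartic_has_integral:
  fixes b :: real
  assumes b: "b > 0"
  shows "((\<lambda>u. exp (- (b * u ^ 4))) has_integral (Gamma (1 / 4) / (4 * b powr (1 / 4)))) {0<..}"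
proof -
  define G where "G = (\<lambda>t::real. t powr (1 / 4 - 1) / exp t)"
  define g where "g = (\<lambda>u::real. b * u ^ 4)"
  have "(G has_integral Gamma (1 / 4)) {0..}" unfolding G_def by (rule Gamma_integral_real) simp
  hence Gi: "(G has_integral Gamma (1 / 4)) {0<..}"
    by (simp only: has_integral_half_line_iff)
  have Ga: "G absolutely_integrable_on {0<..}"
    by (rule nonnegative_absolutely_integrable_1) (use Gi in \<open>auto simp: G_def has_integral_iff\<close>)
  have img: "g ` {0<..} = {0<..}"
  proof (intro equalityI subsetI)
    fix y :: real assume y: "y \<in> {0<..}"
    hence "g (root 4 (y / b)) = y" "root 4 (y / b) > 0" using b by (auto simp: g_def)
    thus "y \<in> g ` {0<..}" by (metis greaterThan_iff image_eqI)
  qed (use b in \<open>auto simp: g_def\<close>)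
  have inj: "inj_on g {0<..}"
    using b by (auto simp: inj_on_def g_def power_eq_iff_eq_base)
  have dg: "(g has_field_derivative 4 * b * u ^ 3) (at u within {0<..})" for u
    unfolding g_def by (auto intro!: derivative_eq_intros)
  have "(\<lambda>u. \<bar>4 * b * u ^ 3\<bar> * G (g u)) absolutely_integrable_on {0<..} \<and>
    integral {0<..} (\<lambda>u. \<bar>4 * b * u ^ 3\<bar> * G (g u)) = Gamma (1 / 4)"
    using has_absolute_integral_change_of_variables_1'[of "{0<..}" g "\<lambda>u. 4 * b * u ^ 3" G "Gamma (1 / 4)"] dg inj Ga Gi
    unfolding img by (auto simp: has_integral_iff)
  hence "((\<lambda>u. \<bar>4 * b * u ^ 3\<bar> * G (g u)) has_integral Gamma (1 / 4)) {0<..}"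
    using set_lebesgue_integral_eq_integral(1) by (auto simp: has_integral_iff)
  moreover have "\<bar>4 * b * u ^ 3\<bar> * G (g u) = 4 * b powr (1 / 4) * exp (- (b * u ^ 4))" if "u \<in> {0<..}" for u
  proof -
    have u: "u > 0" using that by simp
    have "(u ^ 4) powr (1 / 4) = u"
    proof -
      have "u ^ 4 = u powr 4" using u by simp
      thus ?thesis using u by (simp only: powr_powr) simp
    qed
    hence "(b * u ^ 4) powr (1 / 4) = b powr (1 / 4) * u" using u b by (simp add: powr_mult)
    moreover have "(b * u ^ 4) powr (1 / 4 - 1) = (b * u ^ 4) powr (1 / 4) / (b * u ^ 4)"
      using u b by (subst powr_diff) simp
    ultimately have "G (g u) = b powr (1 / 4) * u / (b * u ^ 4) * exp (- (b * u ^ 4))"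
      by (simp only: G_def g_def exp_minus divide_inverse)
    moreover have "\<bar>4 * b * u ^ 3\<bar> = 4 * b * u ^ 3" using u b by simp
    moreover have "4 * b * u ^ 3 * (b powr (1 / 4) * u / (b * u ^ 4) * E) = 4 * b powr (1 / 4) * E" for E
      using u b by (simp add: power4_eq_xxxx power3_eq_cube)
    ultimately show ?thesis by (simp only:)
  qed
  ultimately have "((\<lambda>u. 4 * b powr (1 / 4) * exp (- (b * u ^ 4))) has_integral Gamma (1 / 4)) {0<..}"
    by (subst (asm) has_integral_cong) auto
  from has_integral_mult_right[OF this, of "1 / (4 * b powr (1 / 4))"] show ?thesis
    using b by simp
qed

lemma even_density_quartic:
  assumes b: "b > 0"
  shows "even_density (\<lambda>t. 2 / Gamma (1 / 4) * b powr (1 / 4) * exp (- b * t ^ 4))"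
proof
  define I where "I = Gamma (1 / 4 :: real) / (4 * b powr (1 / 4))"
  have Gp: "Gamma (1 / 4 :: real) > 0" by (rule Gamma_real_pos) simp
  have I: "I \<ge> 0" using Gp by (simp add: I_def)
  have "((\<lambda>u. exp (- (b * u ^ 4))) has_integral I) {0..}"
    unfolding I_def using quartic_has_integral[OF b]
    by (simp only: has_integral_half_line_iff)
  from nn_integral_has_integral_lebesgue[OF _ this]
  have "(\<integral>\<^sup>+x. ennreal (indicator {0..} x * exp (- (b * x ^ 4))) \<partial>lborel) = ennreal I" by simp
  hence "has_bochner_integral lborel (\<lambda>x. indicator {0..} x *\<^sub>R exp (- (b * x ^ 4))) I"
    using I by (intro has_bochner_integral_nn_integral) (auto simp: indicator_def)
  from has_bochner_integral_even_function[OF this]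
  have "has_bochner_integral lborel (\<lambda>x. exp (- (b * x ^ 4))) (2 * I)" by simp
  hence "has_bochner_integral lborel (\<lambda>x. C * exp (- (b * x ^ 4))) (C * (2 * I))" for C
    by (rule has_bochner_integral_mult_right)
  from this[of "2 / Gamma (1 / 4) * b powr (1 / 4)"] show "has_bochner_integral lborel (\<lambda>t. 2 / Gamma (1 / 4) * b powr (1 / 4) * exp (- b * t ^ 4)) 1"
    using Gp b by (simp add: I_def)
  show "continuous_on UNIV (\<lambda>t. 2 / Gamma (1 / 4) * b powr (1 / 4) * exp (- b * t ^ 4))"
    by (intro continuous_intros)
qed simp

section \<open>Reduction to the magnetization\<close>

lemma sum_product_PiE:
  fixes X :: "nat \<Rightarrow> real"
  shows "(\<Sum>f\<in>{0..<p} \<rightarrow>\<^sub>E {0..<N}. \<Prod>k<p. X (f k)) = (\<Sum>i<N. X i) ^ p"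
proof -
  have "(\<Sum>f\<in>{0..<p} \<rightarrow>\<^sub>E {0..<N}. \<Prod>k<p. X (f k)) = (\<Prod>k<p. \<Sum>i<N. X i)"
    using prod_sum_PiE[of "{..<p}" "\<lambda>_. {..<N}" "\<lambda>_. X"] by (simp add: lessThan_atLeast0)
  thus ?thesis by simp
qed

text \<open>The interaction sum factors into a power of the magnetization. \<open>I_fun\<close> is
  added back because \<open>H_fun\<close> contains it with a minus sign and the counting of
  configurations will supply it.\<close>

lemma cw_weight_eq:
  assumes "N > 0"
  shows "cw_weight \<beta> h p N X =
    exp (real N * (H_fun \<beta> h p (magnetization N X / real N) + I_fun (magnetization N X / real N)))"
proof -
  define M where "M = magnetization N X"
  have "real N powr (1 - real p) = real N / real N ^ p"
    using assms by (simp add: powr_diff powr_realpow)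
  hence "\<beta> * real N powr (1 - real p) * M ^ p + h * M = real N * (\<beta> * (M / real N) ^ p + h * (M / real N))"
    using assms by (simp add: power_divide distrib_left)
  thus ?thesis unfolding cw_weight_def sum_product_PiE
    by (simp add: M_def[symmetric] magnetization_def[symmetric] H_fun_def)
qed

lemma sum_cw_configs:
  fixes g :: "real \<Rightarrow> real"
  shows "(\<Sum>X\<in>{X\<in>cw_configs N. P (magnetization N X)}. g (magnetization N X)) =
    (\<Sum>k | k \<le> N \<and> P (2 * real k - real N). real (N choose k) * g (2 * real k - real N))"
proof -
  define \<psi> where "\<psi> = (\<lambda>y. if P y then g y else 0)"
  \<comment> \<open>Configurations correspond to their sets of plus spins; the restricted lambda
    gives the undefined value outside the sites, as extensional functions require.\<close>
  define c where "c = (\<lambda>S. \<lambda>i\<in>{0..<N}. if i \<in> S then 1 else - 1 :: real)"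
  have fin: "finite (cw_configs N)" unfolding cw_configs_def by (intro finite_PiE) auto
  have bij: "bij_betw c (Pow {0..<N}) (cw_configs N)"
  proof (rule bij_betw_byWitness[where f' = "\<lambda>X. {i\<in>{0..<N}. X i = 1}"])
    show "\<forall>S\<in>Pow {0..<N}. {i\<in>{0..<N}. c S i = 1} = S" by (auto simp: c_def)
    show "\<forall>X\<in>cw_configs N. c {i\<in>{0..<N}. X i = 1} = X"
    proof
      fix X assume "X \<in> cw_configs N"
      hence X: "X \<in> {0..<N} \<rightarrow>\<^sub>E {-1, 1}" by (simp add: cw_configs_def)
      show "c {i\<in>{0..<N}. X i = 1} = X"
      proof (rule ext)
        fix i show "c {i\<in>{0..<N}. X i = 1} i = X i"
          using X by (cases "i < N") (auto simp: c_def PiE_def Pi_def extensional_def)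
      qed
    qed
    show "c ` Pow {0..<N} \<subseteq> cw_configs N" by (auto simp: c_def cw_configs_def split: if_splits)
    show "(\<lambda>X. {i\<in>{0..<N}. X i = 1}) ` cw_configs N \<subseteq> Pow {0..<N}" by auto
  qed
  have mag: "magnetization N (c S) = 2 * real (card S) - real N" if "S \<in> Pow {0..<N}" for S
  proof -
    have S: "S \<subseteq> {..<N}" using that by auto
    have "magnetization N (c S) = (\<Sum>i<N. if i \<in> S then 1 else - 1)"
      unfolding magnetization_def by (intro sum.cong) (auto simp: c_def)
    also have "\<dots> = (\<Sum>i<N. 2 * (if i \<in> S then 1 else 0) - 1)" by (intro sum.cong) auto
    also have "\<dots> = 2 * (\<Sum>i<N. if i \<in> S then 1 else 0) - real N"
      by (simp add: sum_subtractf sum_distrib_left)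
    also have "(\<Sum>i<N. if i \<in> S then 1 else 0 :: real) = real (card S)"
      using S by (simp add: sum.If_cases Int_absorb1)
    finally show ?thesis .
  qed
  have "(\<Sum>X\<in>{X\<in>cw_configs N. P (magnetization N X)}. g (magnetization N X)) = (\<Sum>X\<in>cw_configs N. \<psi> (magnetization N X))"
    unfolding \<psi>_def using fin by (simp add: sum.inter_filter)
  also have "\<dots> = (\<Sum>S\<in>Pow {0..<N}. \<psi> (magnetization N (c S)))"
    by (rule sum.reindex_bij_betw[OF bij, symmetric])
  also have "\<dots> = (\<Sum>S\<in>Pow {0..<N}. \<psi> (2 * real (card S) - real N))"
    by (intro sum.cong) (simp_all add: mag)
  also have "\<dots> = (\<Sum>k\<le>N. \<Sum>S\<in>{S\<in>Pow {0..<N}. card S = k}. \<psi> (2 * real (card S) - real N))"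
  proof (rule sum.group[symmetric])
    show "card ` Pow {0..<N} \<subseteq> {..N}" using card_mono[of "{0..<N}"] by fastforce
  qed auto
  also have "\<dots> = (\<Sum>k\<le>N. real (N choose k) * \<psi> (2 * real k - real N))"
  proof (intro sum.cong refl)
    fix k
    have "(\<Sum>S\<in>{S\<in>Pow {0..<N}. card S = k}. \<psi> (2 * real (card S) - real N))
       = (\<Sum>S\<in>{S\<in>Pow {0..<N}. card S = k}. \<psi> (2 * real k - real N))" by (intro sum.cong) auto
    thus "(\<Sum>S\<in>{S\<in>Pow {0..<N}. card S = k}. \<psi> (2 * real (card S) - real N)) = real (N choose k) * \<psi> (2 * real k - real N)"
      using n_subsets[of "{0..<N}" k] by (simp add: Pow_def)
  qed
  also have "\<dots> = (\<Sum>k\<in>{k\<in>{..N}. P (2 * real k - real N)}. real (N choose k) * g (2 * real k - real N))"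
    by (subst sum.inter_filter) (auto simp: \<psi>_def intro!: sum.cong)
  also have "{k\<in>{..N}. P (2 * real k - real N)} = {k. k \<le> N \<and> P (2 * real k - real N)}" by auto
  finally show ?thesis .
qed

lemma sum_cw_weight:
  assumes "N > 0"
  shows "(\<Sum>X\<in>{X\<in>cw_configs N. P (magnetization N X)}. cw_weight \<beta> h p N X) =
    (\<Sum>k | k \<le> N \<and> P (2 * real k - real N). wt (H_fun \<beta> h p) N k)"
  unfolding cw_weight_eq[OF assms] wt_def spin_def by (rule sum_cw_configs)

lemma cw_cond_prob_eq:
  assumes "N > 0"
  shows "cw_cond_prob \<beta> h p N (\<lambda>X. E (magnetization N X)) (\<lambda>X. G (magnetization N X)) =
    (\<Sum>k | k \<le> N \<and> G (2 * real k - real N) \<and> E (2 * real k - real N). wt (H_fun \<beta> h p) N k) /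
    (\<Sum>k | k \<le> N \<and> G (2 * real k - real N). wt (H_fun \<beta> h p) N k)"
proof -
  define T where "T = 2 ^ N * cw_Z \<beta> h p N"
  have "T = (\<Sum>X\<in>cw_configs N. cw_weight \<beta> h p N X)" by (simp add: T_def cw_Z_def)
  moreover have "(\<lambda>i\<in>{0..<N}. 1) \<in> cw_configs N" by (auto simp: cw_configs_def)
  hence "cw_configs N \<noteq> {}" by blast
  moreover have "finite (cw_configs N)" unfolding cw_configs_def by (intro finite_PiE) auto
  ultimately have T: "T > 0" by (auto intro!: sum_pos simp: cw_weight_def)
  have "cw_prob \<beta> h p N (\<lambda>X. P (magnetization N X)) = (\<Sum>k | k \<le> N \<and> P (2 * real k - real N). wt (H_fun \<beta> h p) N k) / T" for P
    unfolding cw_prob_def T_def[symmetric] sum_divide_distrib[symmetric] sum_cw_weight[OF assms] ..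
  from this[of "\<lambda>y. E y \<and> G y"] this[of G] T show ?thesis
    by (simp add: cw_cond_prob_def conj_commute)
qed

text \<open>Lets the unconditional statements be read as conditional ones with
  \<open>A = UNIV\<close>.\<close>

lemma cw_cond_prob_True:
  assumes "N > 0"
  shows "cw_cond_prob \<beta> h p N E (\<lambda>_. True) = cw_prob \<beta> h p N E"
proof -
  define T where "T = 2 ^ N * cw_Z \<beta> h p N"
  have T1: "T = (\<Sum>X\<in>cw_configs N. cw_weight \<beta> h p N X)" by (simp add: T_def cw_Z_def)
  moreover have "(\<lambda>i\<in>{0..<N}. 1) \<in> cw_configs N" by (auto simp: cw_configs_def)
  hence "cw_configs N \<noteq> {}" by blast
  moreover have "finite (cw_configs N)" unfolding cw_configs_def by (intro finite_PiE) auto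
  ultimately have T: "T > 0" by (auto intro!: sum_pos simp: cw_weight_def)
  have "cw_prob \<beta> h p N (\<lambda>_. True) = T / T"
    unfolding cw_prob_def T_def[symmetric] sum_divide_distrib[symmetric] by (simp add: T1)
  thus ?thesis using T by (simp add: cw_cond_prob_def)
qed

section \<open>Moderate deviations\<close>

text \<open>The common core of the three cases, which differ only in \<open>d\<close>, in
  \<open>A\<close> and in the tail \<open>Q\<close>.\<close>

lemma cw_moderate_deviation:
  fixes p d r :: nat and \<beta> h m a C0 :: real and Q :: "real \<Rightarrow> real" and A :: "real set"
  assumes p: "p \<ge> 3" and \<beta>: "\<beta> > 0" and h: "h > 0"
    and gm: "is_global_max \<beta> h p m"
    and A: "m \<in> interior A" "\<And>m'. is_global_max \<beta> h p m' \<Longrightarrow> m' \<in> closure A \<Longrightarrow> m' = m"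
    and d: "d = 2 \<or> d = 4" and tail: "tail_function a d Q"
    and deriv: "H_diff \<beta> h p d m / fact d = - a" "\<And>j. 0 < j \<Longrightarrow> j < d \<Longrightarrow> H_diff \<beta> h p j m = 0"
    and C0: "C0 > 0" and r: "r \<le> 1"
  shows "\<exists>K N0. \<forall>N\<ge>N0. \<forall>y\<in>{0..C0 * real N powr (1 / (real d * (real d + 1)))}.
     \<bar>cw_cond_prob \<beta> h p N
        (\<lambda>X. (- 1) ^ r * ((magnetization N X - real N * m) / real N powr (1 - 1 / real d)) > y)
        (\<lambda>X. magnetization N X / real N \<in> A) / (Q y / (2 * Q 0)) - 1\<bar>
     \<le> K * (1 + y ^ (d + 1)) * real N powr (- 1 / real d)"
proof -
  interpret tail_function a d Q by (rule tail)
  have loc: "\<exists>\<delta>>0. \<exists>L. \<forall>u. \<bar>u\<bar> \<le> \<delta> \<longrightarrow> \<bar>H_fun \<beta> h p (m + u) - H_fun \<beta> h p m + a * u ^ d\<bar> \<le> L * \<bar>u\<bar> ^ (d + 1)"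
  proof -
    have "d > 0" using d by auto
    from H_max_expansion[OF p \<beta> h gm this deriv(2)]
    obtain \<delta> L where L: "\<delta> > 0" "\<And>u. \<bar>u\<bar> \<le> \<delta> \<Longrightarrow>
      \<bar>H_fun \<beta> h p (m + u) - H_fun \<beta> h p m - H_diff \<beta> h p d m / fact d * u ^ d\<bar> \<le> L * \<bar>u\<bar> ^ (d + 1)"
      by blast
    show ?thesis
      by (rule exI[of _ \<delta>], rule conjI[OF L(1)], rule exI[of _ L]) (use L(2) deriv(1) in simp)
  qed
  have ed: "even d" "d > 0" using d by auto
  interpret laplace_peak a d Q "H_fun \<beta> h p" m A
  proof
    show "d = 2 \<or> d = 4" by (rule d)
    show "- 1 < m" "m < 1" using max_in_open[OF p \<beta> h gm] by auto
    obtain e where e: "e > 0" "ball m e \<subseteq> A" using A(1) by (auto simp: mem_interior)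
    have "s \<in> A" if "\<bar>s - m\<bar> \<le> e / 2" for s
      using that e by (intro subsetD[OF e(2)]) (auto simp: dist_real_def abs_minus_commute)
    thus "\<exists>e>0. \<forall>s. \<bar>s - m\<bar> \<le> e \<longrightarrow> s \<in> A" using e(1) by (intro exI[of _ "e / 2"]) auto
    show "\<exists>b>0. \<forall>s\<in>A \<inter> {- 1..1}. H_fun \<beta> h p s \<le> H_fun \<beta> h p m - b * \<bar>s - m\<bar> ^ d"
      by (rule global_bound_at_max[OF p \<beta> h gm ed(2) a_pos loc ed(1) A(2)])
  qed (rule loc)
  obtain K N0 where K: "\<And>N y. N \<ge> N0 \<Longrightarrow> y \<in> {0..C0 * window N} \<Longrightarrow>
    \<bar>(\<Sum>k | k \<le> N \<and> spin N k \<in> A \<and> (- 1) ^ r * scaled d m N k > y. wt (H_fun \<beta> h p) N k) /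
      (\<Sum>k | k \<le> N \<and> spin N k \<in> A. wt (H_fun \<beta> h p) N k) / (Q y / (2 * Q 0)) - 1\<bar>
      \<le> K * (1 + y ^ (d + 1)) * real N powr (- 1 / real d)"
    using moderate_deviation_ratio[OF C0 r] by blast
  show ?thesis
  proof (intro exI[of _ K] exI[of _ "max 1 N0"] allI impI ballI)
    fix N y assume N: "max 1 N0 \<le> N" and y: "y \<in> {0..C0 * real N powr (1 / (real d * (real d + 1)))}"
    have N': "N > 0" "N \<ge> N0" using N by auto
    show "\<bar>cw_cond_prob \<beta> h p N
        (\<lambda>X. (- 1) ^ r * ((magnetization N X - real N * m) / real N powr (1 - 1 / real d)) > y)
        (\<lambda>X. magnetization N X / real N \<in> A) / (Q y / (2 * Q 0)) - 1\<bar>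
      \<le> K * (1 + y ^ (d + 1)) * real N powr (- 1 / real d)"
      using K[OF N'(2), of y] y
      unfolding window_def spin_def scaled_def
        cw_cond_prob_eq[OF N'(1), of \<beta> h p "\<lambda>M. (- 1) ^ r * ((M - real N * m) / real N powr (1 - 1 / real d)) > y" "\<lambda>M. M / real N \<in> A"]
      by simp
  qed
qed

section \<open>Identification of the limit laws and the three regimes\<close>

lemma Phi_eq_cdf: "Phi x = even_density.cdf std_normal_density x"
  by (simp add: Phi_def even_density.cdf_def[OF even_density_std_normal])

lemma cw_gaussian_fluctuation:
  fixes p r :: nat and \<beta> h m :: real and A :: "real set"
  assumes p: "p \<ge> 3" and \<beta>: "\<beta> > 0" and h: "h > 0"
    and gm: "is_global_max \<beta> h p m"
    and A: "m \<in> interior A" "\<And>m'. is_global_max \<beta> h p m' \<Longrightarrow> m' \<in> closure A \<Longrightarrow> m' = m"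
    and neg: "(deriv ^^ 2) (H_fun \<beta> h p) m < 0" and r: "r \<le> 1"
  shows "\<exists>K N0. \<forall>N\<ge>N0. \<forall>x\<in>{0..1 * real N powr (1/6)}.
     \<bar>cw_cond_prob \<beta> h p N
        (\<lambda>X. (- 1) ^ r * ((magnetization N X - real N * m) / sqrt (- real N / (deriv ^^ 2) (H_fun \<beta> h p) m)) > x)
        (\<lambda>X. magnetization N X / real N \<in> A) / (1 - Phi x) - 1\<bar>
     \<le> K * (1 + x ^ 3) / sqrt (real N)"
proof -
  interpret E: even_density std_normal_density by (rule even_density_std_normal)
  define H2 where "H2 = (deriv ^^ 2) (H_fun \<beta> h p) m"
  have H2: "H2 < 0" "H_diff \<beta> h p 2 m = H2"
    using neg max_in_open[OF p \<beta> h gm] by (simp_all only: H2_def H_fun_deriv_funpow)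
  define \<sigma> where "\<sigma> = 1 / sqrt (- H2)"
  have \<sigma>: "\<sigma> > 0" "\<sigma>\<^sup>2 = - 1 / H2" using H2 by (auto simp: \<sigma>_def power_divide)
  define a where "a = - H2 / 2"
  \<comment> \<open>The Gaussian tail integral of \<open>exp (- a * t\<^sup>2)\<close> with variance
    \<open>- 1 / H2\<close>, in the lattice variable scaled by \<open>sqrt N\<close> alone.\<close>
  define Q where "Q = (\<lambda>y. \<sigma> * sqrt (2 * pi) * (1 - E.cdf (y / \<sigma>)))"
  have tail: "tail_function a 2 Q"
    unfolding Q_def
  proof (rule E.tail_function_scaled_cdf)
    fix y :: real
    have s: "1 / \<sigma>\<^sup>2 = - H2" using \<sigma>(2) H2 by simp
    have "(y / \<sigma>)\<^sup>2 / 2 = y\<^sup>2 * (1 / \<sigma>\<^sup>2) / 2" by (simp add: power_divide)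
    also have "\<dots> = a * y\<^sup>2" unfolding s a_def by simp
    finally have "(y / \<sigma>)\<^sup>2 / 2 = a * y\<^sup>2" .
    hence "std_normal_density (y / \<sigma>) = 1 / sqrt (2 * pi) * exp (- a * y\<^sup>2)"
      by (simp add: std_normal_density_def)
    thus "\<sigma> * sqrt (2 * pi) * std_normal_density (y / \<sigma>) / \<sigma> = exp (- a * y ^ 2)" using \<sigma> by simp
  qed (use H2 \<sigma> in \<open>auto simp: a_def\<close>)
  have Q: "Q (\<sigma> * x) / (2 * Q 0) = 1 - Phi x" for x
    using \<sigma> by (simp add: Q_def E.cdf_0 Phi_eq_cdf)
  have 1: "H_diff \<beta> h p 2 m / fact 2 = - a" using H2 by (simp add: a_def)
  have 2: "H_diff \<beta> h p j m = 0" if "0 < j" "j < 2" for j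
  proof -
    have "j = Suc 0" using that by simp
    thus ?thesis using first_derivative_at_max[OF p \<beta> h gm] by (simp only:)
  qed
  \<comment> \<open>The level \<open>x\<close> corresponds to \<open>y = \<sigma> * x\<close>, so
    the range constant \<sigma> covers all \<open>x\<close> up to
    \<open>N powr (1 / 6)\<close>.\<close>
  obtain K N0 where K: "\<And>N y. N \<ge> N0 \<Longrightarrow> y \<in> {0..\<sigma> * real N powr (1 / (real 2 * (real 2 + 1)))} \<Longrightarrow>
     \<bar>cw_cond_prob \<beta> h p N
        (\<lambda>X. (- 1) ^ r * ((magnetization N X - real N * m) / real N powr (1 - 1 / real 2)) > y)
        (\<lambda>X. magnetization N X / real N \<in> A) / (Q y / (2 * Q 0)) - 1\<bar>
     \<le> K * (1 + y ^ (2 + 1)) * real N powr (- 1 / real 2)"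
    using cw_moderate_deviation[OF p \<beta> h gm A _ tail 1 2 \<sigma>(1) r] by blast
  show ?thesis
  proof (intro exI[of _ "\<bar>K\<bar> * (1 + \<sigma> ^ 3)"] exI[of _ "max 1 N0"] allI impI ballI)
    fix N x assume N: "max 1 N0 \<le> N" and x: "x \<in> {0..1 * real N powr (1/6)}"
    have N': "N > 0" "N \<ge> N0" using N by auto
    have s: "sqrt (- real N / H2) = \<sigma> * sqrt (real N)"
      using H2 by (simp add: \<sigma>_def real_sqrt_divide[symmetric] real_sqrt_mult[symmetric] divide_simps)
    have powr: "real N powr (1 - 1 / real 2) = sqrt (real N)" "real N powr (- 1 / real 2) = 1 / sqrt (real N)"
    proof -
      have "1 - 1 / real 2 = 1 / 2" "- 1 / real 2 = - (1 / 2)" by simp_all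
      thus "real N powr (1 - 1 / real 2) = sqrt (real N)" "real N powr (- 1 / real 2) = 1 / sqrt (real N)"
        by (simp_all only: powr_minus powr_half_sqrt[OF of_nat_0_le_iff] inverse_eq_divide)
    qed
    have ev: "((- 1) ^ r * ((M - real N * m) / sqrt (- real N / H2)) > x)
      = ((- 1) ^ r * ((M - real N * m) / real N powr (1 - 1 / real 2)) > \<sigma> * x)" for M
    proof -
      have "(- 1) ^ r * ((M - real N * m) / (\<sigma> * sqrt (real N))) = (- 1) ^ r * ((M - real N * m) / sqrt (real N)) / \<sigma>"
        by simp
      thus ?thesis unfolding s powr by (simp only: pos_less_divide_eq[OF \<sigma>(1)] mult.commute)
    qed
    have "\<sigma> * x \<in> {0..\<sigma> * real N powr (1 / (real 2 * (real 2 + 1)))}" using x \<sigma>(1) by simp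
    from K[OF N'(2) this]
    have "\<bar>cw_cond_prob \<beta> h p N
        (\<lambda>X. (- 1) ^ r * ((magnetization N X - real N * m) / sqrt (- real N / H2)) > x)
        (\<lambda>X. magnetization N X / real N \<in> A) / (1 - Phi x) - 1\<bar>
      \<le> K * (1 + (\<sigma> * x) ^ (2 + 1)) * real N powr (- 1 / real 2)"
      unfolding ev Q .
    also have "\<dots> \<le> (\<bar>K\<bar> * ((1 + \<sigma> ^ 3) * (1 + x ^ 3))) * (1 / sqrt (real N))"
      unfolding powr
    proof (intro mult_right_mono mult_mono)
      have "0 \<le> \<sigma> ^ 3" "0 \<le> x ^ 3" using \<sigma> x by auto
      thus "1 + (\<sigma> * x) ^ (2 + 1) \<le> (1 + \<sigma> ^ 3) * (1 + x ^ 3)"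
        by (simp add: power_mult_distrib algebra_simps numeral_3_eq_3)
    qed (use x \<sigma> in auto)
    finally show "\<bar>cw_cond_prob \<beta> h p N
        (\<lambda>X. (- 1) ^ r * ((magnetization N X - real N * m) / sqrt (- real N / (deriv ^^ 2) (H_fun \<beta> h p) m)) > x)
        (\<lambda>X. magnetization N X / real N \<in> A) / (1 - Phi x) - 1\<bar>
      \<le> \<bar>K\<bar> * (1 + \<sigma> ^ 3) * (1 + x ^ 3) / sqrt (real N)"
      unfolding H2_def[symmetric] by (simp add: mult.assoc)
  qed
qed

lemma cw_special_fluctuation:
  fixes p r :: nat and \<beta> h m :: real
  assumes p: "p \<ge> 3" and \<beta>: "\<beta> > 0" and h: "h > 0"
    and gm: "is_global_max \<beta> h p m"
    and uniq: "\<And>m'. is_global_max \<beta> h p m' \<Longrightarrow> m' = m"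
    and zero: "(deriv ^^ 2) (H_fun \<beta> h p) m = 0" and r: "r \<le> 1"
  shows "\<exists>K N0. \<forall>N\<ge>N0. \<forall>x\<in>{0..1 * real N powr (1/20)}.
     \<bar>cw_prob \<beta> h p N
        (\<lambda>X. (- 1) ^ r * ((magnetization N X - real N * m) / real N powr (3/4)) > x)
        / (1 - F_special ((deriv ^^ 4) (H_fun \<beta> h p) m) x) - 1\<bar>
     \<le> K * (1 + x ^ 5) / real N powr (1/4)"
proof -
  define c where "c = (deriv ^^ 4) (H_fun \<beta> h p) m"
  have H2: "H_diff \<beta> h p 2 m = 0" and H4: "H_diff \<beta> h p 4 m = c"
    using zero max_in_open[OF p \<beta> h gm] by (simp_all only: c_def H_fun_deriv_funpow)
  have c: "c < 0" using degenerate_max(2)[OF p \<beta> h gm H2] by (simp only: H4)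
  define a where "a = - c / 24"
  have a: "a > 0" using c by (simp add: a_def)
  define g where "g = (\<lambda>t. 2 / Gamma (1 / 4) * a powr (1 / 4) * exp (- a * t ^ 4))"
  interpret E: even_density g unfolding g_def by (rule even_density_quartic[OF a])
  have Gp: "Gamma (1 / 4 :: real) > 0" by (rule Gamma_real_pos) simp
  have F: "F_special c x = E.cdf x" for x
    unfolding F_special_def E.cdf_def unfolding g_def a_def by simp
  define Q where "Q = (\<lambda>y. Gamma (1 / 4) / (2 * a powr (1 / 4)) * (1 - E.cdf (y / 1)))"
  have tail: "tail_function a 4 Q"
    unfolding Q_def
  proof (rule E.tail_function_scaled_cdf)
    show "Gamma (1 / 4) / (2 * a powr (1 / 4)) * g (y / 1) / 1 = exp (- a * y ^ 4)" for y
    proof -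
      have cancel: "G / (2 * b) * (2 / G * b * e) = e" if "G > 0" "b > 0" for G b e :: real
        using that by simp
      have "a powr (1 / 4) > 0" using a by simp
      from cancel[OF Gp this] show ?thesis unfolding g_def div_by_1 .
    qed
  qed (use a in auto)
  have Q: "Q x / (2 * Q 0) = 1 - F_special c x" for x
  proof -
    have "Gamma (1 / 4) / (2 * a powr (1 / 4)) > 0" using a Gp by (intro divide_pos_pos) auto
    moreover have "k * (1 - y) / (2 * (k * (1 - 1 / 2))) = 1 - y" if "k > 0" for k y :: real
      using that by simp
    ultimately show ?thesis by (simp only: Q_def F div_by_1 E.cdf_0)
  qed
  have 1: "H_diff \<beta> h p 4 m / fact 4 = - a" unfolding H4 by (simp add: a_def fact_numeral)
  have 2: "H_diff \<beta> h p j m = 0" if "0 < j" "j < 4" for j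
  proof -
    have "j = Suc 0 \<or> j = 2 \<or> j = 3" using that by auto
    thus ?thesis using first_derivative_at_max[OF p \<beta> h gm] third_derivative_zero[OF p \<beta> h gm H2] H2 by (elim disjE) (simp_all only:)
  qed
  obtain K N0 where K: "\<And>N y. N \<ge> N0 \<Longrightarrow> y \<in> {0..1 * real N powr (1 / (real 4 * (real 4 + 1)))} \<Longrightarrow>
     \<bar>cw_cond_prob \<beta> h p N
        (\<lambda>X. (- 1) ^ r * ((magnetization N X - real N * m) / real N powr (1 - 1 / real 4)) > y)
        (\<lambda>X. magnetization N X / real N \<in> UNIV) / (Q y / (2 * Q 0)) - 1\<bar>
     \<le> K * (1 + y ^ (4 + 1)) * real N powr (- 1 / real 4)"
  proof -
    have "m \<in> interior UNIV" "\<And>m'. is_global_max \<beta> h p m' \<Longrightarrow> m' \<in> closure UNIV \<Longrightarrow> m' = m" "(4::nat) = 2 \<or> (4::nat) = 4"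
      using uniq by simp_all
    from cw_moderate_deviation[OF p \<beta> h gm this tail 1 2 zero_less_one r] that show thesis by blast
  qed
  show ?thesis
  proof (intro exI[of _ K] exI[of _ "max 1 N0"] allI impI ballI)
    fix N x assume N: "max 1 N0 \<le> N" and x: "x \<in> {0..1 * real N powr (1/20)}"
    have N': "N > 0" "N \<ge> N0" using N by auto
    have x': "x \<in> {0..1 * real N powr (1 / (real 4 * (real 4 + 1)))}" using x by simp
    have e: "1 - 1 / real 4 = 3 / 4" "(4::nat) + 1 = 5" by simp_all
    have P: "real N powr (- 1 / real 4) = 1 / real N powr (1/4)"
    proof -
      have "- 1 / real 4 = - (1 / 4)" by simp
      thus ?thesis by (simp only: powr_minus inverse_eq_divide)
    qed
    show "\<bar>cw_prob \<beta> h p N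
        (\<lambda>X. (- 1) ^ r * ((magnetization N X - real N * m) / real N powr (3/4)) > x)
        / (1 - F_special ((deriv ^^ 4) (H_fun \<beta> h p) m) x) - 1\<bar>
      \<le> K * (1 + x ^ 5) / real N powr (1/4)"
      using K[OF N'(2) x'] by (simp only: c_def[symmetric] Q UNIV_I cw_cond_prob_True[OF N'(1)] e P times_divide_eq_right mult_1_right)
  qed
qed

theorem theorem3p1:
  fixes p :: nat and \<beta> h :: real
  assumes "p \<ge> 3" and "\<beta> > 0" and "h > 0"
  shows "\<exists>C>0.
    (p_regular \<beta> h p \<longrightarrow>
       (\<forall>m. is_global_max \<beta> h p m \<longrightarrow>
         (\<forall>r::nat. r \<le> 1 \<longrightarrow>
           (\<exists>K N0. \<forall>N\<ge>N0. \<forall>x\<in>{0..C * real N powr (1/6)}.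
              \<bar>cw_prob \<beta> h p N
                   (\<lambda>X. (-1) ^ r * ((magnetization N X - real N * m)
                          / sqrt (- real N / (deriv ^^ 2) (H_fun \<beta> h p) m)) > x)
                 / (1 - Phi x) - 1\<bar>
              \<le> K * (1 + x ^ 3) / sqrt (real N)))))
  \<and> (p_critical \<beta> h p \<longrightarrow>
       (\<forall>m A. is_global_max \<beta> h p m \<longrightarrow> m \<in> interior A \<longrightarrow>
          (\<forall>m'. is_global_max \<beta> h p m' \<and> m' \<in> closure A \<longrightarrow> m' = m) \<longrightarrow>
         (\<forall>r::nat. r \<le> 1 \<longrightarrow>
           (\<exists>K N0. \<forall>N\<ge>N0. \<forall>x\<in>{0..C * real N powr (1/6)}.
              \<bar>cw_cond_prob \<beta> h p N
                   (\<lambda>X. (-1) ^ r * ((magnetization N X - real N * m)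
                          / sqrt (- real N / (deriv ^^ 2) (H_fun \<beta> h p) m)) > x)
                   (\<lambda>X. magnetization N X / real N \<in> A)
                 / (1 - Phi x) - 1\<bar>
              \<le> K * (1 + x ^ 3) / sqrt (real N)))))
  \<and> (p_special \<beta> h p \<longrightarrow>
       (\<forall>m. is_global_max \<beta> h p m \<longrightarrow>
         (\<forall>r::nat. r \<le> 1 \<longrightarrow>
           (\<exists>K N0. \<forall>N\<ge>N0. \<forall>x\<in>{0..C * real N powr (1/20)}.
              \<bar>cw_prob \<beta> h p N
                   (\<lambda>X. (-1) ^ r * ((magnetization N X - real N * m)
                          / real N powr (3/4)) > x)
                 / (1 - F_special ((deriv ^^ 4) (H_fun \<beta> h p) m) x) - 1\<bar>
              \<le> K * (1 + x ^ 5) / real N powr (1/4)))))"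
\<comment> \<open>The core estimate holds for any range constant, with \<open>K\<close> and
  \<open>N0\<close> depending on it; 1 is a convenient choice.\<close>
proof (rule exI[of _ 1], rule conjI[OF zero_less_one], intro conjI impI allI)
  fix m and r :: nat
  assume reg: "p_regular \<beta> h p" and gm: "is_global_max \<beta> h p m" and r: "r \<le> 1"
  have neg: "(deriv ^^ 2) (H_fun \<beta> h p) m < 0" and uniq: "\<And>m'. is_global_max \<beta> h p m' \<Longrightarrow> m' = m"
    using reg gm unfolding p_regular_def by blast+
  obtain K N0 where K: "\<And>N x. N \<ge> N0 \<Longrightarrow> x \<in> {0..1 * real N powr (1/6)} \<Longrightarrow>
     \<bar>cw_cond_prob \<beta> h p N
        (\<lambda>X. (- 1) ^ r * ((magnetization N X - real N * m) / sqrt (- real N / (deriv ^^ 2) (H_fun \<beta> h p) m)) > x)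
        (\<lambda>X. magnetization N X / real N \<in> UNIV) / (1 - Phi x) - 1\<bar>
     \<le> K * (1 + x ^ 3) / sqrt (real N)"
  proof -
    have "m \<in> interior UNIV" "\<And>m'. is_global_max \<beta> h p m' \<Longrightarrow> m' \<in> closure UNIV \<Longrightarrow> m' = m"
      using uniq by simp_all
    from cw_gaussian_fluctuation[OF assms gm this neg r] that show thesis by blast
  qed
  show "\<exists>K N0. \<forall>N\<ge>N0. \<forall>x\<in>{0..1 * real N powr (1/6)}.
              \<bar>cw_prob \<beta> h p N
                   (\<lambda>X. (-1) ^ r * ((magnetization N X - real N * m)
                          / sqrt (- real N / (deriv ^^ 2) (H_fun \<beta> h p) m)) > x)
                 / (1 - Phi x) - 1\<bar>
              \<le> K * (1 + x ^ 3) / sqrt (real N)"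
  proof (intro exI[of _ K] exI[of _ "max 1 N0"] allI impI ballI)
    fix N x assume N: "max 1 N0 \<le> N" and x: "x \<in> {0..1 * real N powr (1/6)}"
    have N': "N > 0" "N \<ge> N0" using N by auto
    show "\<bar>cw_prob \<beta> h p N
                   (\<lambda>X. (-1) ^ r * ((magnetization N X - real N * m)
                          / sqrt (- real N / (deriv ^^ 2) (H_fun \<beta> h p) m)) > x)
                 / (1 - Phi x) - 1\<bar>
              \<le> K * (1 + x ^ 3) / sqrt (real N)"
      using K[OF N'(2) x] by (simp only: UNIV_I cw_cond_prob_True[OF N'(1)])
  qed
next
  fix m A and r :: nat
  assume crit: "p_critical \<beta> h p" and gm: "is_global_max \<beta> h p m" and A: "m \<in> interior A"
    "\<forall>m'. is_global_max \<beta> h p m' \<and> m' \<in> closure A \<longrightarrow> m' = m" and r: "r \<le> 1"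
  obtain m' where m': "is_global_max \<beta> h p m'" "m \<noteq> m'" using crit unfolding p_critical_def by metis
  have "(deriv ^^ 2) (H_fun \<beta> h p) m < 0"
    using critical_nondegenerate[OF assms gm m'] max_in_open[OF assms gm] by (simp only: H_fun_deriv_funpow)
  thus "\<exists>K N0. \<forall>N\<ge>N0. \<forall>x\<in>{0..1 * real N powr (1/6)}.
              \<bar>cw_cond_prob \<beta> h p N
                   (\<lambda>X. (-1) ^ r * ((magnetization N X - real N * m)
                          / sqrt (- real N / (deriv ^^ 2) (H_fun \<beta> h p) m)) > x)
                   (\<lambda>X. magnetization N X / real N \<in> A)
                 / (1 - Phi x) - 1\<bar>
              \<le> K * (1 + x ^ 3) / sqrt (real N)"
    using A by (intro cw_gaussian_fluctuation[OF assms gm A(1) _ _ r]) blast+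
next
  fix m and r :: nat
  assume special: "p_special \<beta> h p" and gm: "is_global_max \<beta> h p m" and r: "r \<le> 1"
  have "(deriv ^^ 2) (H_fun \<beta> h p) m = 0" "\<And>m'. is_global_max \<beta> h p m' \<Longrightarrow> m' = m"
    using special gm unfolding p_special_def by blast+
  thus "\<exists>K N0. \<forall>N\<ge>N0. \<forall>x\<in>{0..1 * real N powr (1/20)}.
              \<bar>cw_prob \<beta> h p N
                   (\<lambda>X. (-1) ^ r * ((magnetization N X - real N * m)
                          / real N powr (3/4)) > x)
                 / (1 - F_special ((deriv ^^ 4) (H_fun \<beta> h p) m) x) - 1\<bar>
              \<le> K * (1 + x ^ 5) / real N powr (1/4)"
    using r by (intro cw_special_fluctuation[OF assms gm])
qed

end
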